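(* Write $\omega_m=e^{2\pi i/m}$, and for $a\in\mathbb C^*$ and $M\in GL(3)$ let $(1,a)\times M\in PGL(6)$ denote the class of $\mathrm{diag}(1,a)\otimes M$. Abelian automorphism groups of smooth cubic fourfolds which are conjugate to subgroups of $D_2\otimes\mathcal P_3\subset PGL(6)=\mathrm{Aut}(\mathbb P^5)$ are either diagonalizable or (up to conjugation) subgroups of the following groups, each of which acts effectively on some smooth cubic fourfold: (a) for $i,j\in\{0,1,2\}$, the group generated by $(1,\omega_3)\times 1$, $(1,\omega_9^{\,i})\times P_3$ and $(1,\omega_9^{\,j})\times W_3$; it is isomorphic to $(\mathbb Z/3\mathbb Z)^{\oplus 3}$ if $i=j=0$ and to $\mathbb Z/9\mathbb Z\oplus\mathbb Z/3\mathbb Z$ otherwise; (b) for $i,j\in\{0,1,2\}$, the group generated by $(1,-1)\times 1$, $(1,\omega_6^{\,i})\times P_3$ and $(1,\omega_6^{\,j})\times W_3$; it is isomorphic to $\mathbb Z/2\mathbb Z\oplus(\mathbb Z/3\mathbb Z)^{\oplus 2}$; (c) for $i,j\in\{0,1,2\}$, the group generated by $(1,\omega_3^{\,i})\times P_3$ and $(1,\omega_3^{\,j})\times W_3$; it is isomorphic to $(\mathbb Z/3\mathbb Z)^{\oplus 2}$.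
   Context: The base field is $\mathbb C$. A finite subgroup $G\subset PGL(6)$ is an automorphism group of a smooth cubic fourfold if there is a smooth cubic hypersurface $X\subset\mathbb P^5$ with $g(X)\subset X$ for all $g\in G$. It is diagonalizable if the inclusion $G\hookrightarrow PGL(6)$ factors through a homomorphism $G\to GL(6)$; for finite abelian $G$ this means that $G$ is conjugate to a group of classes of diagonal matrices. $D_n\subset PGL(n)$ is the subgroup of classes of diagonal matrices. The Pauli subgroup $\mathcal P_3\subset PGL(3)$ is generated by the classes of $$P_3=\begin{pmatrix}0&1&0\\0&0&1\\1&0&0\end{pmatrix},\qquad W_3=\begin{pmatrix}1&0&0\\0&\omega_3&0\\0&0&\omega_3^2\end{pmatrix};$$ it is isomorphic to $\mathbb Z/3\mathbb Z\oplus\mathbb Z/3\mathbb Z$. $D_2\otimes\mathcal P_3\subset PGL(6)$ is the group of classes of tensor (Kronecker) products $A\otimes B$ with $A$ representing an element of $D_2$ and $B$ representing an element of $\mathcal P_3$, acting on $\mathbb C^6=\mathbb C^2\otimes\mathbb C^3$. *)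

theory Defs
  imports
    Complex_Main
    "Jordan_Normal_Form.Matrix"
    "HOL-Algebra.Group_Action"
    "HOL-Algebra.Generated_Groups"
    "HOL-Algebra.Elementary_Groups"
begin

definition GL :: "nat \<Rightarrow> complex mat monoid" where
  "GL n = units_of (ring_mat TYPE(complex) n ())"

definition scalar_mats :: "nat \<Rightarrow> complex mat set" where
  "scalar_mats n = {c \<cdot>\<^sub>m 1\<^sub>m n | c. c \<noteq> 0}"

definition PGL :: "nat \<Rightarrow> complex mat set monoid" where
  "PGL n = GL n Mod scalar_mats n"

definition mat_class :: "nat \<Rightarrow> complex mat \<Rightarrow> complex mat set" where
  "mat_class n A = scalar_mats n #>\<^bsub>GL n\<^esub> A"

definition conjugate_in :: "('a, 'b) monoid_scheme \<Rightarrow> 'a set \<Rightarrow> 'a set \<Rightarrow> bool" where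
  "conjugate_in G H K \<longleftrightarrow>
     (\<exists>g\<in>carrier G. K = (\<lambda>h. g \<otimes>\<^bsub>G\<^esub> h \<otimes>\<^bsub>G\<^esub> inv\<^bsub>G\<^esub> g) ` H)"

text \<open>
  The point of the projective space of dimension \<open>n - 1\<close> with homogeneous coordinates \<open>v\<close>
  is the set of nonzero multiples of \<open>v\<close>, where \<open>v\<close> is a nonzero vector of length \<open>n\<close>.
\<close>

definition proj_point :: "complex vec \<Rightarrow> complex vec set" where
  "proj_point v = {c \<cdot>\<^sub>v v | c. c \<noteq> 0}"

text \<open>
  Both arguments are scaling classes, and the result is the class \<open>[A v]\<close> if they are
  \<open>[A]\<close> and \<open>[v]\<close>.
\<close>

definition proj_act :: "complex mat set \<Rightarrow> complex vec set \<Rightarrow> complex vec set" where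
  "proj_act g p = {A *\<^sub>v v | A v. A \<in> g \<and> v \<in> p}"

text \<open>
  Forms are represented by the polynomial functions they induce, which determine them over
  the complex numbers.  The coefficients \<open>c i j k\<close> are not required to be symmetric.
\<close>

definition cubic_form :: "nat \<Rightarrow> (complex vec \<Rightarrow> complex) \<Rightarrow> bool" where
  "cubic_form n F \<longleftrightarrow>
     (\<exists>c :: nat \<Rightarrow> nat \<Rightarrow> nat \<Rightarrow> complex. \<forall>x\<in>carrier_vec n.
        F x = (\<Sum>i<n. \<Sum>j<n. \<Sum>k<n. c i j k * x $ i * x $ j * x $ k))"

definition has_partial_derivative ::
    "nat \<Rightarrow> (complex vec \<Rightarrow> complex) \<Rightarrow> nat \<Rightarrow> complex \<Rightarrow> complex vec \<Rightarrow> bool" where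
  "has_partial_derivative n F i D x \<longleftrightarrow>
     ((\<lambda>t. F (x + t \<cdot>\<^sub>v unit_vec n i)) has_field_derivative D) (at 0)"

text \<open>
  The Jacobian criterion; it excludes \<open>F = 0\<close> when \<open>n > 0\<close>.
\<close>

definition smooth_form :: "nat \<Rightarrow> (complex vec \<Rightarrow> complex) \<Rightarrow> bool" where
  "smooth_form n F \<longleftrightarrow>
     (\<forall>x\<in>carrier_vec n. x \<noteq> 0\<^sub>v n \<and> F x = 0 \<longrightarrow>
        (\<exists>i<n. \<exists>D. D \<noteq> 0 \<and> has_partial_derivative n F i D x))"

definition hypersurface :: "nat \<Rightarrow> (complex vec \<Rightarrow> complex) \<Rightarrow> complex vec set set" where
  "hypersurface n F = {proj_point v | v. v \<in> carrier_vec n \<and> v \<noteq> 0\<^sub>v n \<and> F v = 0}"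

definition smooth_cubic_fourfold :: "complex vec set set \<Rightarrow> bool" where
  "smooth_cubic_fourfold X \<longleftrightarrow>
     (\<exists>F. cubic_form 6 F \<and> smooth_form 6 F \<and> X = hypersurface 6 F)"

definition cubic_fourfold_automorphism_group :: "complex mat set set \<Rightarrow> bool" where
  "cubic_fourfold_automorphism_group G \<longleftrightarrow>
     subgroup G (PGL 6) \<and> finite G \<and>
     (\<exists>X. smooth_cubic_fourfold X \<and> (\<forall>g\<in>G. proj_act g ` X \<subseteq> X))"

text \<open>
  The restriction to \<open>X\<close> is there because \<open>BijGroup X\<close> consists of extensional functions.
\<close>

definition acts_effectively_on :: "complex mat set set \<Rightarrow> complex vec set set \<Rightarrow> bool" where
  "acts_effectively_on G X \<longleftrightarrow>
     subgroup G (PGL 6) \<and>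
     faithful_action ((PGL 6)\<lparr>carrier := G\<rparr>) X (\<lambda>g. restrict (proj_act g) X)"

definition diagonalizable :: "complex mat set set \<Rightarrow> bool" where
  "diagonalizable G \<longleftrightarrow>
     (\<exists>\<phi> \<in> hom ((PGL 6)\<lparr>carrier := G\<rparr>) (GL 6). \<forall>g\<in>G. mat_class 6 (\<phi> g) = g)"

definition diag_PGL :: "nat \<Rightarrow> complex mat set set" where
  "diag_PGL n = {mat_class n A | A. A \<in> carrier (GL n) \<and> diagonal_mat A}"

definition omega :: "nat \<Rightarrow> complex" where
  "omega m = exp (2 * of_real pi * \<i> / of_nat m)"

definition P3 :: "complex mat" where
  "P3 = mat_of_rows_list 3 [[0, 1, 0], [0, 0, 1], [1, 0, 0]]"

definition W3 :: "complex mat" where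
  "W3 = mat_of_rows_list 3 [[1, 0, 0], [0, omega 3, 0], [0, 0, omega 3 ^ 2]]"

definition pauli3 :: "complex mat set set" where
  "pauli3 = generate (PGL 3) {mat_class 3 P3, mat_class 3 W3}"

definition kronecker :: "complex mat \<Rightarrow> complex mat \<Rightarrow> complex mat" where
  "kronecker A B = mat (dim_row A * dim_row B) (dim_col A * dim_col B)
     (\<lambda>(i, j). A $$ (i div dim_row B, j div dim_col B) * B $$ (i mod dim_row B, j mod dim_col B))"

definition D2_tensor_pauli3 :: "complex mat set set" where
  "D2_tensor_pauli3 = {mat_class 6 (kronecker A B) | A B.
     A \<in> carrier (GL 2) \<and> B \<in> carrier (GL 3) \<and>
     mat_class 2 A \<in> diag_PGL 2 \<and> mat_class 3 B \<in> pauli3}"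

text \<open>
  The class of the tensor product of \<open>diag (1, a)\<close> and \<open>M\<close>, written \<open>(1, a) \<times> M\<close>.
\<close>

definition diag_times :: "complex \<Rightarrow> complex mat \<Rightarrow> complex mat set" where
  "diag_times a M = mat_class 6 (kronecker (mat_of_rows_list 2 [[1, 0], [0, a]]) M)"

definition group_a :: "nat \<Rightarrow> nat \<Rightarrow> complex mat set set" where
  "group_a i j = generate (PGL 6)
     {diag_times (omega 3) (1\<^sub>m 3), diag_times (omega 9 ^ i) P3, diag_times (omega 9 ^ j) W3}"

definition group_b :: "nat \<Rightarrow> nat \<Rightarrow> complex mat set set" where
  "group_b i j = generate (PGL 6)
     {diag_times (-1) (1\<^sub>m 3), diag_times (omega 6 ^ i) P3, diag_times (omega 6 ^ j) W3}"

definition group_c :: "nat \<Rightarrow> nat \<Rightarrow> complex mat set set" where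
  "group_c i j = generate (PGL 6)
     {diag_times (omega 3 ^ i) P3, diag_times (omega 3 ^ j) W3}"

end

theory Submission
  imports Defs "HOL-Computational_Algebra.Fundamental_Theorem_Algebra"
begin

text \<open>
  Write \<open>(x, y)\<close> for the coordinates of \<open>\<complex>\<^sup>6 = \<complex>\<^sup>3 \<oplus> \<complex>\<^sup>3\<close>.  Every element of
  \<open>D\<^sub>2 \<otimes> P\<^sub>3\<close> is \<open>(1, a) \<times> P\<^sup>s W\<^sup>t\<close> for a unique \<open>a \<noteq> 0\<close> and unique \<open>s\<close>, \<open>t\<close> modulo 3, and these
  classes multiply as \<open>\<complex>\<^sup>* \<times> \<int>/3 \<times> \<int>/3\<close> (\<open>tensor_class_mult\<close>, \<open>tensor_class_eq_iff\<close>).  So all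
  questions about subgroups of \<open>D\<^sub>2 \<otimes> P\<^sub>3\<close> are arithmetic with triples \<open>(a, s, t)\<close>.

  \<^emph>\<open>The dichotomy.\<close>  Let \<open>K \<subseteq> D\<^sub>2 \<otimes> P\<^sub>3\<close> preserve a smooth cubic.  The image of \<open>K\<close> in
  \<open>P\<^sub>3 = (\<int>/3)\<^sup>2\<close> is either isotropic for the commutator form \<open>s t' - s' t\<close> or everything.  In
  the first case \<open>\<omega>\<^sub>3\<^bsup>s t\<^esup> P\<^sup>s W\<^sup>t\<close> is a multiplicative choice of representatives, so \<open>K\<close> is
  diagonalizable (\<open>diagonalizable_if_proportional\<close>).  In the second case \<open>K\<close> contains some
  \<open>(1, b) \<times> P\<close> and \<open>(1, c) \<times> W\<close> and is determined by \<open>b\<close>, \<open>c\<close> and the group \<open>N\<close> of all \<open>a\<close> with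
  \<open>(1, a) \<times> 1 \<in> K\<close>.

  \<^emph>\<open>The bound on \<open>N\<close>.\<close>  The geometry enters only here (\<open>smooth_cubic_two_weights\<close>): if
  \<open>(1, a) \<times> 1\<close> preserves a smooth cubic \<open>F = 0\<close>, then \<open>a\<^sup>2 = 1\<close> or \<open>a\<^sup>3 = 1\<close>.  Let \<open>f\<^sub>d\<close> be the part
  of \<open>F\<close> of degree \<open>d\<close> in \<open>y\<close>.  Smoothness along \<open>y = 0\<close> makes \<open>f\<^sub>0\<close> or \<open>f\<^sub>1\<close> nonzero, smoothness
  along \<open>x = 0\<close> makes \<open>f\<^sub>2\<close> or \<open>f\<^sub>3\<close> nonzero, so at a suitable point the polynomial
  \<open>F(x, t y) = \<Sum>\<^sub>d f\<^sub>d(x, y) t\<^sup>d\<close> in \<open>t\<close> is not a monomial and has a nonzero root.  Its at most three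
  roots are permuted by multiplication with \<open>a\<close>, whence \<open>a\<close> has order at most 3.  Looking at
  roots, and not at the equation \<open>F \<circ> g = \<chi> F\<close>, avoids the Nullstellensatz.

  Consequently \<open>N\<close> lies in \<open>\<mu>\<^sub>2\<close> or in \<open>\<mu>\<^sub>3\<close>; since \<open>b\<^sup>3, c\<^sup>3 \<in> N\<close>, the scalars \<open>b\<close> and \<open>c\<close> are sixth
  or ninth roots of unity, and \<open>K\<close> lies in a group of type (b) or (a) (\<open>subset_tensor_lift\<close>).

  \<^emph>\<open>The examples.\<close>  All listed groups have the same shape \<open>tensor_lift m i j\<close> with \<open>m = 9, 6, 3\<close>,
  which gives their isomorphism types.  They leave invariant the cubics
  \<open>\<Sum>\<^sub>k x\<^sub>k\<^sup>3 + \<Sum>\<^sub>k \<epsilon>\<^sup>k z\<^sub>k\<^sub>+\<^sub>r y\<^sub>k\<^sup>2\<close>, where \<open>z\<close> is \<open>x\<close> or \<open>y\<close> and \<open>\<epsilon>\<close>, \<open>r\<close> are adjusted to \<open>i\<close>, \<open>j\<close>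
  (\<open>smooth_pauli_cubic\<close>, \<open>pauli_cubic_invariant\<close>).  The action is effective because a nontrivial
  element of \<open>D\<^sub>2 \<otimes> P\<^sub>3\<close> always has a line without fixed points, and every line meets every cubic
  (\<open>trivial_on_cubic\<close>).
\<close>

section \<open>Matrices modulo scalars\<close>

lemma GL_simps:
  "mult (GL n) = (*)" "one (GL n) = 1\<^sub>m n"
  "carrier (GL n) = {A \<in> carrier_mat n n. \<exists>B\<in>carrier_mat n n. B * A = 1\<^sub>m n \<and> A * B = 1\<^sub>m n}"
  by (auto simp: GL_def units_of_def Units_def ring_mat_simps)

lemma group_GL: "group (GL n)"
  unfolding GL_def
  using ring_mat[where 'a = complex and n = n and b = "()"]
  by (intro monoid.units_group) (simp add: ring_def)

lemma scalar_in_GL: "c \<noteq> 0 \<Longrightarrow> c \<cdot>\<^sub>m 1\<^sub>m n \<in> carrier (GL n)"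
  by (auto simp: GL_simps intro!: bexI[of _ "inverse c \<cdot>\<^sub>m 1\<^sub>m n"] eq_matI)

lemma mat_class_eq:
  assumes "A \<in> carrier (GL n)"
  shows "mat_class n A = {c \<cdot>\<^sub>m A | c. c \<noteq> 0}"
  using assms
  by (auto simp: mat_class_def r_coset_def scalar_mats_def GL_simps)
     (metis left_mult_one_mat mult_smult_assoc_mat one_carrier_mat)+

lemma scalar_mats_normal: "scalar_mats n \<lhd> GL n"
proof -
  interpret group "GL n" by (rule group_GL)
  have sub: "subgroup (scalar_mats n) (GL n)"
  proof (rule subgroupI)
    show "scalar_mats n \<subseteq> carrier (GL n)"
      using scalar_in_GL by (auto simp: scalar_mats_def)
    have "1 \<cdot>\<^sub>m 1\<^sub>m n \<in> scalar_mats n" unfolding scalar_mats_def by (rule CollectI) (rule exI[of _ 1], simp)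
    then show "scalar_mats n \<noteq> {}" by blast
  next
    fix a assume "a \<in> scalar_mats n"
    then obtain c where c: "c \<noteq> 0" "a = c \<cdot>\<^sub>m 1\<^sub>m n" by (auto simp: scalar_mats_def)
    have "inv\<^bsub>GL n\<^esub> a = inverse c \<cdot>\<^sub>m 1\<^sub>m n"
      using c scalar_in_GL[of c n] scalar_in_GL[of "inverse c" n]
      by (intro inv_equality) (auto simp: GL_simps)
    then show "inv\<^bsub>GL n\<^esub> a \<in> scalar_mats n"
      using c by (auto simp: scalar_mats_def)
  next
    fix a b assume "a \<in> scalar_mats n" "b \<in> scalar_mats n"
    then obtain c d where "c \<noteq> 0" "a = c \<cdot>\<^sub>m 1\<^sub>m n" "d \<noteq> 0" "b = d \<cdot>\<^sub>m 1\<^sub>m n"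
      by (auto simp: scalar_mats_def)
    then show "a \<otimes>\<^bsub>GL n\<^esub> b \<in> scalar_mats n"
      by (auto simp: scalar_mats_def GL_simps intro!: exI[of _ "c * d"])
  qed
  show ?thesis
  proof (rule normalI[OF sub], intro ballI)
    fix x assume x: "x \<in> carrier (GL n)"
    then have "x * (c \<cdot>\<^sub>m 1\<^sub>m n) = (c \<cdot>\<^sub>m 1\<^sub>m n) * x" for c
      by (auto simp: GL_simps mult_smult_distrib mult_smult_assoc_mat[OF one_carrier_mat])
    then show "scalar_mats n #>\<^bsub>GL n\<^esub> x = x <#\<^bsub>GL n\<^esub> scalar_mats n"
      by (auto simp: r_coset_def l_coset_def GL_simps scalar_mats_def)
  qed
qed

lemma group_PGL: "group (PGL n)"
  unfolding PGL_def by (rule normal.factorgroup_is_group[OF scalar_mats_normal])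

lemma carrier_PGL: "carrier (PGL n) = mat_class n ` carrier (GL n)"
  by (auto simp: PGL_def carrier_FactGroup mat_class_def)

lemma mat_class_mult:
  assumes "A \<in> carrier (GL n)" "B \<in> carrier (GL n)"
  shows "mat_class n A \<otimes>\<^bsub>PGL n\<^esub> mat_class n B = mat_class n (A * B)"
  using normal.rcos_sum[OF scalar_mats_normal assms]
  by (simp add: PGL_def mat_class_def GL_simps)

lemma mat_class_one: "mat_class n (1\<^sub>m n) = \<one>\<^bsub>PGL n\<^esub>"
  using scalar_in_GL[of 1 n] mat_class_eq[of "1\<^sub>m n" n]
  by (simp add: PGL_def scalar_mats_def GL_simps)

lemma mat_class_inv:
  assumes "A \<in> carrier (GL n)"
  shows "inv\<^bsub>PGL n\<^esub> (mat_class n A) = mat_class n (inv\<^bsub>GL n\<^esub> A)"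
proof (rule group.inv_equality[OF group_PGL])
  have "inv\<^bsub>GL n\<^esub> A \<in> carrier (GL n)" using assms group.inv_closed[OF group_GL] by blast
  then show "mat_class n (inv\<^bsub>GL n\<^esub> A) \<otimes>\<^bsub>PGL n\<^esub> mat_class n A = \<one>\<^bsub>PGL n\<^esub>"
    using group.l_inv[OF group_GL assms] assms
    by (simp add: mat_class_mult mat_class_one[symmetric] GL_simps)
  show "mat_class n A \<in> carrier (PGL n)" "mat_class n (inv\<^bsub>GL n\<^esub> A) \<in> carrier (PGL n)"
    using assms \<open>inv\<^bsub>GL n\<^esub> A \<in> carrier (GL n)\<close> by (auto simp: carrier_PGL)
qed

lemma mat_class_eq_iff:
  assumes "A \<in> carrier (GL n)" "B \<in> carrier (GL n)"
  shows "mat_class n A = mat_class n B \<longleftrightarrow> (\<exists>c. c \<noteq> 0 \<and> A = c \<cdot>\<^sub>m B)"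
proof
  have "A = 1 \<cdot>\<^sub>m A" by (intro eq_matI) auto
  then have "A \<in> mat_class n A" unfolding mat_class_eq[OF assms(1)]
    by (intro CollectI exI[of _ 1]) auto
  then show "\<exists>c. c \<noteq> 0 \<and> A = c \<cdot>\<^sub>m B" if "mat_class n A = mat_class n B"
    using that mat_class_eq[OF assms(2)] by auto
next
  assume "\<exists>c. c \<noteq> 0 \<and> A = c \<cdot>\<^sub>m B"
  then obtain c where c: "c \<noteq> 0" "A = c \<cdot>\<^sub>m B" by blast
  show "mat_class n A = mat_class n B"
    unfolding mat_class_eq[OF assms(1)] mat_class_eq[OF assms(2)]
  proof (intro equalityI subsetI, goal_cases)
    case (1 x)
    then obtain d where "x = d \<cdot>\<^sub>m A" "d \<noteq> 0" by blast
    then show "x \<in> {c \<cdot>\<^sub>m B |c. c \<noteq> 0}"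
      using c by (intro CollectI exI[of _ "d * c"]) auto
  next
    case (2 x)
    then obtain d where "x = d \<cdot>\<^sub>m B" "d \<noteq> 0" by blast
    then show "x \<in> {c \<cdot>\<^sub>m A |c. c \<noteq> 0}"
      using c by (intro CollectI exI[of _ "d / c"]) auto
  qed
qed

lemma smult_GL: "c \<noteq> 0 \<Longrightarrow> A \<in> carrier (GL n) \<Longrightarrow> c \<cdot>\<^sub>m A \<in> carrier (GL n)"
  using monoid.m_closed[OF group.is_monoid[OF group_GL] scalar_in_GL[of c n], of A]
  by (auto simp: GL_simps mult_smult_assoc_mat[of _ n n _ n])

lemma mat_class_smult:
  assumes "c \<noteq> 0" "A \<in> carrier (GL n)"
  shows "mat_class n (c \<cdot>\<^sub>m A) = mat_class n A"
  using assms smult_GL mat_class_eq_iff by blast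

lemma proj_act_mat_class:
  assumes A: "A \<in> carrier (GL n)" and v: "v \<in> carrier_vec n"
  shows "proj_act (mat_class n A) (proj_point v) = proj_point (A *\<^sub>v v)"
proof -
  have *: "(c \<cdot>\<^sub>m A) *\<^sub>v (d \<cdot>\<^sub>v v) = (c * d) \<cdot>\<^sub>v (A *\<^sub>v v)" for c d
    using assms by (auto simp: GL_simps intro!: eq_vecI)
  show ?thesis
  proof (intro equalityI subsetI)
    fix w assume "w \<in> proj_act (mat_class n A) (proj_point v)"
    then obtain c d where "c \<noteq> 0" "d \<noteq> 0" "w = (c \<cdot>\<^sub>m A) *\<^sub>v (d \<cdot>\<^sub>v v)"
      unfolding proj_act_def mat_class_eq[OF A] proj_point_def by blast
    then show "w \<in> proj_point (A *\<^sub>v v)"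
      unfolding proj_point_def * by (intro CollectI exI[of _ "c * d"]) auto
  next
    fix w assume "w \<in> proj_point (A *\<^sub>v v)"
    then obtain c where c: "c \<noteq> 0" "w = c \<cdot>\<^sub>v (A *\<^sub>v v)"
      unfolding proj_point_def by blast
    then have "w = (c \<cdot>\<^sub>m A) *\<^sub>v (1 \<cdot>\<^sub>v v)" using *[of c 1] by simp
    moreover have "c \<cdot>\<^sub>m A \<in> mat_class n A" using c unfolding mat_class_eq[OF A] by blast
    moreover have "1 \<cdot>\<^sub>v v \<in> proj_point v" unfolding proj_point_def by (intro CollectI exI[of _ 1]) auto
    ultimately show "w \<in> proj_act (mat_class n A) (proj_point v)" unfolding proj_act_def by blast
  qed
qed

lemma proj_point_eq_iff:
  "proj_point v = proj_point w \<longleftrightarrow> (\<exists>c. c \<noteq> 0 \<and> v = c \<cdot>\<^sub>v w)"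
proof
  have "v \<in> proj_point v" unfolding proj_point_def by (intro CollectI exI[of _ 1]) auto
  then show "\<exists>c. c \<noteq> 0 \<and> v = c \<cdot>\<^sub>v w" if "proj_point v = proj_point w"
    using that unfolding proj_point_def by blast
next
  assume "\<exists>c. c \<noteq> 0 \<and> v = c \<cdot>\<^sub>v w"
  then obtain c where c: "c \<noteq> 0" "v = c \<cdot>\<^sub>v w" by blast
  show "proj_point v = proj_point w"
    unfolding proj_point_def
  proof (intro equalityI subsetI, goal_cases)
    case (1 x)
    then obtain d where "x = d \<cdot>\<^sub>v v" "d \<noteq> 0" by blast
    then show "x \<in> {c \<cdot>\<^sub>v w |c. c \<noteq> 0}"
      using c by (intro CollectI exI[of _ "d * c"]) (auto simp: smult_smult_assoc)
  next
    case (2 x)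
    then obtain d where "x = d \<cdot>\<^sub>v w" "d \<noteq> 0" by blast
    then show "x \<in> {c \<cdot>\<^sub>v v |c. c \<noteq> 0}"
      using c by (intro CollectI exI[of _ "d / c"]) (auto simp: smult_smult_assoc)
  qed
qed

lemma GL_mult_vec_nonzero:
  assumes A: "A \<in> carrier (GL n)" and v: "v \<in> carrier_vec n" "v \<noteq> 0\<^sub>v n"
  shows "A *\<^sub>v v \<noteq> 0\<^sub>v n"
proof
  assume eq: "A *\<^sub>v v = 0\<^sub>v n"
  obtain B where B: "B \<in> carrier_mat n n" "B * A = 1\<^sub>m n" and A': "A \<in> carrier_mat n n"
    using A by (auto simp: GL_simps)
  have "v = B *\<^sub>v (A *\<^sub>v v)"
    using B A' v by (simp flip: assoc_mult_mat_vec)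
  also have "\<dots> = 0\<^sub>v n" using eq B by (auto intro!: eq_vecI)
  finally show False using v by simp
qed

section \<open>Cubic forms\<close>

lemma cubic_form_cong:
  assumes "cubic_form n F" "\<And>x. x \<in> carrier_vec n \<Longrightarrow> G x = F x"
  shows "cubic_form n G"
  using assms unfolding cubic_form_def by simp

lemma cubic_form_add:
  assumes "cubic_form n F" "cubic_form n G"
  shows "cubic_form n (\<lambda>x. F x + G x)"
proof -
  from assms obtain c d where
    "\<forall>x\<in>carrier_vec n. F x = (\<Sum>i<n. \<Sum>j<n. \<Sum>k<n. c i j k * x $ i * x $ j * x $ k)"
    "\<forall>x\<in>carrier_vec n. G x = (\<Sum>i<n. \<Sum>j<n. \<Sum>k<n. d i j k * x $ i * x $ j * x $ k)"
    unfolding cubic_form_def by blast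
  then show ?thesis unfolding cubic_form_def
    by (intro exI[of _ "\<lambda>i j k. c i j k + d i j k"]) (simp add: algebra_simps sum.distrib)
qed

lemma cubic_form_sum:
  assumes "\<And>a. a \<in> S \<Longrightarrow> cubic_form n (f a)"
  shows "cubic_form n (\<lambda>x. \<Sum>a\<in>S. f a x)"
  using assms
proof (induction S rule: infinite_finite_induct)
  case (insert a S)
  then show ?case using cubic_form_add[of n "f a" "\<lambda>x. \<Sum>a\<in>S. f a x"] by simp
qed (auto simp: cubic_form_def intro!: exI[of _ "\<lambda>_ _ _. 0"])

lemma cubic_form_monomial:
  assumes "p < n" "q < n" "r < n"
  shows "cubic_form n (\<lambda>x. a * x $ p * x $ q * x $ r)"
proof -
  have "(\<Sum>i<n. \<Sum>j<n. \<Sum>k<n. (if i = p \<and> j = q \<and> k = r then a else 0) * x $ i * x $ j * x $ k)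
     = a * x $ p * x $ q * x $ r" for x
  proof -
    have "(if i = p \<and> j = q \<and> k = r then a else 0) * x $ i * x $ j * x $ k
        = (if k = r then if j = q then if i = p then a * x $ p * x $ q * x $ r else 0 else 0 else 0)" for i j k
      by simp
    then show ?thesis using assms by (simp del: if_split)
  qed
  then show ?thesis unfolding cubic_form_def
    by (intro exI[of _ "\<lambda>i j k. if i = p \<and> j = q \<and> k = r then a else 0"]) auto
qed

lemma cubic_form_smult:
  assumes "cubic_form n F" "x \<in> carrier_vec n"
  shows "F (c \<cdot>\<^sub>v x) = c ^ 3 * F x"
  using assms unfolding cubic_form_def
  by (auto simp: sum_distrib_left power3_eq_cube mult_ac intro!: sum.cong)

text \<open>
  The coefficient of the third power is recorded because it guarantees a root when it is nonzero.
\<close>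

lemma cubic_form_line:
  assumes "cubic_form n F" "u \<in> carrier_vec n" "v \<in> carrier_vec n"
  obtains p where "\<And>s. F (u + s \<cdot>\<^sub>v v) = poly p s" "coeff p 3 = F v"
proof -
  from assms obtain c where
    c: "\<And>x. x\<in>carrier_vec n \<Longrightarrow> F x = (\<Sum>i<n. \<Sum>j<n. \<Sum>k<n. c i j k * x $ i * x $ j * x $ k)"
    unfolding cubic_form_def by blast
  define p where "p = (\<Sum>i<n. \<Sum>j<n. \<Sum>k<n.
     smult (c i j k) ([:u $ i, v $ i:] * [:u $ j, v $ j:] * [:u $ k, v $ k:]))"
  have *: "coeff ([:u $ i, v $ i:] * [:u $ j, v $ j:] * [:u $ k, v $ k:]) 3 = v $ i * v $ j * v $ k" for i j k
    by (simp add: eval_nat_numeral)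
  show ?thesis
  proof
    show "F (u + s \<cdot>\<^sub>v v) = poly p s" for s
      using assms by (auto simp: c p_def poly_sum algebra_simps intro!: sum.cong)
    show "coeff p 3 = F v"
      unfolding c[OF assms(3)] p_def coeff_sum coeff_smult * by (simp add: mult_ac)
  qed
qed

lemma cubic_form_comp:
  assumes F: "cubic_form n F" and B: "B \<in> carrier_mat n n"
  shows "cubic_form n (\<lambda>x. F (B *\<^sub>v x))"
proof -
  obtain c where
    c: "\<And>x. x\<in>carrier_vec n \<Longrightarrow> F x = (\<Sum>i<n. \<Sum>j<n. \<Sum>k<n. c i j k * x $ i * x $ j * x $ k)"
    using F unfolding cubic_form_def by blast
  have "cubic_form n (\<lambda>x. \<Sum>i<n. \<Sum>j<n. \<Sum>k<n. \<Sum>p<n. \<Sum>q<n. \<Sum>r<n.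
      (c i j k * B $$ (i, p) * B $$ (j, q) * B $$ (k, r)) * x $ p * x $ q * x $ r)"
    by (intro cubic_form_sum cubic_form_monomial) auto
  then show ?thesis
  proof (rule cubic_form_cong)
    fix x :: "complex vec" assume x: "x \<in> carrier_vec n"
    have Bx: "(B *\<^sub>v x) $ i = (\<Sum>p<n. B $$ (i, p) * x $ p)" if "i < n" for i
      using that B x by (auto simp: scalar_prod_def atLeast0LessThan intro!: sum.cong)
    have "F (B *\<^sub>v x) = (\<Sum>i<n. \<Sum>j<n. \<Sum>k<n. c i j k * (B *\<^sub>v x) $ i * (B *\<^sub>v x) $ j * (B *\<^sub>v x) $ k)"
      using B x by (intro c) auto
    also have "\<dots> = (\<Sum>i<n. \<Sum>j<n. \<Sum>k<n. \<Sum>p<n. \<Sum>q<n. \<Sum>r<n.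
      (c i j k * B $$ (i, p) * B $$ (j, q) * B $$ (k, r)) * x $ p * x $ q * x $ r)"
      by (intro sum.cong refl)
         (simp add: Bx sum_distrib_left sum_distrib_right mult_ac)
    finally show "F (B *\<^sub>v x) = \<dots>" .
  qed
qed

text \<open>
  Linearity of the directional derivative in the direction is what makes the Jacobian criterion
  independent of the coordinates.
\<close>

lemma cubic_form_gradient:
  assumes F: "cubic_form n F" and y: "y \<in> carrier_vec n"
  obtains g where "\<And>v. v \<in> carrier_vec n \<Longrightarrow>
    ((\<lambda>t. F (y + t \<cdot>\<^sub>v v)) has_field_derivative (\<Sum>i<n. g i * v $ i)) (at 0)"
proof -
  obtain c where
    c: "\<And>x. x\<in>carrier_vec n \<Longrightarrow> F x = (\<Sum>i<n. \<Sum>j<n. \<Sum>k<n. c i j k * x $ i * x $ j * x $ k)"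
    using F unfolding cubic_form_def by blast
  define g where "g p = (\<Sum>j<n. \<Sum>k<n. c p j k * y $ j * y $ k)
      + (\<Sum>i<n. \<Sum>k<n. c i p k * y $ i * y $ k) + (\<Sum>i<n. \<Sum>j<n. c i j p * y $ i * y $ j)" for p
  show ?thesis
  proof
    fix v :: "complex vec" assume v: "v \<in> carrier_vec n"
    have eq: "F (y + t \<cdot>\<^sub>v v) = (\<Sum>i<n. \<Sum>j<n. \<Sum>k<n.
       c i j k * (y $ i + t * v $ i) * (y $ j + t * v $ j) * (y $ k + t * v $ k))" for t
      using y v by (subst c) (auto intro!: sum.cong)
    have "((\<lambda>t. \<Sum>i<n. \<Sum>j<n. \<Sum>k<n.
       c i j k * (y $ i + t * v $ i) * (y $ j + t * v $ j) * (y $ k + t * v $ k))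
      has_field_derivative (\<Sum>i<n. \<Sum>j<n. \<Sum>k<n. c i j k * v $ i * y $ j * y $ k
         + c i j k * y $ i * v $ j * y $ k + c i j k * y $ i * y $ j * v $ k)) (at 0)"
      by (intro DERIV_sum) (auto intro!: derivative_eq_intros simp: algebra_simps)
    also have "(\<Sum>i<n. \<Sum>j<n. \<Sum>k<n. c i j k * v $ i * y $ j * y $ k
         + c i j k * y $ i * v $ j * y $ k + c i j k * y $ i * y $ j * v $ k)
       = (\<Sum>i<n. \<Sum>j<n. \<Sum>k<n. c i j k * v $ i * y $ j * y $ k)
       + (\<Sum>i<n. \<Sum>j<n. \<Sum>k<n. c i j k * y $ i * v $ j * y $ k)
       + (\<Sum>i<n. \<Sum>j<n. \<Sum>k<n. c i j k * y $ i * y $ j * v $ k)"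
      by (simp add: sum.distrib)
    also have "(\<Sum>i<n. \<Sum>j<n. \<Sum>k<n. c i j k * y $ i * v $ j * y $ k)
       = (\<Sum>j<n. \<Sum>i<n. \<Sum>k<n. c i j k * y $ i * v $ j * y $ k)"
      by (rule sum.swap)
    also have "(\<Sum>i<n. \<Sum>j<n. \<Sum>k<n. c i j k * y $ i * y $ j * v $ k)
       = (\<Sum>i<n. \<Sum>k<n. \<Sum>j<n. c i j k * y $ i * y $ j * v $ k)"
      by (intro sum.cong refl sum.swap)
    also have "\<dots> = (\<Sum>k<n. \<Sum>i<n. \<Sum>j<n. c i j k * y $ i * y $ j * v $ k)"
      by (rule sum.swap)
    also have "(\<Sum>i<n. \<Sum>j<n. \<Sum>k<n. c i j k * v $ i * y $ j * y $ k)
       + (\<Sum>j<n. \<Sum>i<n. \<Sum>k<n. c i j k * y $ i * v $ j * y $ k)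
       + (\<Sum>k<n. \<Sum>i<n. \<Sum>j<n. c i j k * y $ i * y $ j * v $ k)
       = (\<Sum>i<n. g i * v $ i)"
      by (simp add: g_def sum.distrib distrib_left sum_distrib_left mult_ac)
    finally show "((\<lambda>t. F (y + t \<cdot>\<^sub>v v)) has_field_derivative (\<Sum>i<n. g i * v $ i)) (at 0)"
      by (simp only: eq)
  qed
qed

lemma smooth_form_comp:
  assumes F: "cubic_form n F" "smooth_form n F" and B: "B \<in> carrier (GL n)"
  shows "smooth_form n (\<lambda>x. F (B *\<^sub>v x))"
  unfolding smooth_form_def
proof (intro ballI impI, elim conjE)
  fix x assume x: "x \<in> carrier_vec n" "x \<noteq> 0\<^sub>v n" "F (B *\<^sub>v x) = 0"
  obtain C where B': "B \<in> carrier_mat n n" and C: "C \<in> carrier_mat n n" "B * C = 1\<^sub>m n"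
    using B by (auto simp: GL_simps)
  define y where "y = B *\<^sub>v x"
  have y: "y \<in> carrier_vec n" using B' x by (simp add: y_def)
  obtain g where g: "\<And>v. v \<in> carrier_vec n \<Longrightarrow>
      ((\<lambda>t. F (y + t \<cdot>\<^sub>v v)) has_field_derivative (\<Sum>i<n. g i * v $ i)) (at 0)"
    using cubic_form_gradient[OF F(1) y] by blast
  obtain i D where i: "i < n" "D \<noteq> 0" "((\<lambda>t. F (y + t \<cdot>\<^sub>v unit_vec n i)) has_field_derivative D) (at 0)"
    using F(2) y x GL_mult_vec_nonzero[OF B x(1,2)]
    unfolding smooth_form_def has_partial_derivative_def y_def by blast
  have "D = (\<Sum>p<n. g p * unit_vec n i $ p)"
    using DERIV_unique[OF i(3) g] by simp
  then have gi: "g i = D" using i(1) by (simp add: unit_vec_def if_distrib cong: if_cong)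
  define h where "h j = (\<Sum>p<n. g p * (B *\<^sub>v unit_vec n j) $ p)" for j
  have h: "h j = (\<Sum>p<n. g p * B $$ (p, j))" if "j < n" for j
    using that B' by (auto simp: h_def intro!: sum.cong)
  have "\<exists>j<n. h j \<noteq> 0"
  proof (rule ccontr)
    assume "\<not> ?thesis"
    then have h0: "h j = 0" if "j < n" for j using that by blast
    have "g i = (\<Sum>p<n. g p * (B * C) $$ (p, i))"
      using i(1) unfolding C(2) by (simp add: if_distrib cong: if_cong)
    also have "\<dots> = (\<Sum>p<n. \<Sum>j<n. g p * B $$ (p, j) * C $$ (j, i))"
    proof (rule sum.cong)
      fix p assume "p \<in> {..<n}"
      then have "(B * C) $$ (p, i) = (\<Sum>j<n. B $$ (p, j) * C $$ (j, i))"
        using B' C(1) i(1) by (auto simp: scalar_prod_def atLeast0LessThan intro!: sum.cong)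
      then show "g p * (B * C) $$ (p, i) = (\<Sum>j<n. g p * B $$ (p, j) * C $$ (j, i))"
        by (simp only: sum_distrib_left mult.assoc)
    qed simp
    also have "\<dots> = (\<Sum>j<n. \<Sum>p<n. g p * B $$ (p, j) * C $$ (j, i))" by (rule sum.swap)
    also have "\<dots> = (\<Sum>j<n. h j * C $$ (j, i))" by (simp add: h sum_distrib_right)
    also have "\<dots> = 0" by (simp add: h0)
    finally show False using gi i(2) by simp
  qed
  then obtain j where j: "j < n" "h j \<noteq> 0" by blast
  have "B *\<^sub>v (x + t \<cdot>\<^sub>v unit_vec n j) = y + t \<cdot>\<^sub>v (B *\<^sub>v unit_vec n j)" for t
    using B' x by (simp add: y_def mult_add_distrib_mat_vec mult_mat_vec)
  then have "has_partial_derivative n (\<lambda>x. F (B *\<^sub>v x)) j (h j) x"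
    using g[of "B *\<^sub>v unit_vec n j"] B' unfolding has_partial_derivative_def h_def by simp
  with j show "\<exists>i<n. \<exists>D. D \<noteq> 0 \<and> has_partial_derivative n (\<lambda>x. F (B *\<^sub>v x)) i D x" by blast
qed

text \<open>
  The cone over the hypersurface, with its vertex included, is easier to handle than the set of
  projective points: it reduces invariance to an implication between equations.
\<close>

lemma hypersurface_invariant_iff:
  assumes F: "cubic_form n F" and A: "A \<in> carrier (GL n)"
  shows "proj_act (mat_class n A) ` hypersurface n F \<subseteq> hypersurface n F \<longleftrightarrow>
    (\<forall>w\<in>carrier_vec n. F w = 0 \<longrightarrow> F (A *\<^sub>v w) = 0)"
proof
  have A': "A \<in> carrier_mat n n" using A by (simp add: GL_simps)
  assume inv: "proj_act (mat_class n A) ` hypersurface n F \<subseteq> hypersurface n F"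
  show "\<forall>w\<in>carrier_vec n. F w = 0 \<longrightarrow> F (A *\<^sub>v w) = 0"
  proof (intro ballI impI)
    fix w :: "complex vec" assume w: "w \<in> carrier_vec n" "F w = 0"
    show "F (A *\<^sub>v w) = 0"
    proof (cases "w = 0\<^sub>v n")
      case True
      then have "A *\<^sub>v w = w" using A' by (auto intro!: eq_vecI)
      then show ?thesis using w by simp
    next
      case False
      then have "proj_point w \<in> hypersurface n F" using w unfolding hypersurface_def by blast
      then have "proj_point (A *\<^sub>v w) \<in> hypersurface n F"
        using inv proj_act_mat_class[OF A w(1)] by (metis image_subset_iff)
      then obtain v where v: "v \<in> carrier_vec n" "F v = 0" "proj_point (A *\<^sub>v w) = proj_point v"
        unfolding hypersurface_def by blast
      then obtain c where "A *\<^sub>v w = c \<cdot>\<^sub>v v" unfolding proj_point_eq_iff by blast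
      then show ?thesis using cubic_form_smult[OF F v(1)] v(2) by simp
    qed
  qed
next
  have A': "A \<in> carrier_mat n n" using A by (simp add: GL_simps)
  assume inv: "\<forall>w\<in>carrier_vec n. F w = 0 \<longrightarrow> F (A *\<^sub>v w) = 0"
  show "proj_act (mat_class n A) ` hypersurface n F \<subseteq> hypersurface n F"
  proof (intro image_subsetI)
    fix p assume "p \<in> hypersurface n F"
    then obtain v where v: "p = proj_point v" "v \<in> carrier_vec n" "v \<noteq> 0\<^sub>v n" "F v = 0"
      unfolding hypersurface_def by blast
    then have "proj_act (mat_class n A) p = proj_point (A *\<^sub>v v)" using proj_act_mat_class[OF A] by simp
    moreover have "A *\<^sub>v v \<in> carrier_vec n" "A *\<^sub>v v \<noteq> 0\<^sub>v n" "F (A *\<^sub>v v) = 0"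
      using A' v inv GL_mult_vec_nonzero[OF A] by auto
    ultimately show "proj_act (mat_class n A) p \<in> hypersurface n F"
      unfolding hypersurface_def by blast
  qed
qed

section \<open>One-parameter groups with two weights\<close>

text \<open>
  With weights \<open>e i \<in> {0, 1}\<close> this is \<open>(x, y) \<mapsto> (x, t y)\<close> for the splitting of the coordinates into
  those of weight 0 and those of weight 1; unlike a matrix of \<open>GL n\<close> it makes sense for \<open>t = 0\<close>,
  where it is the projection to \<open>y = 0\<close>.
\<close>

definition weight_scale :: "nat \<Rightarrow> (nat \<Rightarrow> nat) \<Rightarrow> complex \<Rightarrow> complex vec \<Rightarrow> complex vec" where
  "weight_scale n e t x = vec n (\<lambda>i. t ^ e i * x $ i)"

lemma weight_scale_carrier [simp]: "weight_scale n e t x \<in> carrier_vec n"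
  by (simp add: weight_scale_def)

text \<open>
  The decomposition by the degree in the variables of weight 1.  The scaling of the other block
  of variables is recorded as well, so that the two blocks can be exchanged.
\<close>

lemma cubic_form_weight_decomposition:
  assumes F: "cubic_form n F" and e: "\<And>i. i < n \<Longrightarrow> e i \<le> 1"
  obtains f :: "nat \<Rightarrow> complex vec \<Rightarrow> complex" where
    "\<And>d. cubic_form n (f d)"
    "\<And>x. x \<in> carrier_vec n \<Longrightarrow> F x = (\<Sum>d\<le>3. f d x)"
    "\<And>d t x. f d (weight_scale n e t x) = t ^ d * f d x"
    "\<And>d t x. d \<le> 3 \<Longrightarrow> f d (weight_scale n (\<lambda>i. 1 - e i) t x) = t ^ (3 - d) * f d x"
proof -
  obtain c where
    c: "\<And>x. x\<in>carrier_vec n \<Longrightarrow> F x = (\<Sum>i<n. \<Sum>j<n. \<Sum>k<n. c i j k * x $ i * x $ j * x $ k)"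
    using F unfolding cubic_form_def by blast
  define f where "f d x = (\<Sum>i<n. \<Sum>j<n. \<Sum>k<n.
    (if e i + e j + e k = d then c i j k else 0) * x $ i * x $ j * x $ k)" for d x
  show ?thesis
  proof
    show "cubic_form n (f d)" for d
      unfolding cubic_form_def f_def by (rule exI) auto
    fix x :: "complex vec"
    have "(\<Sum>d\<le>3. f d x) = (\<Sum>i<n. \<Sum>j<n. \<Sum>k<n. \<Sum>d\<le>3.
        (if e i + e j + e k = d then c i j k else 0) * x $ i * x $ j * x $ k)"
      unfolding f_def by (simp only: sum.swap[of _ _ "{..3}"])
    also have "\<dots> = (\<Sum>i<n. \<Sum>j<n. \<Sum>k<n. c i j k * x $ i * x $ j * x $ k)"
    proof (intro sum.cong refl)
      fix i j k assume "i \<in> {..<n}" "j \<in> {..<n}" "k \<in> {..<n}"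
      then have "e i + e j + e k \<le> 3" using e[of i] e[of j] e[of k] by simp
      then show "(\<Sum>d\<le>3. (if e i + e j + e k = d then c i j k else 0) * x $ i * x $ j * x $ k)
          = c i j k * x $ i * x $ j * x $ k"
        by (simp flip: sum_distrib_right)
    qed
    finally show "F x = (\<Sum>d\<le>3. f d x)" if "x \<in> carrier_vec n"
      using c[OF that] by simp
    show "f d (weight_scale n e t x) = t ^ d * f d x" for d t
      unfolding f_def sum_distrib_left
      by (intro sum.cong refl) (auto simp: weight_scale_def power_add)
    show "f d (weight_scale n (\<lambda>i. 1 - e i) t x) = t ^ (3 - d) * f d x" if "d \<le> 3" for d t
      unfolding f_def sum_distrib_left
    proof (intro sum.cong refl)
      fix i j k assume ijk: "i \<in> {..<n}" "j \<in> {..<n}" "k \<in> {..<n}"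
      then have "e i \<le> 1" "e j \<le> 1" "e k \<le> 1" using e by auto
      then have "e i + e j + e k = d \<Longrightarrow> (1 - e i) + (1 - e j) + (1 - e k) = 3 - d" by arith
      then have "e i + e j + e k = d \<Longrightarrow> t ^ (3 - d) = t ^ (1 - e i) * t ^ (1 - e j) * t ^ (1 - e k)"
        by (metis power_add)
      then show "(if e i + e j + e k = d then c i j k else 0) * weight_scale n (\<lambda>i. 1 - e i) t x $ i *
            weight_scale n (\<lambda>i. 1 - e i) t x $ j * weight_scale n (\<lambda>i. 1 - e i) t x $ k =
          t ^ (3 - d) * ((if e i + e j + e k = d then c i j k else 0) * x $ i * x $ j * x $ k)"
        using ijk by (auto simp: weight_scale_def)
    qed
  qed
qed

text \<open>
  If \<open>f 0\<close> and \<open>f 1\<close> vanished, then \<open>F\<close> would have order at least 2 in \<open>y\<close>, and it would be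
  singular at every point of the subspace \<open>y = 0\<close>, which is not \<open>0\<close> because of \<open>i0\<close>.
\<close>

lemma smooth_form_low_weight:
  assumes F: "smooth_form n F" and e: "\<And>i. i < n \<Longrightarrow> e i \<le> 1" and i0: "i0 < n" "e i0 = 0"
    and Ff: "\<And>x. x \<in> carrier_vec n \<Longrightarrow> F x = (\<Sum>d\<le>3. f d x)"
    and f: "\<And>d t x. d \<le> 3 \<Longrightarrow> f d (weight_scale n e t x) = t ^ d * f d x"
  shows "\<exists>d\<le>1. \<exists>u\<in>carrier_vec n. f d u \<noteq> 0"
proof (rule ccontr)
  assume "\<not> ?thesis"
  then have "f 0 u = 0" "f 1 u = 0" if "u \<in> carrier_vec n" for u
    using that by auto
  then have F23: "F x = f 2 x + f 3 x" if "x \<in> carrier_vec n" for x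
    using that by (simp add: Ff numeral_3_eq_3 numeral_2_eq_2)
  have low: "F x = 0" if x: "x \<in> carrier_vec n" and "weight_scale n e 0 x = x" for x
    using f[of 2 0 x] f[of 3 0 x] that by (simp add: F23)
  define w :: "complex vec" where "w = unit_vec n i0"
  have w: "w \<in> carrier_vec n" "w \<noteq> 0\<^sub>v n" using i0 by (auto simp: w_def)
  have "weight_scale n e 0 w = w" using i0 by (auto simp: weight_scale_def w_def unit_vec_def)
  then have "F w = 0" using low w by blast
  then obtain i D where i: "i < n" "D \<noteq> 0" "((\<lambda>t. F (w + t \<cdot>\<^sub>v unit_vec n i)) has_field_derivative D) (at 0)"
    using F w unfolding smooth_form_def has_partial_derivative_def by blast
  have "((\<lambda>t. F (w + t \<cdot>\<^sub>v unit_vec n i)) has_field_derivative 0) (at 0)"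
  proof (cases "e i = 0")
    case True
    then have "weight_scale n e 0 (w + t \<cdot>\<^sub>v unit_vec n i) = w + t \<cdot>\<^sub>v unit_vec n i" for t
      using i0 by (auto simp: weight_scale_def w_def unit_vec_def)
    then have "F (w + t \<cdot>\<^sub>v unit_vec n i) = 0" for t
      using low w by simp
    then show ?thesis by simp
  next
    case False
    then have ei: "e i = 1" using e[OF i(1)] by simp
    define v where "v = w + unit_vec n i"
    have "w + t \<cdot>\<^sub>v unit_vec n i = weight_scale n e t v" for t
      using i0 ei by (intro eq_vecI) (auto simp: weight_scale_def w_def unit_vec_def v_def)
    then have "F (w + t \<cdot>\<^sub>v unit_vec n i) = t ^ 2 * f 2 v + t ^ 3 * f 3 v" for t
      using f by (simp add: F23)
    then show ?thesis by (auto intro!: derivative_eq_intros)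
  qed
  with i(3) have "D = 0" by (rule DERIV_unique)
  with i show False by simp
qed

text \<open>
  After the largest power of the variable is split off, a polynomial that is not a monomial leaves
  a factor of positive degree that does not vanish at 0.
\<close>

lemma poly_two_coeffs_nonzero_root:
  fixes p :: "complex poly"
  assumes "coeff p k \<noteq> 0" "coeff p l \<noteq> 0" "k < l"
  obtains t where "t \<noteq> 0" "poly p t = 0"
proof -
  have p0: "p \<noteq> 0" using assms by auto
  obtain q where q: "p = [:- 0, 1:] ^ order 0 p * q" "\<not> [:- 0, 1:] dvd q"
    using order_decomp[OF p0] by blast
  have q0: "poly q 0 \<noteq> 0" using q(2) by (simp add: dvd_iff_poly_eq_0)
  have pm: "p = monom 1 (order 0 p) * q" using q(1) by (simp add: monom_altdef)
  have "\<exists>t. poly q t = 0"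
  proof (rule ccontr)
    assume "\<not> ?thesis"
    then have "constant (poly q)" using fundamental_theorem_of_algebra by blast
    then have "degree q = 0" by (simp add: constant_degree)
    then obtain c where "q = [:c:]" using degree_eq_zeroE by blast
    then have "p = monom c (order 0 p)" using pm by (simp add: mult_monom flip: monom_0)
    then have "k = order 0 p" "l = order 0 p" using assms by (metis coeff_monom)+
    then show False using assms by simp
  qed
  then obtain t where t: "poly q t = 0" by blast
  then have "t \<noteq> 0" using q0 by auto
  moreover have "poly p t = 0" using t by (subst q(1)) simp
  ultimately show ?thesis using that by blast
qed

text \<open>
  The roots \<open>t\<close> of \<open>F(x, t y)\<close> are at most three and are closed under multiplication with \<open>a\<close>.
  A nonzero root exists at a point where a low part \<open>f k\<close> and a high part \<open>f l\<close> of \<open>F\<close> are both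
  nonzero; such a point lies on the line through a point where \<open>f k \<noteq> 0\<close> and a point where
  \<open>f l \<noteq> 0\<close>, because a product of nonzero polynomials in one variable is nonzero.
\<close>

theorem smooth_cubic_two_weights:
  assumes F: "cubic_form n F" "smooth_form n F" and e: "\<And>i. i < n \<Longrightarrow> e i \<le> 1"
    and ij: "i0 < n" "e i0 = 0" "i1 < n" "e i1 = 1"
    and a: "a \<noteq> 0"
    and inv: "\<And>w. w \<in> carrier_vec n \<Longrightarrow> F w = 0 \<Longrightarrow> F (weight_scale n e a w) = 0"
  shows "a ^ 2 = 1 \<or> a ^ 3 = 1"
proof -
  obtain f :: "nat \<Rightarrow> complex vec \<Rightarrow> complex" where f:
    "\<And>d. cubic_form n (f d)"
    "\<And>x. x \<in> carrier_vec n \<Longrightarrow> F x = (\<Sum>d\<le>3. f d x)"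
    "\<And>d t x. f d (weight_scale n e t x) = t ^ d * f d x"
    "\<And>d t x. d \<le> 3 \<Longrightarrow> f d (weight_scale n (\<lambda>i. 1 - e i) t x) = t ^ (3 - d) * f d x"
    using cubic_form_weight_decomposition[OF F(1), where e = e, OF e] by blast
  obtain k u where k: "k \<le> 1" "u \<in> carrier_vec n" "f k u \<noteq> 0"
    using smooth_form_low_weight[OF F(2) e ij(1,2) f(2,3)] by blast
  \<comment> \<open>Exchanging the two blocks of variables turns the high parts of \<open>F\<close> into low parts.\<close>
  have "F x = (\<Sum>d\<le>3. f (3 - d) x)" if "x \<in> carrier_vec n" for x
    using f(2)[OF that] by (simp add: numeral_3_eq_3 eval_nat_numeral)
  then have "\<exists>d\<le>1. \<exists>u\<in>carrier_vec n. f (3 - d) u \<noteq> 0"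
    using ij e f(4)
    by (intro smooth_form_low_weight[OF F(2), of "\<lambda>i. 1 - e i" i1]) auto
  then obtain l v where l: "2 \<le> l" "l \<le> 3" "v \<in> carrier_vec n" "f l v \<noteq> 0"
    by (metis diff_le_mono2 diff_le_self numeral_3_eq_3 numeral_2_eq_2 diff_Suc_1 One_nat_def)
  \<comment> \<open>\<open>p\<close> and \<open>q\<close> are \<open>f k\<close> and \<open>f l\<close> on the line through \<open>u\<close> and \<open>v\<close>.\<close>
  have vu: "v - u \<in> carrier_vec n" "u + 1 \<cdot>\<^sub>v (v - u) = v" "u + 0 \<cdot>\<^sub>v (v - u) = u"
    using k l by (auto intro!: eq_vecI)
  obtain p where p: "\<And>s. f k (u + s \<cdot>\<^sub>v (v - u)) = poly p s"
    using cubic_form_line[OF f(1) k(2) vu(1)] by blast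
  obtain q where q: "\<And>s. f l (u + s \<cdot>\<^sub>v (v - u)) = poly q s"
    using cubic_form_line[OF f(1) k(2) vu(1)] by blast
  have "poly p 0 \<noteq> 0" "poly q 1 \<noteq> 0"
    using k l p[of 0] q[of 1] vu by simp_all
  then have "p * q \<noteq> 0" by auto
  then obtain s where s: "poly (p * q) s \<noteq> 0" using poly_all_0_iff_0 by blast
  define w where "w = u + s \<cdot>\<^sub>v (v - u)"
  have w: "w \<in> carrier_vec n" "f k w \<noteq> 0" "f l w \<noteq> 0"
    using s k vu p q by (auto simp: w_def)
  define P where "P = [:f 0 w, f 1 w, f 2 w, f 3 w:]"
  have P: "F (weight_scale n e t w) = poly P t" for t
    by (subst f(2)) (simp_all add: f(3) P_def eval_nat_numeral algebra_simps)
  have coeff_P: "coeff P d = f d w" if "d \<le> 3" for d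
  proof -
    have "d = 0 \<or> d = 1 \<or> d = 2 \<or> d = 3" using that by auto
    then show ?thesis by (auto simp: P_def eval_nat_numeral)
  qed
  have P0: "P \<noteq> 0" using coeff_P[of k] w(2) k(1) by auto
  have degP: "degree P \<le> 3" by (simp add: P_def)
  obtain t where t: "t \<noteq> 0" "poly P t = 0"
    using poly_two_coeffs_nonzero_root[of P k l] coeff_P[of k] coeff_P[of l] w k(1) l(1,2) by auto
  have scale: "weight_scale n e a (weight_scale n e b w) = weight_scale n e (a * b) w" for b
    by (auto simp: weight_scale_def power_mult_distrib)
  have root: "poly P (a ^ m * t) = 0" for m
  proof (induction m)
    case (Suc m)
    then show ?case
      using inv[of "weight_scale n e (a ^ m * t) w"] by (simp add: P[symmetric] scale mult_ac)
  qed (use t in simp)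
  \<comment> \<open>Four powers of \<open>a\<close> times \<open>t\<close> are too many roots for a polynomial of degree at most 3.\<close>
  have "\<not> inj_on (\<lambda>m. a ^ m * t) {..3::nat}"
  proof
    assume "inj_on (\<lambda>m. a ^ m * t) {..3::nat}"
    then have "card {..3::nat} \<le> card {x. poly P x = 0}"
      by (rule card_inj_on_le) (use root P0 poly_roots_finite in auto)
    also have "\<dots> \<le> 3" using card_poly_roots_bound[OF P0] degP by simp
    finally show False by simp
  qed
  then obtain i j where *: "i \<le> 3" "j \<le> 3" "i < j" "a ^ i * t = a ^ j * t"
    unfolding inj_on_def by (metis atMost_iff linorder_neqE_nat)
  have "a ^ j = a ^ i * a ^ (j - i)" using *(3) by (simp flip: power_add)
  moreover have "a ^ i = a ^ j" using *(4) t by simp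
  ultimately have "a ^ i * a ^ (j - i) = a ^ i * 1" by simp
  then have aji: "a ^ (j - i) = 1" using a by simp
  have "j - i = 1 \<or> j - i = 2 \<or> j - i = 3" using * by auto
  then show ?thesis using aji by auto
qed

section \<open>Roots of unity\<close>

lemma omega_eq_cis: "omega m = cis (2 * pi / real m)"
  by (simp add: omega_def cis_conv_exp mult_ac)

lemma omega_nonzero [simp]: "omega m \<noteq> 0"
  by (simp add: omega_def)

lemma bij_betw_omega_power:
  assumes "m > 0"
  shows "bij_betw (\<lambda>k. omega m ^ k) {..<m} {z. z ^ m = 1}"
  using bij_betw_roots_unity[OF assms] by (simp add: omega_eq_cis DeMoivre mult_ac)

lemma omega_power_self: "m > 0 \<Longrightarrow> omega m ^ m = 1"
  by (simp add: omega_eq_cis DeMoivre)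

lemma omega_powi_eq_1_iff:
  assumes "m > 0"
  shows "omega m powi k = 1 \<longleftrightarrow> int m dvd k"
proof -
  define r where "r = nat (k mod int m)"
  have r: "r < m" "int r = k mod int m" using assms by (auto simp: r_def nat_less_iff)
  have "k = int m * (k div int m) + int r" using r by simp
  then have "omega m powi k = (omega m powi int m) powi (k div int m) * omega m powi int r"
    by (metis omega_nonzero power_int_add power_int_mult)
  then have "omega m powi k = omega m ^ r"
    using omega_power_self[OF assms] by simp
  moreover have "omega m ^ r = omega m ^ 0 \<longleftrightarrow> r = 0"
    using bij_betw_omega_power[OF assms] r assms
    by (intro inj_on_eq_iff[where A = "{..<m}"]) (auto simp: bij_betw_def)
  ultimately show ?thesis using r by (auto simp: dvd_eq_mod_eq_0)
qed

lemma omega_powi_eq_iff: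
  assumes "m > 0"
  shows "omega m powi k = omega m powi l \<longleftrightarrow> k mod int m = l mod int m"
proof -
  have "omega m powi k = omega m powi l \<longleftrightarrow> omega m powi (k - l) = 1"
    by (auto simp: power_int_diff)
  then show ?thesis using omega_powi_eq_1_iff[OF assms] by (simp add: mod_eq_dvd_iff)
qed

lemma omega_power_mult:
  assumes "k > 0"
  shows "omega (m * k) ^ k = omega m"
  using assms by (simp add: omega_def flip: exp_of_nat_mult)

lemma root_of_unity_eq_omega_powi:
  assumes "m > 0" "a ^ m = 1"
  obtains k where "a = omega m powi k"
proof -
  have "a \<in> (\<lambda>k. omega m ^ k) ` {..<m}"
    using bij_betw_omega_power[OF assms(1)] assms(2) by (auto simp: bij_betw_def)
  then obtain k where "a = omega m powi int k" by auto
  then show ?thesis using that by blast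
qed

section \<open>Pauli matrices\<close>

text \<open>
  This is \<open>P\<^sup>s W\<^sup>t\<close>.  The exponents are integers, so that inverses and reductions modulo 3 need no
  case distinctions, and the explicit entries replace an induction on the exponents.
\<close>

definition pauli_mat :: "int \<Rightarrow> int \<Rightarrow> complex mat" where
  "pauli_mat s t = mat 3 3 (\<lambda>(r, c). if (int r + s) mod 3 = int c then omega 3 powi (t * int c) else 0)"

lemma pauli_mat_carrier [simp]: "pauli_mat s t \<in> carrier_mat 3 3"
  "dim_row (pauli_mat s t) = 3" "dim_col (pauli_mat s t) = 3"
  by (auto simp: pauli_mat_def)

lemma less_3_cases: "(r::nat) < 3 \<longleftrightarrow> r = 0 \<or> r = 1 \<or> r = 2"
  by auto

lemma pauli_mat_P3: "P3 = pauli_mat 1 0"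
  by (intro eq_matI) (auto simp: P3_def pauli_mat_def mat_of_rows_list_def less_3_cases)

lemma pauli_mat_W3: "W3 = pauli_mat 0 1"
  by (intro eq_matI) (auto simp: W3_def pauli_mat_def mat_of_rows_list_def less_3_cases)

lemma pauli_mat_one: "1\<^sub>m 3 = pauli_mat 0 0"
  by (intro eq_matI) (auto simp: pauli_mat_def)

text \<open>
  Moving \<open>W\<^sup>t\<close> past \<open>P\<^bsup>s'\<^esup>\<close> costs the scalar \<open>\<omega>\<^sub>3\<^bsup>- t s'\<^esup>\<close>, since \<open>W P = \<omega>\<^sub>3\<^sup>-\<^sup>1 P W\<close>.
\<close>

lemma pauli_mat_mult:
  "pauli_mat s t * pauli_mat s' t' = (omega 3 powi (- t * s')) \<cdot>\<^sub>m pauli_mat (s + s') (t + t')"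
proof (intro eq_matI)
  fix r c assume "r < dim_row ((omega 3 powi (- t * s')) \<cdot>\<^sub>m pauli_mat (s + s') (t + t'))"
    "c < dim_col ((omega 3 powi (- t * s')) \<cdot>\<^sub>m pauli_mat (s + s') (t + t'))"
  then have rc: "r < 3" "c < 3" by auto
  define m where "m = nat ((int r + s) mod 3)"
  have m: "m < 3" "int m = (int r + s) mod 3" by (auto simp: m_def)
  have "(pauli_mat s t * pauli_mat s' t') $$ (r, c)
      = (\<Sum>k<3. (if m = k then omega 3 powi (t * int k) else 0) *
           (if (int k + s') mod 3 = int c then omega 3 powi (t' * int c) else 0))"
    using rc by (auto simp: pauli_mat_def scalar_prod_def atLeast0LessThan m(2)[symmetric] intro!: sum.cong)
  also have "\<dots> = omega 3 powi (t * int m) * (if (int m + s') mod 3 = int c then omega 3 powi (t' * int c) else 0)"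
    using m by (subst sum.remove[of _ m]) auto
  also have "(int m + s') mod 3 = (int r + (s + s')) mod 3"
    unfolding m(2) by (simp add: mod_add_left_eq add.assoc)
  also have "omega 3 powi (t * int m) * (if (int r + (s + s')) mod 3 = int c then omega 3 powi (t' * int c) else 0)
      = omega 3 powi (- t * s') * (if (int r + (s + s')) mod 3 = int c then omega 3 powi ((t + t') * int c) else 0)"
  proof (cases "(int r + (s + s')) mod 3 = int c")
    case True
    then have "(int m + s') mod 3 = int c mod 3" using \<open>(int m + s') mod 3 = _\<close> by simp
    then obtain j where "int m + s' - int c = 3 * j" by (metis mod_eq_dvd_iff dvdE)
    then have "int m = int c - s' + 3 * j" by simp
    then have "t * int m = t * (int c - s' + 3 * j)" by (rule arg_cong)
    then have "t * int m + t' * int c = - t * s' + (t + t') * int c + 3 * (t * j)"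
      by (simp add: algebra_simps)
    then have "(t * int m + t' * int c) mod 3 = (- t * s' + (t + t') * int c) mod 3" by simp
    then have "omega 3 powi (t * int m + t' * int c) = omega 3 powi (- t * s' + (t + t') * int c)"
      by (subst omega_powi_eq_iff) auto
    also have "\<dots> = omega 3 powi (- t * s') * omega 3 powi ((t + t') * int c)"
      by (rule power_int_add) simp
    finally show ?thesis using True by (simp add: power_int_add)
  qed simp
  finally show "(pauli_mat s t * pauli_mat s' t') $$ (r, c)
      = ((omega 3 powi (- t * s')) \<cdot>\<^sub>m pauli_mat (s + s') (t + t')) $$ (r, c)"
    using rc by (simp add: pauli_mat_def)
qed auto

lemma pauli_mat_GL: "pauli_mat s t \<in> carrier (GL 3)"
proof -
  define B where "B = omega 3 powi (- t * s) \<cdot>\<^sub>m pauli_mat (- s) (- t)"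
  have "B * pauli_mat s t = 1\<^sub>m 3" "pauli_mat s t * B = 1\<^sub>m 3"
    unfolding B_def
    by (auto simp: mult_smult_assoc_mat[of _ 3 3 _ 3] mult_smult_distrib[of _ 3 3 _ 3] pauli_mat_mult
        pauli_mat_one[symmetric] power_int_minus)
  then show ?thesis by (auto simp: GL_simps B_def)
qed

lemma pauli3_subset: "pauli3 \<subseteq> {mat_class 3 (pauli_mat s t) | s t. True}"
proof
  interpret group "PGL 3" by (rule group_PGL)
  have mult: "mat_class 3 (pauli_mat s t) \<otimes>\<^bsub>PGL 3\<^esub> mat_class 3 (pauli_mat s' t')
      = mat_class 3 (pauli_mat (s + s') (t + t'))" for s t s' t'
    by (simp add: mat_class_mult pauli_mat_GL pauli_mat_mult mat_class_smult)
  have closed: "mat_class 3 (pauli_mat s t) \<in> carrier (PGL 3)" for s t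
    using pauli_mat_GL by (auto simp: carrier_PGL)
  have inv_class: "inv\<^bsub>PGL 3\<^esub> mat_class 3 (pauli_mat s t) = mat_class 3 (pauli_mat (- s) (- t))" for s t
    by (rule inv_equality) (auto simp: closed mult pauli_mat_one[symmetric] mat_class_one)
  fix x assume "x \<in> pauli3"
  then show "x \<in> {mat_class 3 (pauli_mat s t) | s t. True}"
    unfolding pauli3_def
  proof (induction rule: generate.induct)
    case one
    then show ?case using mat_class_one[of 3] pauli_mat_one by auto
  next
    case (incl h)
    then show ?case by (auto simp: pauli_mat_P3 pauli_mat_W3)
  next
    case (inv h)
    then show ?case by (auto simp: pauli_mat_P3 pauli_mat_W3 inv_class) blast+
  next
    case (eng h1 h2)
    then show ?case using mult by force
  qed
qed

section \<open>Tensor products\<close>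

lemma kronecker_carrier [simp]:
  assumes "A \<in> carrier_mat m n" "B \<in> carrier_mat p q"
  shows "kronecker A B \<in> carrier_mat (m * p) (n * q)"
  using assms by (auto simp: kronecker_def)

lemma kronecker_mult:
  assumes A: "A \<in> carrier_mat m1 k1" "C \<in> carrier_mat k1 n1"
    and B: "B \<in> carrier_mat m2 k2" "D \<in> carrier_mat k2 n2"
  shows "kronecker A B * kronecker C D = kronecker (A * C) (B * D)"
proof (intro eq_matI)
  fix i j assume "i < dim_row (kronecker (A * C) (B * D))" "j < dim_col (kronecker (A * C) (B * D))"
  then have ij: "i < m1 * m2" "j < n1 * n2" using assms by (auto simp: kronecker_def)
  then have pos: "m2 > 0" "n2 > 0" by (auto intro!: Nat.gr0I)
  have bounds: "i div m2 < m1" "j div n2 < n1" "i mod m2 < m2" "j mod n2 < n2"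
    using ij pos by (auto simp: less_mult_imp_div_less)
  have dims: "dim_row A = m1" "dim_col A = k1" "dim_row C = k1" "dim_col C = n1"
    "dim_row B = m2" "dim_col B = k2" "dim_row D = k2" "dim_col D = n2"
    using assms by auto
  have "(kronecker A B * kronecker C D) $$ (i, j)
     = (\<Sum>k<k1 * k2. (A $$ (i div m2, k div k2) * B $$ (i mod m2, k mod k2)) *
                     (C $$ (k div k2, j div n2) * D $$ (k mod k2, j mod n2)))"
    using ij by (auto simp: kronecker_def dims scalar_prod_def atLeast0LessThan intro!: sum.cong)
  also have "\<dots> = (\<Sum>p<k1. \<Sum>q\<in>{p * k2..<p * k2 + k2}.
                     (A $$ (i div m2, q div k2) * B $$ (i mod m2, q mod k2)) *
                     (C $$ (q div k2, j div n2) * D $$ (q mod k2, j mod n2)))"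
    by (rule sum.nat_group[symmetric])
  also have "\<dots> = (\<Sum>p<k1. \<Sum>q<k2. (A $$ (i div m2, p) * B $$ (i mod m2, q)) *
                     (C $$ (p, j div n2) * D $$ (q, j mod n2)))"
  proof (rule sum.cong[OF refl])
    fix p
    have "(\<Sum>q\<in>{p * k2..<p * k2 + k2}. g q) = (\<Sum>q<k2. g (p * k2 + q))" for g :: "nat \<Rightarrow> complex"
      by (rule sum.reindex_bij_witness[of _ "\<lambda>q. p * k2 + q" "\<lambda>q. q - p * k2"]) auto
    then show "(\<Sum>q\<in>{p * k2..<p * k2 + k2}.
                     (A $$ (i div m2, q div k2) * B $$ (i mod m2, q mod k2)) *
                     (C $$ (q div k2, j div n2) * D $$ (q mod k2, j mod n2)))
       = (\<Sum>q<k2. (A $$ (i div m2, p) * B $$ (i mod m2, q)) * (C $$ (p, j div n2) * D $$ (q, j mod n2)))"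
      by simp
  qed
  also have "\<dots> = (\<Sum>p<k1. A $$ (i div m2, p) * C $$ (p, j div n2)) *
                   (\<Sum>q<k2. B $$ (i mod m2, q) * D $$ (q, j mod n2))"
    by (simp add: sum_product mult_ac)
  also have "\<dots> = kronecker (A * C) (B * D) $$ (i, j)"
    using ij bounds by (simp add: kronecker_def dims scalar_prod_def atLeast0LessThan)
  finally show "(kronecker A B * kronecker C D) $$ (i, j) = kronecker (A * C) (B * D) $$ (i, j)" .
qed (use assms in \<open>auto simp: kronecker_def\<close>)

lemma kronecker_smult: "kronecker (a \<cdot>\<^sub>m A) (b \<cdot>\<^sub>m B) = (a * b) \<cdot>\<^sub>m kronecker A B"
proof (intro eq_matI)
  fix i j assume "i < dim_row ((a * b) \<cdot>\<^sub>m kronecker A B)" "j < dim_col ((a * b) \<cdot>\<^sub>m kronecker A B)"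
  then have ij: "i < dim_row A * dim_row B" "j < dim_col A * dim_col B" by (auto simp: kronecker_def)
  then have "dim_row B > 0" "dim_col B > 0" by (auto intro!: Nat.gr0I)
  then show "kronecker (a \<cdot>\<^sub>m A) (b \<cdot>\<^sub>m B) $$ (i, j) = ((a * b) \<cdot>\<^sub>m kronecker A B) $$ (i, j)"
    using ij by (simp add: kronecker_def less_mult_imp_div_less)
qed (auto simp: kronecker_def)

lemma kronecker_one: "kronecker (1\<^sub>m m) (1\<^sub>m n) = 1\<^sub>m (m * n)"
proof (intro eq_matI)
  fix i j assume "i < dim_row (1\<^sub>m (m * n))" "j < dim_col (1\<^sub>m (m * n))"
  then have ij: "i < m * n" "j < m * n" by auto
  then have "n > 0" by (auto intro!: Nat.gr0I)
  moreover have "i = j \<longleftrightarrow> i div n = j div n \<and> i mod n = j mod n" by (metis div_mult_mod_eq)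
  ultimately show "kronecker (1\<^sub>m m) (1\<^sub>m n) $$ (i, j) = 1\<^sub>m (m * n) $$ (i, j)"
    using ij by (auto simp: kronecker_def less_mult_imp_div_less)
qed (auto simp: kronecker_def)

lemma kronecker_GL:
  assumes "A \<in> carrier (GL m)" "B \<in> carrier (GL n)"
  shows "kronecker A B \<in> carrier (GL (m * n))"
proof -
  obtain A' B' where "A \<in> carrier_mat m m" "A' \<in> carrier_mat m m" "A' * A = 1\<^sub>m m" "A * A' = 1\<^sub>m m"
    "B \<in> carrier_mat n n" "B' \<in> carrier_mat n n" "B' * B = 1\<^sub>m n" "B * B' = 1\<^sub>m n"
    using assms by (auto simp: GL_simps)
  then show ?thesis
    by (auto simp: GL_simps kronecker_mult kronecker_one intro!: bexI[of _ "kronecker A' B'"])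
qed

section \<open>The group of classes of tensor products\<close>

definition diag2 :: "complex \<Rightarrow> complex mat" where
  "diag2 a = mat_of_rows_list 2 [[1, 0], [0, a]]"

lemma diag2_alt: "diag2 a = mat 2 2 (\<lambda>(i, j). if i = j then a ^ i else 0)"
  by (intro eq_matI) (auto simp: diag2_def mat_of_rows_list_def less_2_cases_iff)

lemma diag2_carrier [simp]: "diag2 a \<in> carrier_mat 2 2" "dim_row (diag2 a) = 2" "dim_col (diag2 a) = 2"
  by (auto simp: diag2_alt)

lemma diag2_mult: "diag2 a * diag2 b = diag2 (a * b)"
  by (intro eq_matI) (auto simp: diag2_alt scalar_prod_def numeral_2_eq_2 less_Suc_eq)

lemma diag2_one: "diag2 1 = 1\<^sub>m 2"
  by (intro eq_matI) (auto simp: diag2_alt)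

lemma diag2_GL: "a \<noteq> 0 \<Longrightarrow> diag2 a \<in> carrier (GL 2)"
  by (auto simp: GL_simps diag2_mult diag2_one intro!: bexI[of _ "diag2 (inverse a)"])

definition tensor_pauli :: "complex \<Rightarrow> int \<Rightarrow> int \<Rightarrow> complex mat" where
  "tensor_pauli a s t = kronecker (diag2 a) (pauli_mat s t)"

lemma tensor_pauli_carrier [simp]: "tensor_pauli a s t \<in> carrier_mat 6 6"
  "dim_row (tensor_pauli a s t) = 6" "dim_col (tensor_pauli a s t) = 6"
  by (auto simp: tensor_pauli_def kronecker_def)

lemma tensor_pauli_GL: "a \<noteq> 0 \<Longrightarrow> tensor_pauli a s t \<in> carrier (GL 6)"
  using kronecker_GL[OF diag2_GL pauli_mat_GL, of a s t] by (simp add: tensor_pauli_def)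

lemma tensor_pauli_mult:
  "tensor_pauli a s t * tensor_pauli b s' t'
    = (omega 3 powi (- t * s')) \<cdot>\<^sub>m tensor_pauli (a * b) (s + s') (t + t')"
proof -
  have "1 \<cdot>\<^sub>m diag2 (a * b) = diag2 (a * b)" by (intro eq_matI) auto
  then show ?thesis
    using kronecker_smult[of 1 "diag2 (a * b)"]
    by (simp add: tensor_pauli_def kronecker_mult[of _ 2 2 _ 2 _ 3 3 _ 3] diag2_mult pauli_mat_mult)
qed

lemma tensor_pauli_one: "tensor_pauli 1 0 0 = 1\<^sub>m 6"
  using kronecker_one[of 2 3] by (simp add: tensor_pauli_def diag2_one pauli_mat_one)

lemma tensor_pauli_index:
  assumes "r < 6" "c < 6"
  shows "tensor_pauli a s t $$ (r, c) =
    (if r div 3 = c div 3 \<and> (int r + s) mod 3 = int c mod 3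
     then a ^ (r div 3) * omega 3 powi (t * int c) else 0)"
proof -
  have "r div 3 < 2" "c div 3 < 2" using assms by auto
  moreover have "(int (r mod 3) + s) mod 3 = (int r + s) mod 3"
    by (simp add: zmod_int mod_add_left_eq)
  moreover have "omega 3 powi (t * int (c mod 3)) = omega 3 powi (t * int c)"
    by (subst omega_powi_eq_iff) (auto simp: zmod_int mod_mult_right_eq)
  moreover have "tensor_pauli a s t $$ (r, c) = (if r div 3 = c div 3 then a ^ (r div 3) else 0) *
      (if (int (r mod 3) + s) mod 3 = int (c mod 3) then omega 3 powi (t * int (c mod 3)) else 0)"
    using assms calculation(1,2) by (simp add: tensor_pauli_def kronecker_def pauli_mat_def diag2_alt)
  ultimately show ?thesis by (simp only: zmod_int) simp
qed

lemma tensor_pauli_mult_vec: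
  assumes w: "w \<in> carrier_vec 6" and r: "r < 6" and c: "c < 6" "c div 3 = r div 3" "int c mod 3 = (int r + s) mod 3"
  shows "(tensor_pauli a s t *\<^sub>v w) $ r = a ^ (r div 3) * omega 3 powi (t * int c) * w $ c"
proof -
  have uniq: "c' = c" if "c' < 6" "r div 3 = c' div 3" "(int r + s) mod 3 = int c' mod 3" for c'
  proof -
    have "int c' mod 3 = int c mod 3" using that(3) c(3) by (rule trans[OF sym sym])
    then have "c' mod 3 = c mod 3" by (metis of_nat_eq_iff of_nat_mod of_nat_numeral)
    moreover have "c' div 3 = c div 3" using that(2) c(2) by simp
    ultimately show ?thesis using div_mult_mod_eq[of c 3] div_mult_mod_eq[of c' 3] by simp
  qed
  have "(tensor_pauli a s t *\<^sub>v w) $ r = (\<Sum>c'<6. tensor_pauli a s t $$ (r, c') * w $ c')"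
    using w r by (auto simp: scalar_prod_def atLeast0LessThan intro!: sum.cong)
  also have "\<dots> = (\<Sum>c'<6. if c' = c then a ^ (r div 3) * omega 3 powi (t * int c) * w $ c else 0)"
  proof (intro sum.cong refl)
    fix c' :: nat assume "c' \<in> {..<6}"
    then have c': "c' < 6" by simp
    have "(r div 3 = c' div 3 \<and> (int r + s) mod 3 = int c' mod 3) = (c' = c)"
      using uniq[OF c'] c(2,3) by metis
    then show "tensor_pauli a s t $$ (r, c') * w $ c' =
        (if c' = c then a ^ (r div 3) * omega 3 powi (t * int c) * w $ c else 0)"
      unfolding tensor_pauli_index[OF r c'] by simp
  qed
  also have "\<dots> = a ^ (r div 3) * omega 3 powi (t * int c) * w $ c"
    using c by simp
  finally show ?thesis .
qed

lemma tensor_pauli_scalar_mult_vec: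
  assumes "w \<in> carrier_vec 6"
  shows "tensor_pauli a 0 0 *\<^sub>v w = weight_scale 6 (\<lambda>i. i div 3) a w"
proof (intro eq_vecI)
  fix r assume "r < dim_vec (weight_scale 6 (\<lambda>i. i div 3) a w)"
  then have "r < 6" by (simp add: weight_scale_def)
  then show "(tensor_pauli a 0 0 *\<^sub>v w) $ r = weight_scale 6 (\<lambda>i. i div 3) a w $ r"
    using tensor_pauli_mult_vec[OF assms, of r r] by (simp add: weight_scale_def)
qed (simp add: weight_scale_def)

abbreviation tensor_class :: "complex \<Rightarrow> int \<Rightarrow> int \<Rightarrow> complex mat set" where
  "tensor_class a s t \<equiv> diag_times a (pauli_mat s t)"

lemma tensor_class_eq_mat_class: "tensor_class a s t = mat_class 6 (tensor_pauli a s t)"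
  by (simp add: diag_times_def tensor_pauli_def diag2_def)

lemma tensor_class_closed: "a \<noteq> 0 \<Longrightarrow> tensor_class a s t \<in> carrier (PGL 6)"
  using tensor_pauli_GL by (auto simp: carrier_PGL tensor_class_eq_mat_class)

lemma tensor_class_mult:
  assumes "a \<noteq> 0" "b \<noteq> 0"
  shows "tensor_class a s t \<otimes>\<^bsub>PGL 6\<^esub> tensor_class b s' t' = tensor_class (a * b) (s + s') (t + t')"
  using assms
  by (simp add: tensor_class_eq_mat_class mat_class_mult tensor_pauli_GL tensor_pauli_mult mat_class_smult)

lemma tensor_class_one: "tensor_class 1 0 0 = \<one>\<^bsub>PGL 6\<^esub>"
  using mat_class_one[of 6] by (simp add: tensor_class_eq_mat_class tensor_pauli_one)

lemma tensor_class_inv: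
  assumes "a \<noteq> 0"
  shows "inv\<^bsub>PGL 6\<^esub> (tensor_class a s t) = tensor_class (inverse a) (- s) (- t)"
  by (rule group.inv_equality[OF group_PGL]) (use assms in \<open>auto simp: tensor_class_closed tensor_class_mult tensor_class_one\<close>)

text \<open>
  A scalar matrix is recognised from three diagonal entries: the first one forces \<open>s = 0\<close> and
  fixes the scalar to be 1, the second one forces \<open>t = 0\<close>, and the fourth one is then \<open>a\<close>.
\<close>

lemma tensor_class_eq_one_iff:
  assumes "a \<noteq> 0"
  shows "tensor_class a s t = tensor_class 1 0 0 \<longleftrightarrow> a = 1 \<and> 3 dvd s \<and> 3 dvd t"
proof
  assume "tensor_class a s t = tensor_class 1 0 0"
  then obtain c where c: "c \<noteq> 0" "tensor_pauli a s t = c \<cdot>\<^sub>m 1\<^sub>m 6"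
    using assms tensor_pauli_GL[of 1 0 0]
    by (auto simp: tensor_class_eq_mat_class mat_class_eq_iff tensor_pauli_GL tensor_pauli_one)
  have eq: "(if (int r + s) mod 3 = int r mod 3
     then a ^ (r div 3) * omega 3 powi (t * int r) else 0) = c" if "r < 6" for r
    using tensor_pauli_index[OF that that, of a s t] that c by simp
  have s: "s mod 3 = 0" using eq[of 0] c by (auto split: if_splits)
  then have "(int r + s) mod 3 = int r mod 3" for r by presburger
  then have eq': "a ^ (r div 3) * omega 3 powi (t * int r) = c" if "r < 6" for r
    using eq[OF that] by simp
  have "c = 1" using eq'[of 0] by simp
  then have t: "omega 3 powi t = 1" using eq'[of 1] by simp
  then have t3: "3 dvd t" by (subst (asm) omega_powi_eq_1_iff) auto
  have "omega 3 powi (t * 3) = 1" using t by (simp only: power_int_mult) simp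
  then have "a = 1" using eq'[of 3] \<open>c = 1\<close> by simp
  then show "a = 1 \<and> 3 dvd s \<and> 3 dvd t" using s t3 by auto
next
  assume *: "a = 1 \<and> 3 dvd s \<and> 3 dvd t"
  have "pauli_mat s t = pauli_mat 0 0"
  proof (intro eq_matI)
    fix r c assume "r < dim_row (pauli_mat 0 0)" "c < dim_col (pauli_mat 0 0)"
    moreover have "(int r + s) mod 3 = int r mod 3"
      using * by (metis mod_add_self2 dvd_imp_mod_0 add.right_neutral mod_add_right_eq)
    moreover have "omega 3 powi (t * int c) = 1" using * by (subst omega_powi_eq_1_iff) auto
    ultimately show "pauli_mat s t $$ (r, c) = pauli_mat 0 0 $$ (r, c)" by (simp add: pauli_mat_def)
  qed auto
  then show "tensor_class a s t = tensor_class 1 0 0" using * by simp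
qed

lemma tensor_class_eq_iff:
  assumes "a \<noteq> 0" "b \<noteq> 0"
  shows "tensor_class a s t = tensor_class b s' t' \<longleftrightarrow> a = b \<and> s mod 3 = s' mod 3 \<and> t mod 3 = t' mod 3"
proof -
  interpret group "PGL 6" by (rule group_PGL)
  have "tensor_class a s t = tensor_class b s' t' \<longleftrightarrow> tensor_class a s t \<otimes>\<^bsub>PGL 6\<^esub> inv\<^bsub>PGL 6\<^esub> (tensor_class b s' t') = tensor_class 1 0 0"
    using assms by (metis tensor_class_closed tensor_class_one inv_closed inv_solve_right l_one one_closed r_inv)
  also have "\<dots> \<longleftrightarrow> tensor_class (a * inverse b) (s - s') (t - t') = tensor_class 1 0 0"
    using assms by (simp add: tensor_class_inv tensor_class_mult)
  also have "\<dots> \<longleftrightarrow> a = b \<and> s mod 3 = s' mod 3 \<and> t mod 3 = t' mod 3"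
    using assms by (subst tensor_class_eq_one_iff) (auto simp: mod_eq_dvd_iff field_simps)
  finally show ?thesis .
qed

text \<open>
  A matrix whose class is the class of a diagonal matrix is itself diagonal, and \<open>diag(p, q)\<close> is
  the multiple \<open>p diag(1, q / p)\<close>.
\<close>

lemma D2_tensor_pauli3_subset: "D2_tensor_pauli3 \<subseteq> {tensor_class a s t | a s t. a \<noteq> 0}"
proof
  fix x assume "x \<in> D2_tensor_pauli3"
  then obtain A B where x: "x = mat_class 6 (kronecker A B)"
    and A: "A \<in> carrier (GL 2)" "mat_class 2 A \<in> diag_PGL 2"
    and B: "B \<in> carrier (GL 3)" "mat_class 3 B \<in> pauli3"
    unfolding D2_tensor_pauli3_def by blast
  obtain D c where D: "D \<in> carrier (GL 2)" "diagonal_mat D" "A = c \<cdot>\<^sub>m D"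
    using A by (auto simp: diag_PGL_def mat_class_eq_iff)
  obtain s t d where d: "d \<noteq> 0" "B = d \<cdot>\<^sub>m pauli_mat s t"
  proof -
    obtain s t where "mat_class 3 B = mat_class 3 (pauli_mat s t)"
      using B(2) pauli3_subset by blast
    then show ?thesis using mat_class_eq_iff[OF B(1) pauli_mat_GL] that by blast
  qed
  obtain A' where A': "A \<in> carrier_mat 2 2" "A' \<in> carrier_mat 2 2" "A * A' = 1\<^sub>m 2"
    using A by (auto simp: GL_simps)
  have off: "A $$ (0, 1) = 0" "A $$ (1, 0) = 0"
    using D by (auto simp: diagonal_mat_def GL_simps)
  have "(A * A') $$ (i, i) = 1" if "i < 2" for i using that A'(3) by simp
  then have "A $$ (0, 0) * A' $$ (0, 0) = 1" "A $$ (1, 1) * A' $$ (1, 1) = 1"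
    using A'(1,2) off by (fastforce simp: scalar_prod_def numeral_2_eq_2)+
  then have nz: "A $$ (0, 0) \<noteq> 0" "A $$ (1, 1) \<noteq> 0" by auto
  define a where "a = A $$ (1, 1) / A $$ (0, 0)"
  have "A = A $$ (0, 0) \<cdot>\<^sub>m diag2 a"
    using A' off nz by (intro eq_matI) (auto simp: diag2_alt less_2_cases_iff a_def)
  then have "kronecker A B = (A $$ (0, 0) * d) \<cdot>\<^sub>m tensor_pauli a s t"
    unfolding tensor_pauli_def d(2) using kronecker_smult by metis
  moreover have "a \<noteq> 0" using nz by (simp add: a_def)
  ultimately have "x = tensor_class a s t"
    unfolding x tensor_class_eq_mat_class using nz d(1) tensor_pauli_GL[of a s t] kronecker_GL[OF A(1) B(1)]
    by (subst mat_class_eq_iff) (auto intro!: exI[of _ "A $$ (0, 0) * d"])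
  then show "x \<in> {tensor_class a s t | a s t. a \<noteq> 0}" using \<open>a \<noteq> 0\<close> by blast
qed

section \<open>The listed groups\<close>

lemma tensor_class_powi_mult:
  "tensor_class (omega m powi n) s t \<otimes>\<^bsub>PGL 6\<^esub> tensor_class (omega m powi n') s' t' = tensor_class (omega m powi (n + n')) (s + s') (t + t')"
  by (simp add: tensor_class_mult power_int_add)

lemma tensor_class_powi_eq_iff:
  assumes "m > 0"
  shows "tensor_class (omega m powi n) s t = tensor_class (omega m powi n') s' t' \<longleftrightarrow>
    n mod int m = n' mod int m \<and> s mod 3 = s' mod 3 \<and> t mod 3 = t' mod 3"
  using assms by (simp add: tensor_class_eq_iff omega_powi_eq_iff)

lemma tensor_class_int_pow:
  assumes "a \<noteq> 0"
  shows "tensor_class a s t [^]\<^bsub>PGL 6\<^esub> (k::int) = tensor_class (a powi k) (k * s) (k * t)"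
proof -
  interpret group "PGL 6" by (rule group_PGL)
  have nat: "tensor_class a s t [^]\<^bsub>PGL 6\<^esub> (k::nat) = tensor_class (a ^ k) (int k * s) (int k * t)" for k
    using assms by (induction k) (simp_all add: tensor_class_one tensor_class_mult algebra_simps)
  show ?thesis
  proof (cases k rule: int_cases2)
    case (nonneg n)
    then show ?thesis by (simp add: int_pow_int nat)
  next
    case (nonpos n)
    then have "tensor_class a s t [^]\<^bsub>PGL 6\<^esub> k = inv\<^bsub>PGL 6\<^esub> (tensor_class (a ^ n) (int n * s) (int n * t))"
      using assms by (simp add: int_pow_neg_int tensor_class_closed nat)
    also have "\<dots> = tensor_class (a powi k) (k * s) (k * t)"
      using assms nonpos by (simp add: tensor_class_inv power_int_minus)
    finally show ?thesis .
  qed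
qed

text \<open>
  The common shape of the listed groups: \<open>(1, \<omega>\<^sub>m\<^sup>n) \<times> P\<^sup>s W\<^sup>t\<close> with \<open>n \<equiv> i s + j t\<close> modulo 3.  The
  congruence is modulo 3 and not modulo \<open>m\<close> because \<open>(1, \<omega>\<^sub>m\<^sup>3) \<times> 1\<close> is one of the generators.
\<close>

definition tensor_lift :: "nat \<Rightarrow> nat \<Rightarrow> nat \<Rightarrow> complex mat set set" where
  "tensor_lift m i j = {tensor_class (omega m powi n) s t | n s t. 3 dvd n - int i * s - int j * t}"

lemma subgroup_tensor_lift: "subgroup (tensor_lift m i j) (PGL 6)"
proof -
  interpret group "PGL 6" by (rule group_PGL)
  show ?thesis
  proof (rule subgroupI)
    show "tensor_lift m i j \<subseteq> carrier (PGL 6)"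
      by (auto simp: tensor_lift_def tensor_class_closed)
    have "tensor_class (omega m powi 0) 0 0 \<in> tensor_lift m i j"
      unfolding tensor_lift_def by (rule CollectI) (intro exI[of _ 0], simp)
    then show "tensor_lift m i j \<noteq> {}" by blast
  next
    fix x assume "x \<in> tensor_lift m i j"
    then obtain n s t where *: "x = tensor_class (omega m powi n) s t" "3 dvd n - int i * s - int j * t"
      unfolding tensor_lift_def by blast
    have "inv\<^bsub>PGL 6\<^esub> x = tensor_class (omega m powi (- n)) (- s) (- t)"
      using * by (simp add: tensor_class_inv power_int_minus)
    moreover have "3 dvd (- n) - int i * (- s) - int j * (- t)"
    proof -
      have "(- n) - int i * (- s) - int j * (- t) = - (n - int i * s - int j * t)" by simp
      then show ?thesis using *(2) by (metis dvd_minus_iff)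
    qed
    ultimately show "inv\<^bsub>PGL 6\<^esub> x \<in> tensor_lift m i j"
      unfolding tensor_lift_def by blast
  next
    fix x y assume "x \<in> tensor_lift m i j" "y \<in> tensor_lift m i j"
    then obtain n s t n' s' t' where *: "x = tensor_class (omega m powi n) s t" "3 dvd n - int i * s - int j * t"
      "y = tensor_class (omega m powi n') s' t'" "3 dvd n' - int i * s' - int j * t'"
      unfolding tensor_lift_def by blast
    have "x \<otimes>\<^bsub>PGL 6\<^esub> y = tensor_class (omega m powi (n + n')) (s + s') (t + t')"
      using * by (simp add: tensor_class_powi_mult)
    moreover have "3 dvd (n + n') - int i * (s + s') - int j * (t + t')"
      using dvd_add[OF *(2,4)] by (simp add: algebra_simps)
    ultimately show "x \<otimes>\<^bsub>PGL 6\<^esub> y \<in> tensor_lift m i j"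
      unfolding tensor_lift_def by blast
  qed
qed

lemma generate_tensor_lift:
  "generate (PGL 6) {tensor_class (omega m ^ 3) 0 0, tensor_class (omega m ^ i) 1 0, tensor_class (omega m ^ j) 0 1} = tensor_lift m i j"
  (is "generate _ ?S = _")
proof
  interpret group "PGL 6" by (rule group_PGL)
  have "?S \<subseteq> tensor_lift m i j"
  proof -
    have "tensor_class (omega m powi 3) 0 0 \<in> tensor_lift m i j" "tensor_class (omega m powi int i) 1 0 \<in> tensor_lift m i j"
      "tensor_class (omega m powi int j) 0 1 \<in> tensor_lift m i j"
      unfolding tensor_lift_def by (rule CollectI, intro exI conjI, rule refl, simp)+
    then show ?thesis by simp
  qed
  then show "generate (PGL 6) ?S \<subseteq> tensor_lift m i j"
    by (rule generate_subgroup_incl[OF _ subgroup_tensor_lift])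
  have sub: "subgroup (generate (PGL 6) ?S) (PGL 6)"
    by (rule generate_is_subgroup) (auto simp: tensor_class_closed)
  have pow: "tensor_class (a powi k) (k * s) (k * t) \<in> generate (PGL 6) ?S" if "tensor_class a s t \<in> ?S" "a \<noteq> 0" for a s t k
    using subgroup_int_pow_closed[OF sub generate.incl[OF that(1)], of k] that(2) by (simp add: tensor_class_int_pow)
  show "tensor_lift m i j \<subseteq> generate (PGL 6) ?S"
  proof
    fix x assume "x \<in> tensor_lift m i j"
    then obtain n s t where *: "x = tensor_class (omega m powi n) s t" "3 dvd n - int i * s - int j * t"
      unfolding tensor_lift_def by blast
    then obtain l where l: "n = 3 * l + int i * s + int j * t" by (auto elim!: dvdE simp: algebra_simps)
    have "tensor_class ((omega m ^ 3) powi l) (l * 0) (l * 0) \<otimes>\<^bsub>PGL 6\<^esub> tensor_class ((omega m ^ i) powi s) (s * 1) (s * 0)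
        \<otimes>\<^bsub>PGL 6\<^esub> tensor_class ((omega m ^ j) powi t) (t * 0) (t * 1) \<in> generate (PGL 6) ?S"
      by (intro generate.eng pow) auto
    also have "tensor_class ((omega m ^ 3) powi l) (l * 0) (l * 0) \<otimes>\<^bsub>PGL 6\<^esub> tensor_class ((omega m ^ i) powi s) (s * 1) (s * 0)
        \<otimes>\<^bsub>PGL 6\<^esub> tensor_class ((omega m ^ j) powi t) (t * 0) (t * 1) = x"
    proof -
      have "(omega m ^ k) powi u = omega m powi (int k * u)" for k u
        by (simp add: power_int_mult)
      from this[of 3 l] this[of i s] this[of j t] show ?thesis
        unfolding *(1) l by (simp add: tensor_class_mult power_int_add)
    qed
    finally show "x \<in> generate (PGL 6) ?S" .
  qed
qed

lemma group_a_eq: "group_a i j = tensor_lift 9 i j"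
  using generate_tensor_lift[of 9 i j] omega_power_mult[of 3 3]
  by (simp add: group_a_def pauli_mat_P3 pauli_mat_W3 pauli_mat_one)

lemma group_b_eq: "group_b i j = tensor_lift 6 i j"
proof -
  have "omega 2 = - 1" by (simp add: omega_eq_cis)
  then show ?thesis
    using generate_tensor_lift[of 6 i j] omega_power_mult[of 3 2]
    by (simp add: group_b_def pauli_mat_P3 pauli_mat_W3 pauli_mat_one)
qed

text \<open>
  For \<open>m = 3\<close> the first generator \<open>(1, \<omega>\<^sub>m\<^sup>3) \<times> 1\<close> of \<open>tensor_lift\<close> is trivial.
\<close>

lemma group_c_eq: "group_c i j = tensor_lift 3 i j"
proof -
  interpret group "PGL 6" by (rule group_PGL)
  let ?S = "{tensor_class (omega 3 ^ i) 1 0, tensor_class (omega 3 ^ j) 0 1}"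
  have one: "tensor_class (omega 3 ^ 3) 0 0 = \<one>\<^bsub>PGL 6\<^esub>"
    by (simp add: omega_power_self tensor_class_one)
  have "insert \<one>\<^bsub>PGL 6\<^esub> ?S \<subseteq> generate (PGL 6) ?S"
    by (intro subsetI, elim insertE) (auto intro: generate.one generate.incl)
  then have "generate (PGL 6) (insert \<one>\<^bsub>PGL 6\<^esub> ?S) \<subseteq> generate (PGL 6) ?S"
    by (rule generate_subgroup_incl) (rule generate_is_subgroup, auto simp: tensor_class_closed)
  moreover have "generate (PGL 6) ?S \<subseteq> generate (PGL 6) (insert \<one>\<^bsub>PGL 6\<^esub> ?S)"
    by (rule mono_generate) auto
  ultimately show ?thesis
    using generate_tensor_lift[of 3 i j] unfolding one
    by (simp add: group_c_def pauli_mat_P3 pauli_mat_W3)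
qed

section \<open>Isomorphism types\<close>

text \<open>
  Isomorphisms are given by additive parametrisations over the integers, with the kernel stated
  by congruences; the reduced representatives are then dealt with once and for all.
\<close>

lemma iso_integer_mod_2:
  assumes G: "group G" and f: "\<And>x y. f x y \<in> carrier G"
    "\<And>x y x' y'. f x y \<otimes>\<^bsub>G\<^esub> f x' y' = f (x + x') (y + y')"
    and inj: "\<And>x y x' y'. f x y = f x' y' \<longleftrightarrow> x mod int m = x' mod int m \<and> y mod int k = y' mod int k"
    and pos: "m > 0" "k > 0"
    and X: "X = {f x y | x y. True}"
  shows "G\<lparr>carrier := X\<rparr> \<cong> integer_mod_group m \<times>\<times> integer_mod_group k"
proof (rule group.iso_sym)
  show "group (integer_mod_group m \<times>\<times> integer_mod_group k)" by (simp add: DirProd_group)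
  have "(\<lambda>(x, y). f x y) \<in> iso (integer_mod_group m \<times>\<times> integer_mod_group k) (G\<lparr>carrier := X\<rparr>)"
    unfolding iso_def
  proof (intro CollectI conjI homI)
    show "bij_betw (\<lambda>(x, y). f x y) (carrier (integer_mod_group m \<times>\<times> integer_mod_group k)) (carrier (G\<lparr>carrier := X\<rparr>))"
      unfolding bij_betw_def
    proof
      show "inj_on (\<lambda>(x, y). f x y) (carrier (integer_mod_group m \<times>\<times> integer_mod_group k))"
        using pos by (auto simp: inj_on_def carrier_integer_mod_group inj)
      have "f x y \<in> (\<lambda>(x, y). f x y) ` ({0..<int m} \<times> {0..<int k})" for x y
        using pos by (intro image_eqI[of _ _ "(x mod int m, y mod int k)"]) (auto simp: inj)
      then show "(\<lambda>(x, y). f x y) ` carrier (integer_mod_group m \<times>\<times> integer_mod_group k) = carrier (G\<lparr>carrier := X\<rparr>)"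
        using pos by (auto simp: carrier_integer_mod_group X)
    qed
  qed (auto simp: X f inj)
  then show "integer_mod_group m \<times>\<times> integer_mod_group k \<cong> G\<lparr>carrier := X\<rparr>"
    unfolding is_iso_def by blast
qed

lemma iso_integer_mod_3:
  assumes G: "group G" and f: "\<And>x y z. f x y z \<in> carrier G"
    "\<And>x y z x' y' z'. f x y z \<otimes>\<^bsub>G\<^esub> f x' y' z' = f (x + x') (y + y') (z + z')"
    and inj: "\<And>x y z x' y' z'. f x y z = f x' y' z' \<longleftrightarrow>
      x mod int m = x' mod int m \<and> y mod int k = y' mod int k \<and> z mod int l = z' mod int l"
    and pos: "m > 0" "k > 0" "l > 0"
    and X: "X = {f x y z | x y z. True}"
  shows "G\<lparr>carrier := X\<rparr> \<cong> integer_mod_group m \<times>\<times> integer_mod_group k \<times>\<times> integer_mod_group l"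
    (is "_ \<cong> ?Z")
proof (rule group.iso_sym)
  show "group ?Z" by (simp add: DirProd_group)
  have "(\<lambda>(x, y, z). f x y z) \<in> iso ?Z (G\<lparr>carrier := X\<rparr>)"
    unfolding iso_def
  proof (intro CollectI conjI homI)
    show "bij_betw (\<lambda>(x, y, z). f x y z) (carrier ?Z) (carrier (G\<lparr>carrier := X\<rparr>))"
      unfolding bij_betw_def
    proof
      show "inj_on (\<lambda>(x, y, z). f x y z) (carrier ?Z)"
        using pos by (auto simp: inj_on_def carrier_integer_mod_group inj)
      have "f x y z \<in> (\<lambda>(x, y, z). f x y z) ` ({0..<int m} \<times> {0..<int k} \<times> {0..<int l})" for x y z
        using pos by (intro image_eqI[of _ _ "(x mod int m, y mod int k, z mod int l)"]) (auto simp: inj)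
      then show "(\<lambda>(x, y, z). f x y z) ` carrier ?Z = carrier (G\<lparr>carrier := X\<rparr>)"
        using pos by (auto simp: carrier_integer_mod_group X)
    qed
  qed (auto simp: X f inj)
  then show "?Z \<cong> G\<lparr>carrier := X\<rparr>"
    unfolding is_iso_def by blast
qed

lemma group_a_iso_split:
  "(PGL 6)\<lparr>carrier := group_a 0 0\<rparr> \<cong>
     integer_mod_group 3 \<times>\<times> integer_mod_group 3 \<times>\<times> integer_mod_group 3"
proof (rule iso_integer_mod_3[OF group_PGL, where f = "\<lambda>l s t. tensor_class (omega 9 powi (3 * l)) s t"])
  show "group_a 0 0 = {tensor_class (omega 9 powi (3 * l)) s t | l s t. True}"
    unfolding group_a_eq tensor_lift_def
  proof (intro equalityI subsetI; elim CollectE exE conjE)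
    fix x n s t assume "x = tensor_class (omega 9 powi n) s t" "3 dvd n - int 0 * s - int 0 * t"
    then show "x \<in> {tensor_class (omega 9 powi (3 * l)) s t | l s t. True}"
      by (intro CollectI exI[of _ "n div 3"] exI[of _ s] exI[of _ t]) simp
  next
    fix x l s t assume "x = tensor_class (omega 9 powi (3 * l)) s t"
    then show "x \<in> {tensor_class (omega 9 powi n) s t | n s t. 3 dvd n - int 0 * s - int 0 * t}"
      by (intro CollectI exI[of _ "3 * l"] exI[of _ s] exI[of _ t]) simp
  qed
  show "tensor_class (omega 9 powi (3 * x)) y z = tensor_class (omega 9 powi (3 * x')) y' z' \<longleftrightarrow>
      x mod int 3 = x' mod int 3 \<and> y mod int 3 = y' mod int 3 \<and> z mod int 3 = z' mod int 3" for x y z x' y' z'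
  proof -
    have "(3 * u) mod 9 = 3 * (u mod 3)" for u :: int
      using mult_mod_right[of 3 u 3] by simp
    then have "(3 * x) mod 9 = (3 * x') mod 9 \<longleftrightarrow> x mod 3 = x' mod 3"
      by simp
    then show ?thesis by (subst tensor_class_powi_eq_iff) simp_all
  qed
qed (auto simp: tensor_class_closed tensor_class_powi_mult algebra_simps)

text \<open>
  If \<open>i \<noteq> 0\<close>, then \<open>i\<^sup>2 \<equiv> 1\<close> modulo 3, and the congruence \<open>n \<equiv> i s + j t\<close> determines \<open>s\<close> as
  \<open>i (n - j t)\<close>; so \<open>n\<close> modulo 9 and \<open>t\<close> modulo 3 are free coordinates.  If \<open>i = 0\<close>, then
  \<open>j\<^sup>2 \<equiv> 1\<close>, and \<open>t\<close> is determined as \<open>j n\<close>.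
\<close>

lemma group_a_iso_nonsplit:
  assumes "i < 3" "j < 3" "\<not> (i = 0 \<and> j = 0)"
  shows "(PGL 6)\<lparr>carrier := group_a i j\<rparr> \<cong> integer_mod_group 9 \<times>\<times> integer_mod_group 3"
proof -
  define I J where "I = int i" and "J = int j"
  have mod93: "n mod 3 = n' mod 3" if "n mod 9 = n' mod 9" for n n' :: int
    using that dvd_trans[of 3 9 "n - n'"] by (simp add: mod_eq_dvd_iff)
  show ?thesis
  proof (cases "i = 0")
    case False
    then have I2: "3 dvd I * I - 1" using assms by (auto simp: I_def less_3_cases)
    define f where "f n t = tensor_class (omega 9 powi n) (I * (n - J * t)) t" for n t
    show ?thesis
    proof (rule iso_integer_mod_2[OF group_PGL, where f = f])
      have 1: "tensor_class (omega 9 powi n) s t = f n t" if "3 dvd n - I * s - J * t" for n s t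
      proof -
        have "s - I * (n - J * t) = - I * (n - I * s - J * t) - (I * I - 1) * s"
          by (simp add: algebra_simps)
        then have "3 dvd s - I * (n - J * t)" using that I2 by (metis dvd_diff dvd_mult dvd_mult2)
        then show ?thesis unfolding f_def by (subst tensor_class_powi_eq_iff) (simp_all add: mod_eq_dvd_iff)
      qed
      have 2: "3 dvd n - I * (I * (n - J * t)) - J * t" for n t
      proof -
        have "n - I * (I * (n - J * t)) - J * t = (I * I - 1) * (J * t - n)"
          by (simp add: algebra_simps)
        then show ?thesis using I2 by (metis dvd_mult2)
      qed
      show "group_a i j = {f n t | n t. True}"
        unfolding group_a_eq tensor_lift_def I_def[symmetric] J_def[symmetric]
      proof (intro equalityI subsetI)
        fix x assume "x \<in> {tensor_class (omega 9 powi n) s t | n s t. 3 dvd n - I * s - J * t}"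
        then show "x \<in> {f n t | n t. True}" using 1 by blast
      next
        fix x assume "x \<in> {f n t | n t. True}"
        then show "x \<in> {tensor_class (omega 9 powi n) s t | n s t. 3 dvd n - I * s - J * t}"
          using 2 unfolding f_def by blast
      qed
      show "f x y = f x' y' \<longleftrightarrow> x mod int 9 = x' mod int 9 \<and> y mod int 3 = y' mod int 3" for x y x' y'
      proof -
        have "(I * (x - J * y)) mod 3 = (I * (x' - J * y')) mod 3"
          if "x mod 9 = x' mod 9" "y mod 3 = y' mod 3"
          using that(2) mod93[OF that(1)] by (intro mod_mult_cong mod_diff_cong) auto
        then show ?thesis unfolding f_def by (subst tensor_class_powi_eq_iff) auto
      qed
    qed (auto simp: f_def tensor_class_closed tensor_class_powi_mult algebra_simps)
  next
    case True
    then have J2: "3 dvd J * J - 1" using assms by (auto simp: J_def less_3_cases)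
    have I0: "I = 0" using True by (simp add: I_def)
    define f where "f n s = tensor_class (omega 9 powi n) s (J * n)" for n s
    show ?thesis
    proof (rule iso_integer_mod_2[OF group_PGL, where f = f])
      have 1: "tensor_class (omega 9 powi n) s t = f n s" if "3 dvd n - I * s - J * t" for n s t
      proof -
        have "t - J * n = - J * (n - I * s - J * t) - (J * J - 1) * t"
          by (simp add: algebra_simps I0)
        then have "3 dvd t - J * n" using that J2 by (metis dvd_diff dvd_mult dvd_mult2)
        then show ?thesis unfolding f_def by (subst tensor_class_powi_eq_iff) (simp_all add: mod_eq_dvd_iff)
      qed
      have 2: "3 dvd n - I * s - J * (J * n)" for n s
      proof -
        have "n - I * s - J * (J * n) = (J * J - 1) * (- n)"
          by (simp add: algebra_simps I0)
        then show ?thesis using J2 by (metis dvd_mult2)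
      qed
      show "group_a i j = {f n s | n s. True}"
        unfolding group_a_eq tensor_lift_def I_def[symmetric] J_def[symmetric]
      proof (intro equalityI subsetI)
        fix x assume "x \<in> {tensor_class (omega 9 powi n) s t | n s t. 3 dvd n - I * s - J * t}"
        then show "x \<in> {f n t | n t. True}" using 1 by blast
      next
        fix x assume "x \<in> {f n t | n t. True}"
        then show "x \<in> {tensor_class (omega 9 powi n) s t | n s t. 3 dvd n - I * s - J * t}"
          using 2 unfolding f_def by blast
      qed
      show "f x y = f x' y' \<longleftrightarrow> x mod int 9 = x' mod int 9 \<and> y mod int 3 = y' mod int 3" for x y x' y'
      proof -
        have "(J * x) mod 3 = (J * x') mod 3" if "x mod 9 = x' mod 9"
          using mod93[OF that] by (intro mod_mult_cong) auto
        then show ?thesis unfolding f_def by (subst tensor_class_powi_eq_iff) auto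
      qed
    qed (auto simp: f_def tensor_class_closed tensor_class_powi_mult algebra_simps)
  qed
qed

text \<open>
  The exponent \<open>3 l + 4 (i s + j t)\<close> modulo 6 is the solution of the Chinese remainder problem
  \<open>l\<close> modulo 2 and \<open>i s + j t\<close> modulo 3.
\<close>

lemma group_b_iso:
  "(PGL 6)\<lparr>carrier := group_b i j\<rparr> \<cong>
     integer_mod_group 2 \<times>\<times> integer_mod_group 3 \<times>\<times> integer_mod_group 3"
proof -
  define I J where "I = int i" and "J = int j"
  define f where "f l s t = tensor_class (omega 6 powi (3 * l + 4 * (I * s + J * t))) s t" for l s t
  show ?thesis
  proof (rule iso_integer_mod_3[OF group_PGL, where f = f])
    have 1: "tensor_class (omega 6 powi n) s t = f n s t" if "3 dvd n - I * s - J * t" for n s t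
    proof -
      obtain k where "n - I * s - J * t = 3 * k" using \<open>3 dvd _\<close> by blast
      then have "n - (3 * n + 4 * (I * s + J * t)) = 6 * (2 * k - n)" by (simp add: algebra_simps)
      then have "6 dvd n - (3 * n + 4 * (I * s + J * t))" by (metis dvd_triv_left)
      then show ?thesis unfolding f_def by (subst tensor_class_powi_eq_iff) (simp_all add: mod_eq_dvd_iff)
    qed
    have 2: "3 dvd 3 * l + 4 * (I * s + J * t) - I * s - J * t" for l s t
    proof -
      have "3 * l + 4 * (I * s + J * t) - I * s - J * t = 3 * (l + I * s + J * t)"
        by (simp add: algebra_simps)
      then show ?thesis by simp
    qed
    show "group_b i j = {f l s t | l s t. True}"
      unfolding group_b_eq tensor_lift_def I_def[symmetric] J_def[symmetric]
    proof (intro equalityI subsetI)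
      fix x assume "x \<in> {tensor_class (omega 6 powi n) s t | n s t. 3 dvd n - I * s - J * t}"
      then show "x \<in> {f l s t | l s t. True}" using 1 by blast
    next
      fix x assume "x \<in> {f l s t | l s t. True}"
      then show "x \<in> {tensor_class (omega 6 powi n) s t | n s t. 3 dvd n - I * s - J * t}"
        using 2 unfolding f_def by blast
    qed
    show "f l s t = f l' s' t' \<longleftrightarrow> l mod int 2 = l' mod int 2 \<and> s mod int 3 = s' mod int 3 \<and> t mod int 3 = t' mod int 3"
      for l s t l' s' t'
    proof -
      have "(3 * l + 4 * (I * s + J * t)) mod 6 = (3 * l' + 4 * (I * s' + J * t')) mod 6 \<longleftrightarrow> l mod 2 = l' mod 2"
        if "s mod 3 = s' mod 3" "t mod 3 = t' mod 3"
      proof -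
        have "(I * s + J * t) mod 3 = (I * s' + J * t') mod 3"
          using that by (intro mod_add_cong mod_mult_cong) auto
        then obtain k where k: "I * s + J * t = I * s' + J * t' + 3 * k"
          by (metis mod_eq_dvd_iff dvdE diff_eq_eq add.commute)
        have "6 dvd (3 * l + 4 * (I * s + J * t)) - (3 * l' + 4 * (I * s' + J * t')) \<longleftrightarrow> 6 dvd 3 * (l - l') + 12 * k"
          unfolding k by (simp add: algebra_simps)
        also have "\<dots> \<longleftrightarrow> 2 dvd l - l'" by presburger
        finally show ?thesis by (simp only: mod_eq_dvd_iff)
      qed
      then show ?thesis unfolding f_def by (subst tensor_class_powi_eq_iff) auto
    qed
  qed (auto simp: f_def tensor_class_closed tensor_class_powi_mult algebra_simps)
qed

lemma group_c_iso:
  "(PGL 6)\<lparr>carrier := group_c i j\<rparr> \<cong> integer_mod_group 3 \<times>\<times> integer_mod_group 3"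
proof -
  define I J where "I = int i" and "J = int j"
  define f where "f s t = tensor_class (omega 3 powi (I * s + J * t)) s t" for s t
  show ?thesis
  proof (rule iso_integer_mod_2[OF group_PGL, where f = f])
    have 1: "tensor_class (omega 3 powi n) s t = f s t" if "3 dvd n - I * s - J * t" for n s t
    proof -
      have "n mod 3 = (I * s + J * t) mod 3" using that unfolding mod_eq_dvd_iff diff_diff_eq .
      then show ?thesis unfolding f_def by (subst tensor_class_powi_eq_iff) simp_all
    qed
    show "group_c i j = {f s t | s t. True}"
      unfolding group_c_eq tensor_lift_def I_def[symmetric] J_def[symmetric]
    proof (intro equalityI subsetI)
      fix x assume "x \<in> {tensor_class (omega 3 powi n) s t | n s t. 3 dvd n - I * s - J * t}"
      then show "x \<in> {f s t | s t. True}" using 1 by blast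
    next
      fix x assume "x \<in> {f s t | s t. True}"
      moreover have "3 dvd (I * s + J * t) - I * s - J * t" for s t by simp
      ultimately show "x \<in> {tensor_class (omega 3 powi n) s t | n s t. 3 dvd n - I * s - J * t}"
        unfolding f_def by blast
    qed
    show "f x y = f x' y' \<longleftrightarrow> x mod int 3 = x' mod int 3 \<and> y mod int 3 = y' mod int 3" for x y x' y'
    proof -
      have "(I * x + J * y) mod 3 = (I * x' + J * y') mod 3" if "x mod 3 = x' mod 3" "y mod 3 = y' mod 3"
        using that by (intro mod_add_cong mod_mult_cong) auto
      then show ?thesis unfolding f_def by (subst tensor_class_powi_eq_iff) auto
    qed
  qed (auto simp: f_def tensor_class_closed tensor_class_powi_mult algebra_simps)
qed

section \<open>Classification\<close>

lemma conj_mat_class: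
  assumes "A \<in> carrier (GL n)" "M \<in> carrier (GL n)"
  shows "inv\<^bsub>PGL n\<^esub> (mat_class n A) \<otimes>\<^bsub>PGL n\<^esub> mat_class n M \<otimes>\<^bsub>PGL n\<^esub> mat_class n A
    = mat_class n (inv\<^bsub>GL n\<^esub> A * M * A)"
proof -
  have inv: "inv\<^bsub>GL n\<^esub> A \<in> carrier (GL n)" using assms group.inv_closed[OF group_GL] by blast
  then have "inv\<^bsub>GL n\<^esub> A * M \<in> carrier (GL n)"
    using monoid.m_closed[OF group.is_monoid[OF group_GL] inv assms(2)] by (simp add: GL_simps)
  then show ?thesis using assms inv by (simp add: mat_class_inv mat_class_mult)
qed

text \<open>
  Instead of the conjugated group acting on the transformed fourfold, the form is transported:
  \<open>w \<mapsto> F(A\<^sup>-\<^sup>1 w)\<close> is a smooth cubic form whose zeros are preserved by \<open>(1, a) \<times> 1\<close>.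
\<close>

lemma scalar_on_factor_order:
  assumes G: "cubic_fourfold_automorphism_group G" and g: "g \<in> carrier (PGL 6)" and a: "a \<noteq> 0"
    and tensor_class: "tensor_class a 0 0 \<in> (\<lambda>h. g \<otimes>\<^bsub>PGL 6\<^esub> h \<otimes>\<^bsub>PGL 6\<^esub> inv\<^bsub>PGL 6\<^esub> g) ` G"
  shows "a ^ 2 = 1 \<or> a ^ 3 = 1"
proof -
  interpret P: group "PGL 6" by (rule group_PGL)
  interpret L: group "GL 6" by (rule group_GL)
  obtain F where F: "cubic_form 6 F" "smooth_form 6 F"
    and inv: "\<And>h. h \<in> G \<Longrightarrow> proj_act h ` hypersurface 6 F \<subseteq> hypersurface 6 F"
    and sub: "subgroup G (PGL 6)"
    using G unfolding cubic_fourfold_automorphism_group_def smooth_cubic_fourfold_def by blast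
  obtain A where A: "A \<in> carrier (GL 6)" "g = mat_class 6 A" using g carrier_PGL by blast
  define B where "B = inv\<^bsub>GL 6\<^esub> A"
  define D where "D = tensor_pauli a 0 0"
  have B: "B \<in> carrier (GL 6)" "A * B = 1\<^sub>m 6"
    using A L.r_inv[OF A(1)] by (auto simp: B_def GL_simps(1,2))
  have D: "D \<in> carrier (GL 6)" using a tensor_pauli_GL by (simp add: D_def)
  have mats: "A \<in> carrier_mat 6 6" "B \<in> carrier_mat 6 6" "D \<in> carrier_mat 6 6"
    using A B D by (auto simp: GL_simps)
  obtain h where h: "h \<in> G" "tensor_class a 0 0 = g \<otimes>\<^bsub>PGL 6\<^esub> h \<otimes>\<^bsub>PGL 6\<^esub> inv\<^bsub>PGL 6\<^esub> g"
    using tensor_class by blast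
  have hc: "h \<in> carrier (PGL 6)" using sub h(1) by (rule subgroup.mem_carrier)
  have "h = inv\<^bsub>PGL 6\<^esub> g \<otimes>\<^bsub>PGL 6\<^esub> tensor_class a 0 0 \<otimes>\<^bsub>PGL 6\<^esub> g"
    unfolding h(2) using g hc by (simp add: P.m_assoc P.inv_solve_left)
  also have "\<dots> = mat_class 6 (B * D * A)"
    unfolding A(2) tensor_class_eq_mat_class B_def D_def
    using A a tensor_pauli_GL by (simp add: conj_mat_class)
  finally have hM: "h = mat_class 6 (B * D * A)" .
  have "B * D * A \<in> carrier (GL 6)"
    using L.m_closed[OF L.m_closed[OF B(1) D] A(1)] by (simp add: GL_simps(1))
  then have key: "F ((B * D * A) *\<^sub>v w) = 0" if "w \<in> carrier_vec 6" "F w = 0" for w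
    using inv[OF h(1)] that unfolding hM by (simp add: hypersurface_invariant_iff[OF F(1)])
  show ?thesis
  proof (rule smooth_cubic_two_weights)
    show "cubic_form 6 (\<lambda>x. F (B *\<^sub>v x))" using F(1) mats(2) by (rule cubic_form_comp)
    show "smooth_form 6 (\<lambda>x. F (B *\<^sub>v x))" using F B(1) by (rule smooth_form_comp)
    fix w :: "complex vec" assume w: "w \<in> carrier_vec 6" "F (B *\<^sub>v w) = 0"
    have "(B * D * A) *\<^sub>v (B *\<^sub>v w) = B *\<^sub>v (D *\<^sub>v ((A * B) *\<^sub>v w))"
      using mats w by (simp add: assoc_mult_mat_vec[of _ 6 6 _ 6])
    also have "\<dots> = B *\<^sub>v (D *\<^sub>v w)" using w B by simp
    finally have "F (B *\<^sub>v (D *\<^sub>v w)) = 0" using key[of "B *\<^sub>v w"] w mats by simp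
    then show "F (B *\<^sub>v weight_scale 6 (\<lambda>i. i div 3) a w) = 0"
      using w by (simp add: D_def tensor_pauli_scalar_mult_vec)
  next
    show "i div 3 \<le> 1" if "i < 6" for i :: nat using that by simp
    show "(0::nat) < 6" "(0::nat) div 3 = 0" "(3::nat) < 6" "(3::nat) div 3 = 1" by auto
  qed (rule a)
qed

text \<open>
  The quadratic correction \<open>\<omega>\<^sub>3\<^bsup>s t\<^esup>\<close> changes the cocycle \<open>- t s'\<close> of the matrices \<open>P\<^sup>s W\<^sup>t\<close> by the
  coboundary of \<open>s t\<close> and makes it, modulo 3, the alternating form \<open>s t' - s' t\<close> up to sign.
\<close>

definition pauli_lift :: "complex \<Rightarrow> int \<Rightarrow> int \<Rightarrow> complex mat" where
  "pauli_lift a s t = omega 3 powi (s * t) \<cdot>\<^sub>m tensor_pauli a s t"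

lemma pauli_lift_GL: "a \<noteq> 0 \<Longrightarrow> pauli_lift a s t \<in> carrier (GL 6)"
  by (simp add: pauli_lift_def smult_GL tensor_pauli_GL)

lemma mat_class_pauli_lift: "a \<noteq> 0 \<Longrightarrow> mat_class 6 (pauli_lift a s t) = tensor_class a s t"
  by (simp add: pauli_lift_def mat_class_smult tensor_pauli_GL tensor_class_eq_mat_class)

lemma pauli_lift_cong:
  assumes "s mod 3 = s' mod 3" "t mod 3 = t' mod 3"
  shows "pauli_lift a s t = pauli_lift a s' t'"
proof -
  have "omega 3 powi (s * t) = omega 3 powi (s' * t')"
    using assms by (subst omega_powi_eq_iff) (simp, metis mod_mult_cong of_nat_numeral)
  moreover have "tensor_pauli a s t = tensor_pauli a s' t'"
  proof (intro eq_matI)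
    fix r c assume "r < dim_row (tensor_pauli a s' t')" "c < dim_col (tensor_pauli a s' t')"
    moreover have "(int r + s) mod 3 = (int r + s') mod 3" using assms by (metis mod_add_right_eq)
    moreover have "omega 3 powi (t * int c) = omega 3 powi (t' * int c)"
      using assms by (subst omega_powi_eq_iff) (simp, metis mod_mult_left_eq of_nat_numeral)
    ultimately show "tensor_pauli a s t $$ (r, c) = tensor_pauli a s' t' $$ (r, c)"
      by (simp add: tensor_pauli_index)
  qed auto
  ultimately show ?thesis by (simp add: pauli_lift_def)
qed

lemma pauli_lift_mult:
  assumes "3 dvd s * t' - s' * t"
  shows "pauli_lift a s t * pauli_lift b s' t' = pauli_lift (a * b) (s + s') (t + t')"
proof -
  have "s * t + s' * t' - t * s' - (s + s') * (t + t') = - (s * t' - s' * t) - 3 * (s' * t)"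
    by (simp add: algebra_simps)
  then have "3 dvd s * t + s' * t' - t * s' - (s + s') * (t + t')"
    using assms by (metis dvd_diff dvd_minus_iff dvd_triv_left)
  then have "(s * t + s' * t' + (- t * s')) mod 3 = ((s + s') * (t + t')) mod 3"
    by (simp add: mod_eq_dvd_iff)
  then have "omega 3 powi (s * t + s' * t' + (- t * s')) = omega 3 powi ((s + s') * (t + t'))"
    by (subst omega_powi_eq_iff) simp_all
  then have "omega 3 powi (s * t) * omega 3 powi (s' * t') * omega 3 powi (- t * s') = omega 3 powi ((s + s') * (t + t'))"
    by (simp only: power_int_add[OF disjI1[OF omega_nonzero]])
  moreover have smult_smult: "a \<cdot>\<^sub>m (b \<cdot>\<^sub>m M) = (a * b) \<cdot>\<^sub>m M" for a b :: complex and M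
    by (intro eq_matI) auto
  ultimately show ?thesis
    by (simp add: pauli_lift_def mult_smult_assoc_mat[of _ 6 6 _ 6] mult_smult_distrib[of _ 6 6 _ 6]
      tensor_pauli_mult smult_smult mult_ac)
qed

text \<open>
  On a group on which the alternating form vanishes, the corrected representatives multiply
  exactly and not only up to a scalar.
\<close>

lemma diagonalizable_if_proportional:
  assumes K: "K \<subseteq> {tensor_class a s t | a s t. a \<noteq> 0}"
    and proportional: "\<And>a s t b s' t'. a \<noteq> 0 \<Longrightarrow> b \<noteq> 0 \<Longrightarrow> tensor_class a s t \<in> K \<Longrightarrow> tensor_class b s' t' \<in> K \<Longrightarrow> 3 dvd s * t' - s' * t"
  shows "diagonalizable K"
proof -
  define \<phi> where "\<phi> g = (case SOME (a, s, t). a \<noteq> 0 \<and> g = tensor_class a s t of (a, s, t) \<Rightarrow> pauli_lift a s t)" for g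
  have \<phi>: "\<phi> (tensor_class a s t) = pauli_lift a s t" if "a \<noteq> 0" for a s t
  proof -
    obtain b s' t' where *: "(SOME (b, s', t'). b \<noteq> 0 \<and> tensor_class a s t = tensor_class b s' t') = (b, s', t')"
      by (rule prod_cases3)
    have "\<exists>x. case x of (b, s', t') \<Rightarrow> b \<noteq> 0 \<and> tensor_class a s t = tensor_class b s' t'" using that by auto
    from someI_ex[OF this] have "b \<noteq> 0 \<and> tensor_class a s t = tensor_class b s' t'" unfolding * by simp
    then have "a = b" "s' mod 3 = s mod 3" "t' mod 3 = t mod 3"
      using that tensor_class_eq_iff[of a b s t s' t'] by metis+
    then show ?thesis unfolding \<phi>_def * by (simp add: pauli_lift_cong[of s' s t' t])
  qed
  have "\<phi> \<in> hom ((PGL 6)\<lparr>carrier := K\<rparr>) (GL 6)"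
  proof (rule homI)
    fix x assume "x \<in> carrier ((PGL 6)\<lparr>carrier := K\<rparr>)"
    then obtain a s t where "a \<noteq> 0" "x = tensor_class a s t" using K by auto
    then show "\<phi> x \<in> carrier (GL 6)" by (simp add: \<phi> pauli_lift_GL)
  next
    fix x y assume "x \<in> carrier ((PGL 6)\<lparr>carrier := K\<rparr>)" "y \<in> carrier ((PGL 6)\<lparr>carrier := K\<rparr>)"
    then have xy: "x \<in> K" "y \<in> K" by simp_all
    obtain a s t where x: "a \<noteq> 0" "x = tensor_class a s t" using K xy(1) by blast
    obtain b s' t' where y: "b \<noteq> 0" "y = tensor_class b s' t'" using K xy(2) by blast
    note * = x y xy
    have "3 dvd s * t' - s' * t" using proportional[OF x(1) y(1)] xy unfolding x y by blast
    then show "\<phi> (x \<otimes>\<^bsub>(PGL 6)\<lparr>carrier := K\<rparr>\<^esub> y) = \<phi> x \<otimes>\<^bsub>GL 6\<^esub> \<phi> y"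
      using * by (simp add: tensor_class_mult \<phi> pauli_lift_mult GL_simps)
  qed
  moreover have "\<forall>g\<in>K. mat_class 6 (\<phi> g) = g"
  proof
    fix g assume "g \<in> K"
    then obtain a s t where "a \<noteq> 0" "g = tensor_class a s t" using K by blast
    then show "mat_class 6 (\<phi> g) = g" by (simp add: \<phi> mat_class_pauli_lift)
  qed
  ultimately show ?thesis unfolding diagonalizable_def by blast
qed

text \<open>
  The cube of \<open>(1, b) \<times> P\<close> is \<open>(1, b\<^sup>3) \<times> 1\<close>, hence \<open>b\<close> is a root of unity of order dividing
  \<open>3 k\<close>, and likewise \<open>c\<close>.  A general element of \<open>K\<close> differs from \<open>((1, b) \<times> P)\<^sup>s ((1, c) \<times> W)\<^sup>t\<close> by
  some \<open>(1, a) \<times> 1\<close> with \<open>a\<^sup>k = 1\<close>.  The exponents of \<open>b\<close> and \<open>c\<close> matter only modulo 3, because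
  \<open>\<omega>\<^sub>3\<^sub>k\<^sup>3\<close> is a primitive \<open>k\<close>-th root of unity.
\<close>

lemma subset_tensor_lift:
  assumes sub: "subgroup K (PGL 6)" and K: "K \<subseteq> {tensor_class a s t | a s t. a \<noteq> 0}"
    and k: "k > 0" "\<And>a. a \<noteq> 0 \<Longrightarrow> tensor_class a 0 0 \<in> K \<Longrightarrow> a ^ k = 1"
    and P: "b \<noteq> 0" "tensor_class b 1 0 \<in> K" and W: "c \<noteq> 0" "tensor_class c 0 1 \<in> K"
  shows "\<exists>i\<in>{0, 1, 2}. \<exists>j\<in>{0, 1, 2}. K \<subseteq> tensor_lift (k * 3) i j"
proof -
  let ?m = "k * 3"
  have pow: "tensor_class (a powi l) (l * s) (l * t) \<in> K" if "a \<noteq> 0" "tensor_class a s t \<in> K" for a s t l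
    using group.subgroup_int_pow_closed[OF group_PGL sub that(2), of l] that(1) by (simp add: tensor_class_int_pow)
  have root: "\<exists>n. a = omega ?m powi n" if "a \<noteq> 0" "tensor_class (a ^ 3) (3 * s) (3 * t) \<in> K" for a s t
  proof -
    have "tensor_class (a ^ 3) (3 * s) (3 * t) = tensor_class (a ^ 3) 0 0" using that by (simp add: tensor_class_eq_iff)
    then have "(a ^ 3) ^ k = 1" using k that by simp
    then have "a ^ ?m = 1" by (simp add: mult.commute flip: power_mult)
    then show ?thesis using root_of_unity_eq_omega_powi[of ?m a] k(1) by auto
  qed
  obtain u where u: "b = omega ?m powi u" using root[of b 1 0] pow[OF P, of 3] P by auto
  obtain v where v: "c = omega ?m powi v" using root[of c 0 1] pow[OF W, of 3] W by auto
  define i j where "i = nat (u mod 3)" and "j = nat (v mod 3)"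
  have ij: "i \<in> {0, 1, 2}" "j \<in> {0, 1, 2}" by (auto simp: i_def j_def)
  have int_ij: "int i = u mod 3" "int j = v mod 3" by (simp_all add: i_def j_def)
  have "K \<subseteq> tensor_lift ?m i j"
  proof
    fix x assume x: "x \<in> K"
    then obtain d s t where d: "d \<noteq> 0" "x = tensor_class d s t" using K by blast
    have "x \<otimes>\<^bsub>PGL 6\<^esub> (tensor_class (b powi (- s)) (- s * 1) (- s * 0) \<otimes>\<^bsub>PGL 6\<^esub> tensor_class (c powi (- t)) (- t * 0) (- t * 1)) \<in> K"
      using x pow[OF P, of "- s"] pow[OF W, of "- t"] sub by (intro subgroup.m_closed[OF sub]) auto
    also have "x \<otimes>\<^bsub>PGL 6\<^esub> (tensor_class (b powi (- s)) (- s * 1) (- s * 0) \<otimes>\<^bsub>PGL 6\<^esub> tensor_class (c powi (- t)) (- t * 0) (- t * 1))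
        = tensor_class (d * (b powi (- s) * c powi (- t))) 0 0"
      unfolding d(2) using d(1) P(1) W(1) by (simp add: tensor_class_mult)
    finally have "(d * (b powi (- s) * c powi (- t))) ^ k = 1"
      using k(2) d(1) P(1) W(1) by simp
    then obtain l where "d * (b powi (- s) * c powi (- t)) = omega k powi l"
      using root_of_unity_eq_omega_powi k(1) by blast
    also have "omega k = omega ?m ^ 3" by (rule omega_power_mult[symmetric]) simp
    finally have l: "d * (b powi (- s) * c powi (- t)) = omega ?m powi (3 * l)"
      by (simp add: power_int_mult)
    have "d = (d * (b powi (- s) * c powi (- t))) * (b powi s * c powi t)"
      using P(1) W(1) by (simp add: power_int_minus field_simps)
    also have "\<dots> = omega ?m powi (3 * l + u * s + v * t)"
      unfolding l unfolding u v by (simp add: power_int_add power_int_mult)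
    finally have "x = tensor_class (omega ?m powi (3 * l + u * s + v * t)) s t" using d(2) by simp
    moreover have "3 dvd (3 * l + u * s + v * t) - int i * s - int j * t"
    proof -
      have "u = 3 * (u div 3) + int i" "v = 3 * (v div 3) + int j" unfolding int_ij by simp_all
      then have "(3 * l + u * s + v * t) - int i * s - int j * t
          = (3 * l + (3 * (u div 3) + int i) * s + (3 * (v div 3) + int j) * t) - int i * s - int j * t"
        by simp
      also have "\<dots> = 3 * (l + (u div 3) * s + (v div 3) * t)" by (simp add: algebra_simps)
      finally show ?thesis by (metis dvd_triv_left)
    qed
    ultimately show "x \<in> tensor_lift ?m i j" unfolding tensor_lift_def by blast
  qed
  then show ?thesis using ij by blast
qed

text \<open>
  Two elements with nonzero \<open>\<delta> = s t' - s' t\<close> modulo 3 generate the whole Pauli group modulo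
  scalars on the factors: by Cramer's rule, with \<open>\<delta>\<close> as its own inverse modulo 3, suitable products
  of their powers lie over \<open>P\<close> and over \<open>W\<close>.  The \<open>a\<close> with \<open>(1, a) \<times> 1 \<in> K\<close> form a group, which is
  not the union of two proper subgroups; so one of the equations \<open>a\<^sup>2 = 1\<close>, \<open>a\<^sup>3 = 1\<close> holds for all
  of them.
\<close>

lemma classification:
  assumes sub: "subgroup K (PGL 6)" and K: "K \<subseteq> {tensor_class a s t | a s t. a \<noteq> 0}"
    and N: "\<And>a. a \<noteq> 0 \<Longrightarrow> tensor_class a 0 0 \<in> K \<Longrightarrow> a ^ 2 = 1 \<or> a ^ 3 = 1"
  shows "diagonalizable K \<or>
    (\<exists>i\<in>{0, 1, 2}. \<exists>j\<in>{0, 1, 2}. K \<subseteq> tensor_lift 9 i j \<or> K \<subseteq> tensor_lift 6 i j)"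
proof (cases "\<forall>a s t b s' t'. a \<noteq> 0 \<longrightarrow> b \<noteq> 0 \<longrightarrow> tensor_class a s t \<in> K \<longrightarrow> tensor_class b s' t' \<in> K \<longrightarrow> 3 dvd s * t' - s' * t")
  case True
  then show ?thesis using diagonalizable_if_proportional[OF K] by blast
next
  case False
  then obtain a s t b s' t' where *: "a \<noteq> 0" "b \<noteq> 0" "tensor_class a s t \<in> K" "tensor_class b s' t' \<in> K"
    and nd: "\<not> 3 dvd s * t' - s' * t" by blast
  define \<delta> where "\<delta> = s * t' - s' * t"
  have "\<delta> mod 3 = 1 \<or> \<delta> mod 3 = 2" using nd by (simp add: \<delta>_def) presburger
  then have \<delta>2: "(\<delta> * \<delta>) mod 3 = 1" by (auto simp: mod_mult_eq[of \<delta> 3 \<delta>, symmetric])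
  have comb: "tensor_class (a powi k * b powi l) (k * s + l * s') (k * t + l * t') \<in> K" for k l
    using subgroup.m_closed[OF sub group.subgroup_int_pow_closed[OF group_PGL sub *(3), of k]
        group.subgroup_int_pow_closed[OF group_PGL sub *(4), of l]] *(1,2)
    by (simp add: tensor_class_int_pow tensor_class_mult)
  have "\<exists>c. c \<noteq> 0 \<and> tensor_class c 1 0 \<in> K"
  proof (intro exI conjI)
    let ?c = "a powi (t' * \<delta>) * b powi (- t * \<delta>)"
    show "?c \<noteq> 0" using * by simp
    have "t' * \<delta> * s + - t * \<delta> * s' = \<delta> * \<delta>" "t' * \<delta> * t + - t * \<delta> * t' = 0"
      by (simp_all add: \<delta>_def algebra_simps)
    then have "tensor_class ?c (\<delta> * \<delta>) 0 \<in> K" using comb[of "t' * \<delta>" "- t * \<delta>"] by simp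
    moreover have "tensor_class ?c (\<delta> * \<delta>) 0 = tensor_class ?c 1 0" using \<open>?c \<noteq> 0\<close> \<delta>2 by (subst tensor_class_eq_iff) simp_all
    ultimately show "tensor_class ?c 1 0 \<in> K" by simp
  qed
  then obtain p where p: "p \<noteq> 0" "tensor_class p 1 0 \<in> K" by blast
  have "\<exists>c. c \<noteq> 0 \<and> tensor_class c 0 1 \<in> K"
  proof (intro exI conjI)
    let ?c = "a powi (- s' * \<delta>) * b powi (s * \<delta>)"
    show "?c \<noteq> 0" using * by simp
    have "- s' * \<delta> * s + s * \<delta> * s' = 0" "- s' * \<delta> * t + s * \<delta> * t' = \<delta> * \<delta>"
      by (simp_all add: \<delta>_def algebra_simps)
    then have "tensor_class ?c 0 (\<delta> * \<delta>) \<in> K" using comb[of "- s' * \<delta>" "s * \<delta>"] by simp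
    moreover have "tensor_class ?c 0 (\<delta> * \<delta>) = tensor_class ?c 0 1" using \<open>?c \<noteq> 0\<close> \<delta>2 by (subst tensor_class_eq_iff) simp_all
    ultimately show "tensor_class ?c 0 1 \<in> K" by simp
  qed
  then obtain q where q: "q \<noteq> 0" "tensor_class q 0 1 \<in> K" by blast
  have "(\<forall>a. a \<noteq> 0 \<longrightarrow> tensor_class a 0 0 \<in> K \<longrightarrow> a ^ 2 = 1) \<or> (\<forall>a. a \<noteq> 0 \<longrightarrow> tensor_class a 0 0 \<in> K \<longrightarrow> a ^ 3 = 1)"
  proof (rule ccontr)
    assume "\<not> ?thesis"
    then obtain x y where x: "x \<noteq> 0" "tensor_class x 0 0 \<in> K" "x ^ 2 \<noteq> 1" and y: "y \<noteq> 0" "tensor_class y 0 0 \<in> K" "y ^ 3 \<noteq> 1"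
      by blast
    then have "x ^ 3 = 1" "y ^ 2 = 1" using N by blast+
    moreover have "tensor_class (x * y) 0 0 \<in> K"
      using subgroup.m_closed[OF sub x(2) y(2)] x(1) y(1) by (simp add: tensor_class_mult)
    then have "(x * y) ^ 2 = 1 \<or> (x * y) ^ 3 = 1" using N x(1) y(1) by simp
    ultimately show False using x(3) y(3) by (auto simp: power_mult_distrib)
  qed
  then show ?thesis
  proof
    assume "\<forall>a. a \<noteq> 0 \<longrightarrow> tensor_class a 0 0 \<in> K \<longrightarrow> a ^ 2 = 1"
    then have "\<exists>i\<in>{0, 1, 2}. \<exists>j\<in>{0, 1, 2}. K \<subseteq> tensor_lift (2 * 3) i j"
      using p q by (intro subset_tensor_lift[OF sub K]) auto
    then show ?thesis by simp blast
  next
    assume "\<forall>a. a \<noteq> 0 \<longrightarrow> tensor_class a 0 0 \<in> K \<longrightarrow> a ^ 3 = 1"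
    then have "\<exists>i\<in>{0, 1, 2}. \<exists>j\<in>{0, 1, 2}. K \<subseteq> tensor_lift (3 * 3) i j"
      using p q by (intro subset_tensor_lift[OF sub K]) auto
    then show ?thesis by simp blast
  qed
qed

lemma diagonalizable_conjugate:
  assumes G: "G \<subseteq> carrier (PGL 6)" and g: "g \<in> carrier (PGL 6)"
    and K: "diagonalizable ((\<lambda>h. g \<otimes>\<^bsub>PGL 6\<^esub> h \<otimes>\<^bsub>PGL 6\<^esub> inv\<^bsub>PGL 6\<^esub> g) ` G)"
  shows "diagonalizable G"
proof -
  interpret P: group "PGL 6" by (rule group_PGL)
  interpret L: group "GL 6" by (rule group_GL)
  define c where "c h = g \<otimes>\<^bsub>PGL 6\<^esub> h \<otimes>\<^bsub>PGL 6\<^esub> inv\<^bsub>PGL 6\<^esub> g" for h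
  obtain \<phi> where \<phi>: "\<phi> \<in> hom ((PGL 6)\<lparr>carrier := c ` G\<rparr>) (GL 6)" "\<And>h. h \<in> G \<Longrightarrow> mat_class 6 (\<phi> (c h)) = c h"
    using K unfolding diagonalizable_def c_def by blast
  obtain A where A: "A \<in> carrier (GL 6)" "g = mat_class 6 A" using g carrier_PGL by blast
  define \<psi> where "\<psi> h = inv\<^bsub>GL 6\<^esub> A \<otimes>\<^bsub>GL 6\<^esub> \<phi> (c h) \<otimes>\<^bsub>GL 6\<^esub> A" for h
  have closed: "\<phi> (c h) \<in> carrier (GL 6)" if "h \<in> G" for h
    using \<phi>(1) that by (auto simp: hom_def)
  have cmult: "c (h \<otimes>\<^bsub>PGL 6\<^esub> k) = c h \<otimes>\<^bsub>PGL 6\<^esub> c k" if "h \<in> G" "k \<in> G" for h k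
  proof -
    have "h \<in> carrier (PGL 6)" "k \<in> carrier (PGL 6)" using that G by auto
    then show ?thesis using g P.inv_solve_left[of "inv\<^bsub>PGL 6\<^esub> g"]
      by (simp add: c_def P.m_assoc) (simp flip: P.m_assoc)
  qed
  have "\<psi> \<in> hom ((PGL 6)\<lparr>carrier := G\<rparr>) (GL 6)"
  proof (rule homI)
    fix h assume "h \<in> carrier ((PGL 6)\<lparr>carrier := G\<rparr>)"
    then show "\<psi> h \<in> carrier (GL 6)" using closed A by (simp add: \<psi>_def)
  next
    fix h k assume "h \<in> carrier ((PGL 6)\<lparr>carrier := G\<rparr>)" "k \<in> carrier ((PGL 6)\<lparr>carrier := G\<rparr>)"
    then have hk: "h \<in> G" "k \<in> G" by auto
    have "\<phi> (c (h \<otimes>\<^bsub>PGL 6\<^esub> k)) = \<phi> (c h) \<otimes>\<^bsub>GL 6\<^esub> \<phi> (c k)"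
      unfolding cmult[OF hk] using \<phi>(1) hk by (auto simp: hom_def)
    moreover have "\<phi> (c h) \<otimes>\<^bsub>GL 6\<^esub> (A \<otimes>\<^bsub>GL 6\<^esub> (inv\<^bsub>GL 6\<^esub> A \<otimes>\<^bsub>GL 6\<^esub> (\<phi> (c k) \<otimes>\<^bsub>GL 6\<^esub> A)))
        = \<phi> (c h) \<otimes>\<^bsub>GL 6\<^esub> (\<phi> (c k) \<otimes>\<^bsub>GL 6\<^esub> A)"
      using closed[OF hk(2)] A(1) by (simp flip: L.m_assoc)
    ultimately show "\<psi> (h \<otimes>\<^bsub>(PGL 6)\<lparr>carrier := G\<rparr>\<^esub> k) = \<psi> h \<otimes>\<^bsub>GL 6\<^esub> \<psi> k"
      using closed hk A(1) by (simp add: \<psi>_def L.m_assoc)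
  qed
  moreover have "mat_class 6 (\<psi> h) = h" if "h \<in> G" for h
  proof -
    have h: "h \<in> carrier (PGL 6)" using that G by blast
    have "mat_class 6 (\<psi> h) = inv\<^bsub>PGL 6\<^esub> g \<otimes>\<^bsub>PGL 6\<^esub> c h \<otimes>\<^bsub>PGL 6\<^esub> g"
      using conj_mat_class[OF A(1) closed[OF that]] \<phi>(2)[OF that] by (simp add: \<psi>_def A(2) GL_simps(1))
    also have "\<dots> = h"
    proof -
      have "inv\<^bsub>PGL 6\<^esub> g \<otimes>\<^bsub>PGL 6\<^esub> (g \<otimes>\<^bsub>PGL 6\<^esub> h) = h" using g h by (simp flip: P.m_assoc)
      then show ?thesis unfolding c_def using g h by (simp add: P.m_assoc)
    qed
    finally show ?thesis .
  qed
  ultimately show ?thesis unfolding diagonalizable_def by blast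
qed

lemma subgroup_conjugate:
  assumes "group P" "subgroup G P" "g \<in> carrier P"
  shows "subgroup ((\<lambda>h. g \<otimes>\<^bsub>P\<^esub> h \<otimes>\<^bsub>P\<^esub> inv\<^bsub>P\<^esub> g) ` G) P"
proof -
  interpret group P by fact
  have "g \<otimes>\<^bsub>P\<^esub> (x \<otimes>\<^bsub>P\<^esub> y) \<otimes>\<^bsub>P\<^esub> inv\<^bsub>P\<^esub> g = (g \<otimes>\<^bsub>P\<^esub> x \<otimes>\<^bsub>P\<^esub> inv\<^bsub>P\<^esub> g) \<otimes>\<^bsub>P\<^esub> (g \<otimes>\<^bsub>P\<^esub> y \<otimes>\<^bsub>P\<^esub> inv\<^bsub>P\<^esub> g)"
    if "x \<in> carrier P" "y \<in> carrier P" for x y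
  proof -
    have "inv\<^bsub>P\<^esub> g \<otimes>\<^bsub>P\<^esub> (g \<otimes>\<^bsub>P\<^esub> (y \<otimes>\<^bsub>P\<^esub> inv\<^bsub>P\<^esub> g)) = y \<otimes>\<^bsub>P\<^esub> inv\<^bsub>P\<^esub> g"
      using assms(3) that by (simp flip: m_assoc)
    then show ?thesis using assms(3) that by (simp add: m_assoc)
  qed
  then have "group_hom P P (\<lambda>h. g \<otimes>\<^bsub>P\<^esub> h \<otimes>\<^bsub>P\<^esub> inv\<^bsub>P\<^esub> g)"
    using assms(3) by (intro group_hom.intro group_hom_axioms.intro homI) auto
  then show ?thesis using assms(2) by (rule group_hom.subgroup_img_is_subgroup)
qed

section \<open>Invariant cubics\<close>

text \<open>
  Invariance of the form, and not only of its zeros, passes to inverses; so it suffices to check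
  it on generators.
\<close>

lemma subgroup_invariance:
  "subgroup {mat_class n A | A. A \<in> carrier (GL n) \<and> (\<forall>w\<in>carrier_vec n. F (A *\<^sub>v w) = F w)} (PGL n)"
  (is "subgroup ?S _")
proof -
  interpret P: group "PGL n" by (rule group_PGL)
  interpret L: group "GL n" by (rule group_GL)
  show ?thesis
  proof (rule P.subgroupI)
    show "?S \<subseteq> carrier (PGL n)" using carrier_PGL by blast
    have "1\<^sub>m n \<in> carrier (GL n)" using L.one_closed by (simp only: GL_simps(2))
    moreover have "\<forall>w\<in>carrier_vec n. F (1\<^sub>m n *\<^sub>v w) = F w" by simp
    ultimately show "?S \<noteq> {}" by blast
  next
    fix g assume "g \<in> ?S"
    then obtain A where A: "g = mat_class n A" "A \<in> carrier (GL n)" "\<And>w. w \<in> carrier_vec n \<Longrightarrow> F (A *\<^sub>v w) = F w"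
      by blast
    let ?B = "inv\<^bsub>GL n\<^esub> A"
    have B: "?B \<in> carrier (GL n)" "A * ?B = 1\<^sub>m n"
      using A(2) L.r_inv[OF A(2)] by (auto simp: GL_simps(1,2))
    have mats: "A \<in> carrier_mat n n" "?B \<in> carrier_mat n n" using A(2) B(1) by (auto simp: GL_simps(3))
    have "F (?B *\<^sub>v w) = F w" if "w \<in> carrier_vec n" for w
    proof -
      have "F (?B *\<^sub>v w) = F (A *\<^sub>v (?B *\<^sub>v w))" using A(3)[of "?B *\<^sub>v w"] mats that by simp
      also have "A *\<^sub>v (?B *\<^sub>v w) = w" using mats that B(2) by (simp flip: assoc_mult_mat_vec)
      finally show ?thesis .
    qed
    then show "inv\<^bsub>PGL n\<^esub> g \<in> ?S" using A(1,2) B(1) mat_class_inv by blast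
  next
    fix g h assume "g \<in> ?S" "h \<in> ?S"
    then obtain A B where A: "g = mat_class n A" "A \<in> carrier (GL n)" "\<And>w. w \<in> carrier_vec n \<Longrightarrow> F (A *\<^sub>v w) = F w"
      and B: "h = mat_class n B" "B \<in> carrier (GL n)" "\<And>w. w \<in> carrier_vec n \<Longrightarrow> F (B *\<^sub>v w) = F w"
      by blast
    have AB: "A * B \<in> carrier (GL n)" using L.m_closed[OF A(2) B(2)] by (simp only: GL_simps(1))
    have mats: "A \<in> carrier_mat n n" "B \<in> carrier_mat n n" using A(2) B(2) by (auto simp: GL_simps(3))
    then have "F ((A * B) *\<^sub>v w) = F w" if "w \<in> carrier_vec n" for w
      using that A(3)[of "B *\<^sub>v w"] B(3)[of w] by (simp add: assoc_mult_mat_vec[of _ n n _ n])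
    then show "g \<otimes>\<^bsub>PGL n\<^esub> h \<in> ?S"
      using AB mat_class_mult[OF A(2) B(2)] A(1) B(1) by blast
  qed
qed

text \<open>
  The offset \<open>d\<close> selects which block of variables the linear factor comes from: \<open>x\<close> if \<open>d = 0\<close>,
  \<open>y\<close> if \<open>d = 3\<close>.  The monomial \<open>z\<^sub>k\<^sub>+\<^sub>r y\<^sub>k\<^sup>2\<close> has weight \<open>3 k + r \<equiv> r\<close> under \<open>W\<close>, the same for all
  \<open>k\<close>, while \<open>P\<close> shifts \<open>k\<close> and so multiplies the second sum by \<open>\<epsilon>\<^sup>-\<^sup>1\<close>.
\<close>

definition pauli_cubic :: "nat \<Rightarrow> complex \<Rightarrow> nat \<Rightarrow> complex vec \<Rightarrow> complex" where
  "pauli_cubic d \<epsilon> r w = (\<Sum>k<3. w $ k ^ 3) + (\<Sum>k<3. \<epsilon> ^ k * w $ (d + (k + r) mod 3) * w $ (3 + k) ^ 2)"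

lemma sum_less_3: "(\<Sum>k<(3::nat). f k) = f 0 + f 1 + f 2"
  by (simp add: eval_nat_numeral)

lemma cubic_form_pauli_cubic:
  assumes "d \<le> 3"
  shows "cubic_form 6 (pauli_cubic d \<epsilon> r)"
proof -
  have "cubic_form 6 (\<lambda>w. (\<Sum>k<3. 1 * w $ k * w $ k * w $ k) +
      (\<Sum>k<3. \<epsilon> ^ k * w $ (d + (k + r) mod 3) * w $ (3 + k) * w $ (3 + k)))"
  proof (intro cubic_form_add cubic_form_sum cubic_form_monomial)
    show "d + (k + r) mod 3 < 6" for k
    proof -
      have "(k + r) mod 3 < 3" by simp
      then show ?thesis using assms by linarith
    qed
  qed auto
  then show ?thesis
    by (rule cubic_form_cong) (simp add: pauli_cubic_def power2_eq_square power3_eq_cube mult.assoc)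
qed

text \<open>
  Multiplying the three equations gives \<open>a b c (u v t)\<^sup>2 = - 8 a b c (u v t)\<^sup>2\<close>, so one of the
  coordinates vanishes, and the others follow.
\<close>

lemma klein_cubic_critical:
  fixes u v t :: complex
  assumes "a \<noteq> 0" "b \<noteq> 0" "c \<noteq> 0"
    and "2 * a * u * v + c * t ^ 2 = 0" "a * u ^ 2 + 2 * b * v * t = 0" "b * v ^ 2 + 2 * c * t * u = 0"
  shows "u = 0 \<and> v = 0 \<and> t = 0"
proof -
  have "c * t ^ 2 = - (2 * a * u * v)" "a * u ^ 2 = - (2 * b * v * t)" "b * v ^ 2 = - (2 * c * t * u)"
    using assms(4-6) by (simp_all only: eq_neg_iff_add_eq_0 add.commute)
  then have "(c * t ^ 2) * (a * u ^ 2) * (b * v ^ 2) = - (2 * a * u * v) * - (2 * b * v * t) * - (2 * c * t * u)"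
    by (simp only:)
  then have "9 * (a * b * c) * (u * v * t) ^ 2 = 0" by (simp add: power2_eq_square algebra_simps)
  then have "u = 0 \<or> v = 0 \<or> t = 0" using assms by auto
  then show ?thesis using assms by auto
qed

text \<open>
  For \<open>d = 0\<close> the form is a sum of the binary forms \<open>X\<^sup>3 + e X Y\<^sup>2\<close>; for \<open>d = 3\<close> it is the sum of a
  Fermat cubic in \<open>x\<close> and, in \<open>y\<close>, a Fermat cubic (\<open>r = 0\<close>) or a Klein cubic
  \<open>a u\<^sup>2 v + b v\<^sup>2 t + c t\<^sup>2 u\<close> (\<open>r = 1, 2\<close>).  In each case the partial derivatives have no common zero.
\<close>

lemma smooth_pauli_cubic:
  assumes d: "d = 0 \<or> d = 3" and r: "r < 3" and \<epsilon>: "\<epsilon> \<noteq> 0"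
  shows "smooth_form 6 (pauli_cubic d \<epsilon> r)"
  unfolding smooth_form_def
proof (intro ballI impI, elim conjE)
  fix w :: "complex vec" assume w: "w \<in> carrier_vec 6" "w \<noteq> 0\<^sub>v 6"
  define \<delta> :: "nat \<Rightarrow> nat \<Rightarrow> complex" where "\<delta> i k = (if k = i then 1 else 0)" for i k
  define D where "D i = (\<Sum>k<3. 3 * w $ k ^ 2 * \<delta> i k) +
    (\<Sum>k<3. \<epsilon> ^ k * (\<delta> i (d + (k + r) mod 3) * w $ (3 + k) ^ 2
       + 2 * w $ (d + (k + r) mod 3) * w $ (3 + k) * \<delta> i (3 + k)))" for i
  have deriv: "has_partial_derivative 6 (pauli_cubic d \<epsilon> r) i (D i) w" if i: "i < 6" for i
  proof -
    have idx: "(w + t \<cdot>\<^sub>v unit_vec 6 i) $ k = w $ k + t * \<delta> i k" if "k < 6" for t k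
      using w i that by (simp add: \<delta>_def unit_vec_def)
    have "d + (k + r) mod 3 < 6" for k
    proof -
      have "(k + r) mod 3 < 3" by simp
      then show ?thesis using d by linarith
    qed
    then have "pauli_cubic d \<epsilon> r (w + t \<cdot>\<^sub>v unit_vec 6 i) = (\<Sum>k<3. (w $ k + t * \<delta> i k) ^ 3) +
      (\<Sum>k<3. \<epsilon> ^ k * (w $ (d + (k + r) mod 3) + t * \<delta> i (d + (k + r) mod 3)) * (w $ (3 + k) + t * \<delta> i (3 + k)) ^ 2)" for t
      unfolding pauli_cubic_def by (intro arg_cong2[of _ _ _ _ "(+)"] sum.cong) (simp_all add: idx del: index_add_vec)
    moreover have "((\<lambda>t. (\<Sum>k<3. (w $ k + t * \<delta> i k) ^ 3) +
      (\<Sum>k<3. \<epsilon> ^ k * (w $ (d + (k + r) mod 3) + t * \<delta> i (d + (k + r) mod 3)) * (w $ (3 + k) + t * \<delta> i (3 + k)) ^ 2))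
      has_field_derivative D i) (at 0)"
      unfolding D_def
      by (intro DERIV_add DERIV_sum) (auto intro!: derivative_eq_intros simp: algebra_simps)
    ultimately show ?thesis unfolding has_partial_derivative_def by simp
  qed
  have "\<exists>i<6. D i \<noteq> 0"
  proof (rule ccontr)
    assume "\<not> ?thesis"
    then have D_zero: "D i = 0" if "i < 6" for i using that by blast
    then have D0: "D 0 = 0" "D 1 = 0" "D 2 = 0" "D 3 = 0" "D 4 = 0" "D 5 = 0" by simp_all
    have "w $ 0 = 0 \<and> w $ 1 = 0 \<and> w $ 2 = 0 \<and> w $ 3 = 0 \<and> w $ 4 = 0 \<and> w $ 5 = 0"
      using d
    proof
      assume d: "d = 0"
      have zero: "w $ ((k + r) mod 3) = 0 \<and> w $ (3 + k) = 0" if k: "k < 3" for k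
      proof -
        have "D (3 + k) = \<epsilon> ^ k * (2 * w $ ((k + r) mod 3) * w $ (3 + k))"
          "D ((k + r) mod 3) = 3 * w $ ((k + r) mod 3) ^ 2 + \<epsilon> ^ k * w $ (3 + k) ^ 2"
          using k[unfolded less_3_cases] r[unfolded less_3_cases]
          by (elim disjE; simp only: D_def \<delta>_def d sum_less_3; simp add: numeral_2_eq_2[symmetric])+
        moreover have "D (3 + k) = 0" "D ((k + r) mod 3) = 0"
        proof -
          have "(k + r) mod 3 < 3" by simp
          then have "(k + r) mod 3 < 6" by linarith
          then show "D (3 + k) = 0" "D ((k + r) mod 3) = 0" using D_zero k by simp_all
        qed
        ultimately show ?thesis using \<epsilon> by auto
      qed
      show ?thesis
        using zero[of 0] zero[of 1] zero[of 2] r[unfolded less_3_cases]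
        by (elim disjE) (simp_all add: numeral_2_eq_2[symmetric])
    next
      assume d: "d = 3"
      have x: "w $ 0 = 0" "w $ 1 = 0" "w $ 2 = 0"
        using D0(1-3) by (auto simp: D_def \<delta>_def d sum_less_3)
      consider "r = 0" | "r = 1" | "r = 2" using r by linarith
      then have "w $ 3 = 0 \<and> w $ 4 = 0 \<and> w $ 5 = 0"
      proof cases
        case 1
        then show ?thesis using D0(4-6) \<epsilon> by (auto simp: D_def \<delta>_def d sum_less_3 power2_eq_square)
      next
        case 2
        then show ?thesis
          using D0(4-6) \<epsilon> klein_cubic_critical[of 1 \<epsilon> "\<epsilon> ^ 2" "w $ 3" "w $ 4" "w $ 5"]
          by (simp add: D_def \<delta>_def d sum_less_3 algebra_simps)
      next
        case 3
        then show ?thesis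
          using D0(4-6) \<epsilon> klein_cubic_critical[of 1 "\<epsilon> ^ 2" \<epsilon> "w $ 3" "w $ 5" "w $ 4"]
          by (simp add: D_def \<delta>_def d sum_less_3 algebra_simps)
      qed
      with x show ?thesis by simp
    qed
    then have "w $ i = 0" if "i < 6" for i
    proof -
      have "i = 0 \<or> i = 1 \<or> i = 2 \<or> i = 3 \<or> i = 4 \<or> i = 5" using that by auto
      then show ?thesis using \<open>w $ 0 = 0 \<and> _\<close> by auto
    qed
    then have "w = 0\<^sub>v 6" using w by (intro eq_vecI) auto
    with w show False by simp
  qed
  then show "\<exists>i<6. \<exists>D. D \<noteq> 0 \<and> has_partial_derivative 6 (pauli_cubic d \<epsilon> r) i D w"
    using deriv by blast
qed

text \<open>
  The number \<open>p\<close> is the degree of the second sum in \<open>y\<close>, so \<open>(1, a)\<close> multiplies that sum by \<open>a\<^sup>p\<close>,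
  which has to compensate the characters of \<open>P\<close> and \<open>W\<close> on it.
\<close>

lemma pauli_cubic_invariant:
  assumes d: "d = 0 \<and> p = 2 \<or> d = 3 \<and> p = 3" and r: "r < 3"
    and z: "z ^ p = 1" and b: "b ^ p = \<epsilon>" "\<epsilon> ^ 3 = 1" and c: "c ^ p * omega 3 ^ r = 1"
    and w: "w \<in> carrier_vec 6"
  shows "pauli_cubic d \<epsilon> r (tensor_pauli z 0 0 *\<^sub>v w) = pauli_cubic d \<epsilon> r w"
    and "pauli_cubic d \<epsilon> r (tensor_pauli b 1 0 *\<^sub>v w) = pauli_cubic d \<epsilon> r w"
    and "pauli_cubic d \<epsilon> r (tensor_pauli c 0 1 *\<^sub>v w) = pauli_cubic d \<epsilon> r w"
proof -
  define \<omega> where "\<omega> = omega 3"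
  have \<omega>: "\<omega> ^ 3 = 1" by (simp add: \<omega>_def omega_power_self)
  note act = tensor_pauli_mult_vec[OF w]
  have z': "(tensor_pauli z 0 0 *\<^sub>v w) $ i = z ^ (i div 3) * w $ i" if "i < 6" for i
    using act[of i i 0] that by simp
  have b': "(tensor_pauli b 1 0 *\<^sub>v w) $ 0 = w $ 1" "(tensor_pauli b 1 0 *\<^sub>v w) $ 1 = w $ 2"
    "(tensor_pauli b 1 0 *\<^sub>v w) $ 2 = w $ 0" "(tensor_pauli b 1 0 *\<^sub>v w) $ 3 = b * w $ 4"
    "(tensor_pauli b 1 0 *\<^sub>v w) $ 4 = b * w $ 5" "(tensor_pauli b 1 0 *\<^sub>v w) $ 5 = b * w $ 3"
    using act[of 0 1 1 b 0] act[of 1 2 1 b 0] act[of 2 0 1 b 0] act[of 3 4 1 b 0] act[of 4 5 1 b 0] act[of 5 3 1 b 0]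
    by simp_all
  have c': "(tensor_pauli c 0 1 *\<^sub>v w) $ i = c ^ (i div 3) * \<omega> ^ i * w $ i" if "i < 6" for i
    using act[of i i 0 c 1] that by (simp add: \<omega>_def)
  define g where "g v k = v $ (d + (k + r) mod 3) * v $ (3 + k) ^ 2" for v :: "complex vec" and k
  have F: "pauli_cubic d \<epsilon> r v = (v $ 0 ^ 3 + v $ 1 ^ 3 + v $ 2 ^ 3) + (g v 0 + \<epsilon> * g v 1 + \<epsilon> ^ 2 * g v 2)" for v
    by (simp add: pauli_cubic_def g_def sum_less_3 mult.assoc)
  consider "d = 0" "p = 2" "r = 0" | "d = 0" "p = 2" "r = 1" | "d = 0" "p = 2" "r = 2"
    | "d = 3" "p = 3" "r = 0" | "d = 3" "p = 3" "r = 1" | "d = 3" "p = 3" "r = 2"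
    using d r by linarith
  note cases = this
  let ?z = "tensor_pauli z 0 0 *\<^sub>v w" and ?b = "tensor_pauli b 1 0 *\<^sub>v w" and ?c = "tensor_pauli c 0 1 *\<^sub>v w"
  have "g ?z 0 = z ^ p * g w 0 \<and> g ?z 1 = z ^ p * g w 1 \<and> g ?z 2 = z ^ p * g w 2"
    by (cases rule: cases) (simp_all add: g_def z' power2_eq_square power3_eq_cube mult_ac del: index_mult_mat_vec)
  then show "pauli_cubic d \<epsilon> r ?z = pauli_cubic d \<epsilon> r w"
    by (simp add: F z' z del: index_mult_mat_vec)
  have "g ?b 0 = b ^ p * g w 1 \<and> g ?b 1 = b ^ p * g w 2 \<and> g ?b 2 = b ^ p * g w 0"
    by (cases rule: cases) (simp_all add: g_def b' b'[unfolded One_nat_def] numeral_2_eq_2[symmetric] power2_eq_square power3_eq_cube mult_ac del: index_mult_mat_vec)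
  moreover have \<epsilon>3: "\<epsilon> * (\<epsilon> * \<epsilon>) = 1"
    using b(2) by (simp add: power3_eq_cube mult.assoc)
  ultimately show "pauli_cubic d \<epsilon> r ?b = pauli_cubic d \<epsilon> r w"
    by (simp add: F b' b'[unfolded One_nat_def] b(1) del: index_mult_mat_vec) (simp add: power2_eq_square \<epsilon>3)
  have g_c: "g ?c k = (c ^ p * \<omega> ^ r) * g w k" if k: "k < 3" for k
  proof -
    define q where "q = (k + r) mod 3"
    have q: "q < 3" by (simp add: q_def)
    then have div: "(d + q) div 3 = d div 3" "(3 + k) div 3 = 1" "d + q < 6" using d k by auto
    have "(d + q + 2 * (3 + k)) mod 3 = r mod 3"
      using d k[unfolded less_3_cases] r[unfolded less_3_cases] by (elim disjE conjE) (simp_all add: q_def)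
    then have "\<omega> ^ (d + q + 2 * (3 + k)) = \<omega> ^ r"
      using omega_powi_eq_iff[of 3 "int (d + q + 2 * (3 + k))" "int r"]
      unfolding \<omega>_def power_int_of_nat by (metis of_nat_mod zero_less_numeral)
    moreover have "(\<omega> ^ (3 + k)) ^ 2 = \<omega> ^ (2 * (3 + k))" by (metis power_mult mult.commute)
    ultimately have \<omega>r: "\<omega> ^ (d + q) * (\<omega> ^ (3 + k)) ^ 2 = \<omega> ^ r" by (metis power_add)
    have cp: "c ^ (d div 3) * c ^ 2 = c ^ p" using d by (auto simp: power2_eq_square power3_eq_cube)
    have "g ?c k = (c ^ (d div 3) * \<omega> ^ (d + q) * w $ (d + q)) * (c ^ 1 * \<omega> ^ (3 + k) * w $ (3 + k)) ^ 2"
      unfolding g_def q_def[symmetric] using c'[of "d + q"] c'[of "3 + k"] k div by simp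
    also have "\<dots> = (c ^ (d div 3) * c ^ 2) * (\<omega> ^ (d + q) * (\<omega> ^ (3 + k)) ^ 2) * g w k"
      unfolding g_def q_def[symmetric] power_mult_distrib power_one_right by (simp only: mult_ac)
    finally show ?thesis unfolding cp \<omega>r .
  qed
  have "(\<omega> ^ 2) ^ 3 = 1" using \<omega> by (metis power_mult mult.commute power_one)
  then have "(\<omega> * x) ^ 3 = x ^ 3" "(\<omega> ^ 2 * x) ^ 3 = x ^ 3" for x
    using \<omega> by (simp_all only: power_mult_distrib mult_1_left)
  then show "pauli_cubic d \<epsilon> r ?c = pauli_cubic d \<epsilon> r w"
    using c by (simp add: F c' g_c \<omega>_def[symmetric] del: index_mult_mat_vec)
qed

section \<open>Effectiveness\<close>

lemma cubic_form_zero_on_line: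
  assumes F: "cubic_form n F" and uv: "u \<in> carrier_vec n" "v \<in> carrier_vec n"
  obtains \<alpha> \<beta> where "\<alpha> \<noteq> 0 \<or> \<beta> \<noteq> 0" "F (\<alpha> \<cdot>\<^sub>v u + \<beta> \<cdot>\<^sub>v v) = 0"
proof (cases "F v = 0")
  case True
  moreover have "0 \<cdot>\<^sub>v u + 1 \<cdot>\<^sub>v v = v" using uv by (intro eq_vecI) auto
  ultimately show ?thesis using that[of 0 1] by simp
next
  case False
  obtain p where p: "\<And>s. F (u + s \<cdot>\<^sub>v v) = poly p s" "coeff p 3 = F v"
    using cubic_form_line[OF F uv] by blast
  have "degree p \<noteq> 0" using False p(2) coeff_eq_0[of p 3] by (intro notI) simp
  then have "\<not> constant (poly p)" by (simp add: constant_degree)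
  then obtain s where "poly p s = 0" using fundamental_theorem_of_algebra by blast
  moreover have "1 \<cdot>\<^sub>v u + s \<cdot>\<^sub>v v = u + s \<cdot>\<^sub>v v" using uv by (intro eq_vecI) auto
  ultimately show ?thesis using that[of 1 s] p(1)[of s] by simp
qed

text \<open>
  An element that fixes all points of the cubic has all zeros of \<open>F\<close> as eigenvectors, but each
  nontrivial element has a plane in \<open>\<complex>\<^sup>6\<close> that contains no eigenvector, and \<open>F\<close> has a nonzero zero on
  it.  The plane is spanned by \<open>e\<^sub>0, e\<^sub>3\<close> if the permutation part is nontrivial, by
  \<open>e\<^sub>0 + e\<^sub>1 + e\<^sub>2, e\<^sub>3 + e\<^sub>4 + e\<^sub>5\<close> if the element is diagonal with nontrivial \<open>W\<close>-part, and by
  \<open>e\<^sub>0 + e\<^sub>3, e\<^sub>1 + e\<^sub>4\<close> if it is \<open>(1, a) \<times> 1\<close>.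
\<close>

lemma trivial_on_cubic:
  assumes F: "cubic_form 6 F" and a: "a \<noteq> 0"
    and fix_pts: "\<And>p. p \<in> hypersurface 6 F \<Longrightarrow> proj_act (tensor_class a s t) p = p"
  shows "tensor_class a s t = tensor_class 1 0 0"
proof (rule ccontr)
  assume "tensor_class a s t \<noteq> tensor_class 1 0 0"
  then have nontriv: "a \<noteq> 1 \<or> \<not> 3 dvd s \<or> \<not> 3 dvd t" using tensor_class_eq_one_iff[OF a] by blast
  have eigen: "\<exists>c. tensor_pauli a s t *\<^sub>v w = c \<cdot>\<^sub>v w"
    if w: "w \<in> carrier_vec 6" "w \<noteq> 0\<^sub>v 6" "F w = 0" for w
  proof -
    have "proj_point w \<in> hypersurface 6 F" using w unfolding hypersurface_def by blast
    then have "proj_point (tensor_pauli a s t *\<^sub>v w) = proj_point w"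
      using fix_pts proj_act_mat_class[OF tensor_pauli_GL[OF a] w(1)] unfolding tensor_class_eq_mat_class by metis
    then show ?thesis unfolding proj_point_eq_iff by blast
  qed
  have no_eigen: False
    if uv: "u \<in> carrier_vec 6" "v \<in> carrier_vec 6" and
      none: "\<And>\<alpha> \<beta> c. (\<And>r. r < 6 \<Longrightarrow> (tensor_pauli a s t *\<^sub>v (\<alpha> \<cdot>\<^sub>v u + \<beta> \<cdot>\<^sub>v v)) $ r = c * (\<alpha> \<cdot>\<^sub>v u + \<beta> \<cdot>\<^sub>v v) $ r)
        \<Longrightarrow> \<alpha> = 0 \<and> \<beta> = 0"
      and indep: "\<And>\<alpha> \<beta>. \<alpha> \<cdot>\<^sub>v u + \<beta> \<cdot>\<^sub>v v = 0\<^sub>v 6 \<Longrightarrow> \<alpha> = 0 \<and> \<beta> = 0" for u v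
  proof -
    obtain \<alpha> \<beta> where *: "\<alpha> \<noteq> 0 \<or> \<beta> \<noteq> 0" "F (\<alpha> \<cdot>\<^sub>v u + \<beta> \<cdot>\<^sub>v v) = 0"
      using cubic_form_zero_on_line[OF F uv] by blast
    define w where "w = \<alpha> \<cdot>\<^sub>v u + \<beta> \<cdot>\<^sub>v v"
    have w: "w \<in> carrier_vec 6" "w \<noteq> 0\<^sub>v 6" "F w = 0" using * uv indep by (auto simp: w_def)
    then obtain c where c: "tensor_pauli a s t *\<^sub>v w = c \<cdot>\<^sub>v w" using eigen by blast
    have "(tensor_pauli a s t *\<^sub>v w) $ r = c * w $ r" if "r < 6" for r
      unfolding c using that w(1) by simp
    then show False using none[of \<alpha> \<beta> c] * unfolding w_def by blast
  qed
  note act = tensor_pauli_mult_vec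
  consider "\<not> 3 dvd s" | "3 dvd s" "\<not> 3 dvd t" | "3 dvd s" "3 dvd t" "a \<noteq> 1" using nontriv by blast
  then show False
  proof cases
    case 1
    define r where "r = nat ((- s) mod 3)"
    have int_r: "int r = (- s) mod 3" by (simp add: r_def)
    have "(- s) mod 3 = 1 \<or> (- s) mod 3 = 2" using 1 by presburger
    then have r: "r = 1 \<or> r = 2" by (auto simp: r_def)
    have rs: "(int r + s) mod 3 = 0" "(int (3 + r) + s) mod 3 = 0"
      unfolding of_nat_add int_r add.assoc by (simp_all add: mod_simps)
    define u v :: "complex vec" where "u = unit_vec 6 0" and "v = unit_vec 6 3"
    show False
    proof (rule no_eigen[of u v])
      fix \<alpha> \<beta> :: complex
      let ?w = "\<alpha> \<cdot>\<^sub>v u + \<beta> \<cdot>\<^sub>v v"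
      have w: "?w \<in> carrier_vec 6" "?w $ 0 = \<alpha>" "?w $ 3 = \<beta>" "?w $ r = 0" "?w $ (3 + r) = 0"
        using r by (auto simp: u_def v_def)
      show "\<alpha> = 0 \<and> \<beta> = 0" if "?w = 0\<^sub>v 6" using w(2,3) unfolding that by simp
      show "\<alpha> = 0 \<and> \<beta> = 0" if "\<And>i. i < 6 \<Longrightarrow> (tensor_pauli a s t *\<^sub>v ?w) $ i = c * ?w $ i" for c
      proof -
        \<comment> \<open>The permutation moves \<open>\<alpha>\<close> and \<open>\<beta>\<close> to coordinates where the vector vanishes.\<close>
        have r6: "r < 6" "3 + r < 6" "0 div 3 = r div 3" "3 div 3 = (3 + r) div 3" using r by auto
        have "(tensor_pauli a s t *\<^sub>v ?w) $ r = a ^ (r div 3) * omega 3 powi (t * int 0) * ?w $ 0"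
          by (rule act[OF w(1) r6(1) _ r6(3)]) (simp_all only: rs(1), simp_all)
        then have "a ^ (r div 3) * omega 3 powi (t * int 0) * \<alpha> = 0"
          unfolding that[OF r6(1)] w by simp
        moreover have "(tensor_pauli a s t *\<^sub>v ?w) $ (3 + r) = a ^ ((3 + r) div 3) * omega 3 powi (t * int 3) * ?w $ 3"
          by (rule act[OF w(1) r6(2) _ r6(4)]) (simp_all only: rs(2), simp_all)
        then have "a ^ ((3 + r) div 3) * omega 3 powi (t * int 3) * \<beta> = 0"
          unfolding that[OF r6(2)] w by simp
        ultimately show ?thesis using a by simp
      qed
    qed (auto simp: u_def v_def)
  next
    case 2
    have s: "int i mod 3 = (int i + s) mod 3" for i using 2(1) by (auto elim!: dvdE)
    have \<omega>: "omega 3 powi t \<noteq> 1" using omega_powi_eq_1_iff[of 3 t] 2(2) by simp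
    define u v :: "complex vec" where "u = vec 6 (\<lambda>i. if i < 3 then 1 else 0)" and "v = vec 6 (\<lambda>i. if i < 3 then 0 else 1)"
    show False
    proof (rule no_eigen[of u v])
      fix \<alpha> \<beta> :: complex
      let ?w = "\<alpha> \<cdot>\<^sub>v u + \<beta> \<cdot>\<^sub>v v"
      have w: "?w \<in> carrier_vec 6" "?w $ 0 = \<alpha>" "?w $ 1 = \<alpha>" "?w $ 3 = \<beta>" "?w $ 4 = \<beta>"
        by (auto simp: u_def v_def)
      show "\<alpha> = 0 \<and> \<beta> = 0" if "?w = 0\<^sub>v 6" using w(2,4) unfolding that by simp
      show "\<alpha> = 0 \<and> \<beta> = 0" if eq: "\<And>i. i < 6 \<Longrightarrow> (tensor_pauli a s t *\<^sub>v ?w) $ i = c * ?w $ i" for c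
      proof -
        have e: "\<alpha> = c * \<alpha>" "omega 3 powi t * \<alpha> = c * \<alpha>"
          "a * omega 3 powi (t * 3) * \<beta> = c * \<beta>" "a * omega 3 powi (t * 4) * \<beta> = c * \<beta>"
          using eq[of 0] eq[of 1] eq[of 3] eq[of 4]
            act[OF w(1) _ _ _ s, of 0 a t] act[OF w(1) _ _ _ s, of 1 a t]
            act[OF w(1) _ _ _ s, of 3 a t] act[OF w(1) _ _ _ s, of 4 a t]
          unfolding w by (auto simp del: index_mult_mat_vec)
        have "\<beta> = 0"
        proof (rule ccontr)
          assume "\<beta> \<noteq> 0"
          then have c: "a * omega 3 powi (t * 3) = c" "a * omega 3 powi (t * 4) = c" using e(3,4) by auto
          have "omega 3 powi (t * 4) = omega 3 powi (t * 3 + t)" by (simp add: mult.commute)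
          also have "\<dots> = omega 3 powi (t * 3) * omega 3 powi t" by (rule power_int_add) simp
          finally have "c * omega 3 powi t = c * 1" using c by (metis mult.assoc mult.right_neutral)
          moreover have "c \<noteq> 0" using c(1) a by auto
          ultimately show False using \<omega> by simp
        qed
        moreover have "\<alpha> = 0" using e(1,2) \<omega> by auto
        ultimately show ?thesis by simp
      qed
    qed (auto simp: u_def v_def)
  next
    case 3
    have s: "int i mod 3 = (int i + s) mod 3" for i using 3(1) by (auto elim!: dvdE)
    have \<omega>: "omega 3 powi (t * k) = 1" for k using omega_powi_eq_1_iff[of 3 "t * k"] 3(2) by simp
    define u v :: "complex vec" where "u = unit_vec 6 0 + unit_vec 6 3" and "v = unit_vec 6 1 + unit_vec 6 4"
    show False
    proof (rule no_eigen[of u v])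
      fix \<alpha> \<beta> :: complex
      let ?w = "\<alpha> \<cdot>\<^sub>v u + \<beta> \<cdot>\<^sub>v v"
      have w: "?w \<in> carrier_vec 6" "?w $ 0 = \<alpha>" "?w $ 1 = \<beta>" "?w $ 3 = \<alpha>" "?w $ 4 = \<beta>"
        by (auto simp: u_def v_def)
      show "\<alpha> = 0 \<and> \<beta> = 0" if "?w = 0\<^sub>v 6" using w(2,3) unfolding that by simp
      show "\<alpha> = 0 \<and> \<beta> = 0" if eq: "\<And>i. i < 6 \<Longrightarrow> (tensor_pauli a s t *\<^sub>v ?w) $ i = c * ?w $ i" for c
      proof -
        have e: "\<alpha> = c * \<alpha>" "\<beta> = c * \<beta>" "a * \<alpha> = c * \<alpha>" "a * \<beta> = c * \<beta>"
          using eq[of 0] eq[of 1] eq[of 3] eq[of 4]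
            act[OF w(1) _ _ _ s, of 0 a t] act[OF w(1) _ _ _ s, of 1 a t]
            act[OF w(1) _ _ _ s, of 3 a t] act[OF w(1) _ _ _ s, of 4 a t]
          unfolding w \<omega> by (auto simp del: index_mult_mat_vec)
        then show ?thesis using 3(3) by (metis mult_cancel_right mult_cancel_right2)
      qed
    qed (auto simp: u_def v_def)
  qed
qed

lemma proj_act_hypersurface:
  assumes p: "p \<in> hypersurface n F"
  shows "proj_act \<one>\<^bsub>PGL n\<^esub> p = p"
    and "g \<in> carrier (PGL n) \<Longrightarrow> h \<in> carrier (PGL n) \<Longrightarrow>
      proj_act (g \<otimes>\<^bsub>PGL n\<^esub> h) p = proj_act g (proj_act h p)"
proof -
  interpret L: group "GL n" by (rule group_GL)
  obtain v where v: "v \<in> carrier_vec n" "p = proj_point v"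
    using p unfolding hypersurface_def by blast
  have "1\<^sub>m n \<in> carrier (GL n)" using L.one_closed by (simp only: GL_simps(2))
  then show "proj_act \<one>\<^bsub>PGL n\<^esub> p = p"
    using v proj_act_mat_class[of "1\<^sub>m n" n v] by (simp flip: mat_class_one)
  assume "g \<in> carrier (PGL n)" "h \<in> carrier (PGL n)"
  then obtain A B where A: "A \<in> carrier (GL n)" "g = mat_class n A" and B: "B \<in> carrier (GL n)" "h = mat_class n B"
    unfolding carrier_PGL by blast
  have AB: "A * B \<in> carrier (GL n)" using L.m_closed[OF A(1) B(1)] by (simp only: GL_simps(1))
  have "A \<in> carrier_mat n n" "B \<in> carrier_mat n n" using A(1) B(1) by (auto simp: GL_simps(3))
  then show "proj_act (g \<otimes>\<^bsub>PGL n\<^esub> h) p = proj_act g (proj_act h p)"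
    using A B AB v by (simp add: mat_class_mult proj_act_mat_class assoc_mult_mat_vec[of _ n n _ n])
qed

lemma acts_effectively_on_cubic:
  assumes F: "cubic_form 6 F" and H: "subgroup H (PGL 6)" "H \<subseteq> {tensor_class a s t | a s t. a \<noteq> 0}"
    and inv: "\<And>g. g \<in> H \<Longrightarrow> proj_act g ` hypersurface 6 F \<subseteq> hypersurface 6 F"
  shows "acts_effectively_on H (hypersurface 6 F)"
proof -
  let ?X = "hypersurface 6 F" and ?f = "\<lambda>g. restrict (proj_act g) (hypersurface 6 F)"
  interpret P: group "PGL 6" by (rule group_PGL)
  interpret H: group "(PGL 6)\<lparr>carrier := H\<rparr>" using H(1) by (rule P.subgroup_imp_group)
  have HP: "g \<in> carrier (PGL 6)" if "g \<in> H" for g using H(1) that by (rule subgroup.mem_carrier)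
  have X: "proj_act g p \<in> ?X" if "g \<in> H" "p \<in> ?X" for g p using inv that by blast
  have cancel: "proj_act (inv\<^bsub>PGL 6\<^esub> g) (proj_act g p) = p" "proj_act g (proj_act (inv\<^bsub>PGL 6\<^esub> g) p) = p"
    if "g \<in> H" "p \<in> ?X" for g p
    using that HP[OF that(1)] by (simp_all flip: proj_act_hypersurface(2)) (simp_all add: proj_act_hypersurface(1))
  have inv_H: "inv\<^bsub>PGL 6\<^esub> g \<in> H" if "g \<in> H" for g using H(1) that by (rule subgroup.m_inv_closed)
  have bij: "?f g \<in> Bij ?X" if "g \<in> H" for g
  proof -
    have "bij_betw (proj_act g) ?X ?X"
      by (rule bij_betw_byWitness[where f' = "proj_act (inv\<^bsub>PGL 6\<^esub> g)"])
         (use that cancel X inv_H in auto)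
    then show ?thesis by (simp add: Bij_def)
  qed
  have "group_hom ((PGL 6)\<lparr>carrier := H\<rparr>) (BijGroup ?X) ?f"
  proof (intro group_hom.intro group_hom_axioms.intro homI H.is_group group_BijGroup)
    fix g assume "g \<in> carrier ((PGL 6)\<lparr>carrier := H\<rparr>)"
    then show "?f g \<in> carrier (BijGroup ?X)" using bij by (simp add: BijGroup_def)
  next
    fix g h assume "g \<in> carrier ((PGL 6)\<lparr>carrier := H\<rparr>)" "h \<in> carrier ((PGL 6)\<lparr>carrier := H\<rparr>)"
    then have gh: "g \<in> H" "h \<in> H" by simp_all
    show "?f (g \<otimes>\<^bsub>(PGL 6)\<lparr>carrier := H\<rparr>\<^esub> h) = ?f g \<otimes>\<^bsub>BijGroup ?X\<^esub> ?f h"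
      using gh bij X HP by (auto simp: BijGroup_def compose_def proj_act_hypersurface(2) fun_eq_iff)
  qed
  moreover have "inj_on ?f H"
  proof (rule inj_onI)
    fix g h assume gh: "g \<in> H" "h \<in> H" "?f g = ?f h"
    have eq: "proj_act g p = proj_act h p" if "p \<in> ?X" for p
      using gh(3) that by (metis restrict_apply')
    have k: "inv\<^bsub>PGL 6\<^esub> h \<otimes>\<^bsub>PGL 6\<^esub> g \<in> H" using inv_H gh H(1) by (simp add: subgroup.m_closed)
    then obtain a s t where ast: "a \<noteq> 0" "inv\<^bsub>PGL 6\<^esub> h \<otimes>\<^bsub>PGL 6\<^esub> g = tensor_class a s t" using H(2) by blast
    have "proj_act (tensor_class a s t) p = p" if "p \<in> ?X" for p
      unfolding ast(2)[symmetric] proj_act_hypersurface(2)[OF that HP[OF inv_H[OF gh(2)]] HP[OF gh(1)]] eq[OF that]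
      using cancel(1)[OF gh(2) that] .
    then have "inv\<^bsub>PGL 6\<^esub> h \<otimes>\<^bsub>PGL 6\<^esub> g = \<one>\<^bsub>PGL 6\<^esub>"
      unfolding ast(2) tensor_class_one[symmetric] by (rule trivial_on_cubic[OF F ast(1)])
    then show "g = h" using gh HP by (metis P.inv_closed P.inv_equality P.inv_inv)
  qed
  ultimately show ?thesis
    unfolding acts_effectively_on_def faithful_action_def group_action_def faithful_action_axioms_def
    using H(1) by simp
qed

lemma tensor_lift_acts_effectively:
  fixes d m i j p r :: nat and \<epsilon> :: complex
  assumes d: "d = 0 \<and> p = 2 \<or> d = 3 \<and> p = 3" and r: "r < 3"
    and m: "(omega m ^ 3) ^ p = 1" "(omega m ^ i) ^ p = \<epsilon>" "\<epsilon> ^ 3 = 1" "(omega m ^ j) ^ p * omega 3 ^ r = 1"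
  shows "\<exists>X. smooth_cubic_fourfold X \<and> acts_effectively_on (tensor_lift m i j) X"
proof (intro exI conjI)
  let ?F = "pauli_cubic d \<epsilon> r"
  have F: "cubic_form 6 ?F" using d by (intro cubic_form_pauli_cubic) auto
  have "\<epsilon> \<noteq> 0" using m(3) by auto
  then have "smooth_form 6 ?F" using d r by (intro smooth_pauli_cubic) auto
  then show "smooth_cubic_fourfold (hypersurface 6 ?F)"
    using F unfolding smooth_cubic_fourfold_def by blast
  let ?S = "{mat_class 6 A | A. A \<in> carrier (GL 6) \<and> (\<forall>w\<in>carrier_vec 6. ?F (A *\<^sub>v w) = ?F w)}"
  have "tensor_class a s t \<in> ?S" if "a \<noteq> 0" "\<And>w. w \<in> carrier_vec 6 \<Longrightarrow> ?F (tensor_pauli a s t *\<^sub>v w) = ?F w" for a s t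
    using that tensor_pauli_GL tensor_class_eq_mat_class by blast
  then have "{tensor_class (omega m ^ 3) 0 0, tensor_class (omega m ^ i) 1 0, tensor_class (omega m ^ j) 0 1} \<subseteq> ?S"
    using pauli_cubic_invariant[OF d r m] by simp
  then have "generate (PGL 6) {tensor_class (omega m ^ 3) 0 0, tensor_class (omega m ^ i) 1 0, tensor_class (omega m ^ j) 0 1} \<subseteq> ?S"
    by (rule group.generate_subgroup_incl[OF group_PGL _ subgroup_invariance])
  then have S: "tensor_lift m i j \<subseteq> ?S" by (simp only: generate_tensor_lift)
  show "acts_effectively_on (tensor_lift m i j) (hypersurface 6 ?F)"
  proof (rule acts_effectively_on_cubic[OF F subgroup_tensor_lift])
    show "tensor_lift m i j \<subseteq> {tensor_class a s t | a s t. a \<noteq> 0}"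
      unfolding tensor_lift_def by fastforce
    fix g assume "g \<in> tensor_lift m i j"
    then obtain A where "g = mat_class 6 A" "A \<in> carrier (GL 6)" "\<And>w. w \<in> carrier_vec 6 \<Longrightarrow> ?F (A *\<^sub>v w) = ?F w"
      using S by blast
    then show "proj_act g ` hypersurface 6 ?F \<subseteq> hypersurface 6 ?F"
      by (simp add: hypersurface_invariant_iff[OF F])
  qed
qed

text \<open>
  The exponent \<open>r = 2 j\<close> is \<open>- j\<close> modulo 3: the weight of the second sum under \<open>W\<close> has to cancel
  the factor \<open>\<omega>\<^sub>3\<^sup>j\<close> that comes from \<open>(1, \<omega>\<^sub>3\<^sub>p\<^sup>j)\<close>.
\<close>

lemma tensor_lift_acts_on_cubic:
  fixes d p i j :: nat
  assumes d: "d = 0 \<and> p = 2 \<or> d = 3 \<and> p = 3" and j: "j < 3"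
  shows "\<exists>X. smooth_cubic_fourfold X \<and> acts_effectively_on (tensor_lift (3 * p) i j) X"
proof (rule tensor_lift_acts_effectively[OF d])
  have p: "p > 0" using d by auto
  have \<omega>p: "omega (3 * p) ^ p = omega 3" using p by (rule omega_power_mult)
  have pow: "(omega (3 * p) ^ k) ^ p = omega 3 ^ k" for k
    unfolding \<omega>p[symmetric] by (simp add: mult.commute flip: power_mult)
  show "(2 * j) mod 3 < 3" by simp
  show "(omega (3 * p) ^ 3) ^ p = 1" unfolding pow by (simp add: omega_power_self)
  show "(omega (3 * p) ^ i) ^ p = omega 3 ^ i" by (rule pow)
  have "(omega 3 ^ i) ^ 3 = (omega 3 ^ 3) ^ i" by (simp add: mult.commute flip: power_mult)
  then show "(omega 3 ^ i) ^ 3 = 1" by (simp add: omega_power_self)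
  have "omega 3 ^ (j + (2 * j) mod 3) = 1"
    using j[unfolded less_3_cases] omega_power_self[of 3]
    by (elim disjE) (simp_all add: power3_eq_cube mult.assoc)
  then show "(omega (3 * p) ^ j) ^ p * omega 3 ^ ((2 * j) mod 3) = 1"
    unfolding pow by (simp add: power_add)
qed

text \<open>
  The Fermat cubic \<open>\<Sum>\<^sub>k x\<^sub>k\<^sup>3 + \<Sum>\<^sub>k y\<^sub>k\<^sup>3\<close> serves for all \<open>i\<close>, \<open>j\<close> at once, since the scalars
  \<open>\<omega>\<^sub>3\<^sup>i\<close> and \<open>\<omega>\<^sub>3\<^sup>j\<close> act trivially on cubic forms in \<open>y\<close>.
\<close>

lemma group_c_acts_on_fermat_cubic:
  "\<exists>X. smooth_cubic_fourfold X \<and> acts_effectively_on (tensor_lift 3 i j) X"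
proof (rule tensor_lift_acts_effectively)
  show "(3::nat) = 0 \<and> (3::nat) = 2 \<or> (3::nat) = 3 \<and> (3::nat) = 3" "(0::nat) < 3" by simp_all
  have pow: "(omega 3 ^ k) ^ 3 = 1" for k
    using omega_power_self[of 3] by (metis power_mult mult.commute power_one zero_less_numeral)
  show "(omega 3 ^ 3) ^ 3 = 1" "(omega 3 ^ i) ^ 3 = 1" "(omega 3 ^ j) ^ 3 * omega 3 ^ 0 = 1"
    by (simp_all only: pow power_0 mult_1_right)
  show "(1::complex) ^ 3 = 1" by simp
qed

section \<open>Classification up to conjugation\<close>

lemma pauli_subgroup_classification:
  assumes G: "cubic_fourfold_automorphism_group G"
    and K: "conjugate_in (PGL 6) G K" "K \<subseteq> D2_tensor_pauli3"
  shows "diagonalizable G \<or>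
    (\<exists>i\<in>{0, 1, 2}. \<exists>j\<in>{0, 1, 2}. K \<subseteq> group_a i j \<or> K \<subseteq> group_b i j)"
proof -
  obtain g where g: "g \<in> carrier (PGL 6)"
    and Kg: "K = (\<lambda>h. g \<otimes>\<^bsub>PGL 6\<^esub> h \<otimes>\<^bsub>PGL 6\<^esub> inv\<^bsub>PGL 6\<^esub> g) ` G"
    using K(1) unfolding conjugate_in_def by blast
  have sub: "subgroup G (PGL 6)"
    using G unfolding cubic_fourfold_automorphism_group_def by blast
  have "diagonalizable K \<or>
    (\<exists>i\<in>{0, 1, 2}. \<exists>j\<in>{0, 1, 2}. K \<subseteq> tensor_lift 9 i j \<or> K \<subseteq> tensor_lift 6 i j)"
  proof (rule classification)
    show "subgroup K (PGL 6)" unfolding Kg by (rule subgroup_conjugate[OF group_PGL sub g])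
    show "K \<subseteq> {tensor_class a s t | a s t. a \<noteq> 0}" using K(2) D2_tensor_pauli3_subset by (rule subset_trans)
    show "a ^ 2 = 1 \<or> a ^ 3 = 1" if "a \<noteq> 0" "tensor_class a 0 0 \<in> K" for a
      using scalar_on_factor_order[OF G g that(1)] that(2) unfolding Kg by blast
  qed
  then show ?thesis
  proof
    assume "diagonalizable K"
    then have "diagonalizable G"
      unfolding Kg by (rule diagonalizable_conjugate[OF subgroup.subset[OF sub] g])
    then show ?thesis by blast
  next
    assume "\<exists>i\<in>{0, 1, 2}. \<exists>j\<in>{0, 1, 2}. K \<subseteq> tensor_lift 9 i j \<or> K \<subseteq> tensor_lift 6 i j"
    then show ?thesis unfolding group_a_eq group_b_eq by (rule disjI2)
  qed
qed

theorem theorem3: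
  shows "(\<forall>G. cubic_fourfold_automorphism_group G \<and>
              comm_group ((PGL 6)\<lparr>carrier := G\<rparr>) \<and>
              (\<exists>K. conjugate_in (PGL 6) G K \<and> K \<subseteq> D2_tensor_pauli3) \<longrightarrow>
            diagonalizable G \<or>
            (\<exists>i\<in>{0, 1, 2}. \<exists>j\<in>{0, 1, 2}. \<exists>K. conjugate_in (PGL 6) G K \<and>
               (K \<subseteq> group_a i j \<or> K \<subseteq> group_b i j \<or> K \<subseteq> group_c i j)))
       \<and> (\<forall>i\<in>{0, 1, 2}. \<forall>j\<in>{0, 1, 2}.
            (\<exists>X. smooth_cubic_fourfold X \<and> acts_effectively_on (group_a i j) X) \<and>
            (\<exists>X. smooth_cubic_fourfold X \<and> acts_effectively_on (group_b i j) X) \<and>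
            (\<exists>X. smooth_cubic_fourfold X \<and> acts_effectively_on (group_c i j) X) \<and>
            (i = 0 \<and> j = 0 \<longrightarrow>
               (PGL 6)\<lparr>carrier := group_a i j\<rparr> \<cong>
               integer_mod_group 3 \<times>\<times> integer_mod_group 3 \<times>\<times> integer_mod_group 3) \<and>
            (\<not> (i = 0 \<and> j = 0) \<longrightarrow>
               (PGL 6)\<lparr>carrier := group_a i j\<rparr> \<cong>
               integer_mod_group 9 \<times>\<times> integer_mod_group 3) \<and>
            (PGL 6)\<lparr>carrier := group_b i j\<rparr> \<cong>
              integer_mod_group 2 \<times>\<times> integer_mod_group 3 \<times>\<times> integer_mod_group 3 \<and>
            (PGL 6)\<lparr>carrier := group_c i j\<rparr> \<cong>
              integer_mod_group 3 \<times>\<times> integer_mod_group 3)"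
proof (intro conjI allI ballI impI)
  fix G assume "cubic_fourfold_automorphism_group G \<and>
              comm_group ((PGL 6)\<lparr>carrier := G\<rparr>) \<and>
              (\<exists>K. conjugate_in (PGL 6) G K \<and> K \<subseteq> D2_tensor_pauli3)"
  then obtain K where "cubic_fourfold_automorphism_group G"
    and K: "conjugate_in (PGL 6) G K" "K \<subseteq> D2_tensor_pauli3" by blast
  then have "diagonalizable G \<or>
      (\<exists>i\<in>{0, 1, 2}. \<exists>j\<in>{0, 1, 2}. K \<subseteq> group_a i j \<or> K \<subseteq> group_b i j)"
    by (rule pauli_subgroup_classification)
  then show "diagonalizable G \<or>
            (\<exists>i\<in>{0, 1, 2}. \<exists>j\<in>{0, 1, 2}. \<exists>K. conjugate_in (PGL 6) G K \<and>
               (K \<subseteq> group_a i j \<or> K \<subseteq> group_b i j \<or> K \<subseteq> group_c i j))"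
    using K(1) by blast
next
  fix i j :: nat
  assume i: "i \<in> {0, 1, 2}" and j: "j \<in> {0, 1, 2}"
  have ij: "i < 3" "j < 3" using i j by auto
  show "\<exists>X. smooth_cubic_fourfold X \<and> acts_effectively_on (group_a i j) X"
    using tensor_lift_acts_on_cubic[of 3 3 j i] ij by (simp add: group_a_eq)
  show "\<exists>X. smooth_cubic_fourfold X \<and> acts_effectively_on (group_b i j) X"
    using tensor_lift_acts_on_cubic[of 0 2 j i] ij by (simp add: group_b_eq)
  show "\<exists>X. smooth_cubic_fourfold X \<and> acts_effectively_on (group_c i j) X"
    using group_c_acts_on_fermat_cubic[of i j] by (simp add: group_c_eq)
  show "(PGL 6)\<lparr>carrier := group_a i j\<rparr> \<cong>
       integer_mod_group 3 \<times>\<times> integer_mod_group 3 \<times>\<times> integer_mod_group 3" if "i = 0 \<and> j = 0"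
    using that group_a_iso_split by simp
  show "(PGL 6)\<lparr>carrier := group_a i j\<rparr> \<cong> integer_mod_group 9 \<times>\<times> integer_mod_group 3"
    if "\<not> (i = 0 \<and> j = 0)"
    using ij that by (rule group_a_iso_nonsplit)
  show "(PGL 6)\<lparr>carrier := group_b i j\<rparr> \<cong>
      integer_mod_group 2 \<times>\<times> integer_mod_group 3 \<times>\<times> integer_mod_group 3"
    by (rule group_b_iso)
  show "(PGL 6)\<lparr>carrier := group_c i j\<rparr> \<cong> integer_mod_group 3 \<times>\<times> integer_mod_group 3"
    by (rule group_c_iso)
qed

end
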